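(* Let $\mathcal R$ be a Rauzy class of irreducible permutations of $m$ symbols, $\mathcal G$ the Rauzy--Veech--Zorich induction map on $\Delta(\mathcal R)$ and $\nu$ its absolutely continuous invariant probability measure. The map $\mathcal G^2:\Delta^+\to\Delta^+$ is exact with respect to $\nu|_{\Delta^+}$; that is, every set in the $\sigma$-algebra $\bigcap_{n\ge1}\mathcal G^{-2n}\mathcal B(\Delta^+)$, where $\mathcal B(\Delta^+)$ is the Borel $\sigma$-algebra of $\Delta^+$, has either zero or full $\nu|_{\Delta^+}$-measure.
   Context: Let $m\ge 2$, $\mathbb R^m_+=\{\lambda\in\mathbb R^m:\lambda_i>0\ \forall i\}$, $|\lambda|=\sum_i\lambda_i$, $\Delta_{m-1}=\{\lambda\in\mathbb R^m_+:|\lambda|=1\}$. A permutation $\pi$ of $\{1,\dots,m\}$ is irreducible if $\pi\{1,\dots,k\}=\{1,\dots,k\}$ only for $k=m$. Let $E$ be the identity matrix and $E_{ij}$ the matrix units. Rauzy operations: $a\pi(j)=\pi(j)$ if $j\le\pi^{-1}m$; $a\pi(j)=\pi(m)$ if $j=\pi^{-1}m+1$; $a\pi(j)=\pi(j-1)$ otherwise. $b\pi(j)=\pi(j)$ if $\pi(j)\le\pi(m)$; $b\pi(j)=\pi(j)+1$ if $\pi(m)<\pi(j)<m$; $b\pi(j)=\pi(m)+1$ if $\pi(j)=m$. Matrices: $A(a,\pi)=\sum_{i=1}^{\pi^{-1}m}E_{ii}+E_{m,\pi^{-1}m+1}+\sum_{i=\pi^{-1}m}^{m-1}E_{i,i+1}$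 and $A(b,\pi)=E+E_{m,\pi^{-1}m}$. A Rauzy class $\mathcal R$ is the set of all permutations obtained from a given irreducible permutation by applying $a$ and $b$ repeatedly. $\Delta(\mathcal R)=\Delta_{m-1}\times\mathcal R$, with Lebesgue measure. $\Delta^+_\pi=\{\lambda\in\Delta_{m-1}:\lambda_{\pi^{-1}m}>\lambda_m\}$, $\Delta^-_\pi=\{\lambda\in\Delta_{m-1}:\lambda_m>\lambda_{\pi^{-1}m}\}$, $\Delta^\pm=\{(\lambda,\pi):\pi\in\mathcal R,\ \lambda\in\Delta_\pi^\pm\}$. Define (almost everywhere) $\mathcal T(\lambda,\pi)=\bigl(\tfrac{A(a,\pi)^{-1}\lambda}{|A(a,\pi)^{-1}\lambda|},a\pi\bigr)$ if $\lambda\in\Delta_\pi^+$ and $\mathcal T(\lambda,\pi)=\bigl(\tfrac{A(b,\pi)^{-1}\lambda}{|A(b,\pi)^{-1}\lambda|},b\pi\bigr)$ if $\lambda\in\Delta_\pi^-$. For $(\lambda,\pi)\in\Delta^{+}$ let $n(\lambda,\pi)=\inf\{k>0:\mathcal T^k(\lambda,\pi)\in\Delta^-\}$, for $(\lambda,\pi)\in\Delta^-$ let $n(\lambda,\pi)=\inf\{k>0:\mathcal T^k(\lambda,\pi)\in\Delta^+\}$, and $\mathcal G(\lambda,\pi)=\mathcal T^{n(\lambda,\pi)}(\lambda,\pi)$. The map $\mathcal G$ exchanges $\Delta^+$ and $\Delta^-$ (up to null sets), and has a unique invariant probability measure $\nu$ absolutely continuous with respect to Lebesgue measure on $\Delta(\mathcal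 R)$; it is ergodic (Zorich). *)

theory Defs
  imports "HOL-Probability.Probability"
begin

text \<open>
  Vectors of $R^m$ are functions \<^typ>\<open>nat \<Rightarrow> real\<close> that are extensional on \<open>{1..m}\<close>, that is, points
  of \<open>PiM {1..m} (\<lambda>_. borel)\<close>. Only the entries with indices in \<open>{1..m}\<close> of a matrix
  \<^typ>\<open>nat \<Rightarrow> nat \<Rightarrow> real\<close> matter. A permutation of \<open>{1..m}\<close> is a function \<open>\<pi>\<close> with
  \<open>\<pi> permutes {1..m}\<close>, so it is the identity outside \<open>{1..m}\<close>, and \<open>inv \<pi>\<close> is its inverse.
\<close>

definition mat_vec :: "nat \<Rightarrow> (nat \<Rightarrow> nat \<Rightarrow> real) \<Rightarrow> (nat \<Rightarrow> real) \<Rightarrow> (nat \<Rightarrow> real)" where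
  "mat_vec m A v = (\<lambda>i\<in>{1..m}. \<Sum>j=1..m. A i j * v j)"

definition mat_id :: "nat \<Rightarrow> nat \<Rightarrow> real" where
  "mat_id i j = of_bool (i = j)"

definition mat_unit :: "nat \<Rightarrow> nat \<Rightarrow> nat \<Rightarrow> nat \<Rightarrow> real" where
  "mat_unit p q i j = of_bool (i = p \<and> j = q)"

definition mat_inverse_of :: "nat \<Rightarrow> (nat \<Rightarrow> nat \<Rightarrow> real) \<Rightarrow> (nat \<Rightarrow> nat \<Rightarrow> real)" where
  "mat_inverse_of m A = (SOME B. \<forall>i\<in>{1..m}. \<forall>j\<in>{1..m}.
     (\<Sum>k=1..m. A i k * B k j) = mat_id i j \<and> (\<Sum>k=1..m. B i k * A k j) = mat_id i j)"

definition coord_sum :: "nat \<Rightarrow> (nat \<Rightarrow> real) \<Rightarrow> real" where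
  "coord_sum m v = (\<Sum>i=1..m. v i)"

definition vec_normalize :: "nat \<Rightarrow> (nat \<Rightarrow> real) \<Rightarrow> (nat \<Rightarrow> real)" where
  "vec_normalize m v = (\<lambda>i\<in>{1..m}. v i / coord_sum m v)"

definition irreducible_perm :: "nat \<Rightarrow> (nat \<Rightarrow> nat) \<Rightarrow> bool" where
  "irreducible_perm m \<pi> \<longleftrightarrow>
     \<pi> permutes {1..m} \<and> (\<forall>k\<in>{1..m}. \<pi> ` {1..k} = {1..k} \<longrightarrow> k = m)"

definition rauzy_a :: "nat \<Rightarrow> (nat \<Rightarrow> nat) \<Rightarrow> (nat \<Rightarrow> nat)" where
  "rauzy_a m \<pi> = (\<lambda>j.
     if j \<notin> {1..m} then j
     else if j \<le> inv \<pi> m then \<pi> j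
     else if j = inv \<pi> m + 1 then \<pi> m
     else \<pi> (j - 1))"

definition rauzy_b :: "nat \<Rightarrow> (nat \<Rightarrow> nat) \<Rightarrow> (nat \<Rightarrow> nat)" where
  "rauzy_b m \<pi> = (\<lambda>j.
     if j \<notin> {1..m} then j
     else if \<pi> j \<le> \<pi> m then \<pi> j
     else if \<pi> j < m then \<pi> j + 1
     else \<pi> m + 1)"

definition rauzy_mat_a :: "nat \<Rightarrow> (nat \<Rightarrow> nat) \<Rightarrow> (nat \<Rightarrow> nat \<Rightarrow> real)" where
  "rauzy_mat_a m \<pi> = (\<lambda>i j.
     (\<Sum>p = 1..inv \<pi> m. mat_unit p p i j)
     + mat_unit m (inv \<pi> m + 1) i j
     + (\<Sum>p = inv \<pi> m..m - 1. mat_unit p (p + 1) i j))"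

definition rauzy_mat_b :: "nat \<Rightarrow> (nat \<Rightarrow> nat) \<Rightarrow> (nat \<Rightarrow> nat \<Rightarrow> real)" where
  "rauzy_mat_b m \<pi> = (\<lambda>i j. mat_id i j + mat_unit m (inv \<pi> m) i j)"

inductive_set rauzy_orbit :: "nat \<Rightarrow> (nat \<Rightarrow> nat) \<Rightarrow> (nat \<Rightarrow> nat) set"
  for m :: nat and \<pi>\<^sub>0 :: "nat \<Rightarrow> nat" where
  start: "\<pi>\<^sub>0 \<in> rauzy_orbit m \<pi>\<^sub>0"
| step_a: "\<pi> \<in> rauzy_orbit m \<pi>\<^sub>0 \<Longrightarrow> rauzy_a m \<pi> \<in> rauzy_orbit m \<pi>\<^sub>0"
| step_b: "\<pi> \<in> rauzy_orbit m \<pi>\<^sub>0 \<Longrightarrow> rauzy_b m \<pi> \<in> rauzy_orbit m \<pi>\<^sub>0"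

definition rauzy_class :: "nat \<Rightarrow> (nat \<Rightarrow> nat) set \<Rightarrow> bool" where
  "rauzy_class m R \<longleftrightarrow> (\<exists>\<pi>\<^sub>0. irreducible_perm m \<pi>\<^sub>0 \<and> R = rauzy_orbit m \<pi>\<^sub>0)"

definition open_simplex :: "nat \<Rightarrow> (nat \<Rightarrow> real) set" where
  "open_simplex m =
     {v \<in> extensional {1..m}. (\<forall>i\<in>{1..m}. 0 < v i) \<and> coord_sum m v = 1}"

text \<open>
  Lebesgue measure on the simplex is $(m-1)$-dimensional Lebesgue measure in the coordinates
  $\lambda_1, \dots, \lambda_{m-1}$; it differs from the Euclidean surface measure only by a constant
  factor.
\<close>

definition simplex_lebesgue :: "nat \<Rightarrow> (nat \<Rightarrow> real) measure" where
  "simplex_lebesgue m =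
     distr
       (restrict_space (PiM {1..m - 1} (\<lambda>_. lborel))
          {x. (\<forall>i\<in>{1..m - 1}. 0 < x i) \<and> (\<Sum>i=1..m - 1. x i) < 1})
       (restrict_space (PiM {1..m} (\<lambda>_. borel)) (open_simplex m))
       (\<lambda>x. x(m := 1 - (\<Sum>i=1..m - 1. x i)))"

definition Delta_lebesgue ::
  "nat \<Rightarrow> (nat \<Rightarrow> nat) set \<Rightarrow> ((nat \<Rightarrow> real) \<times> (nat \<Rightarrow> nat)) measure" where
  "Delta_lebesgue m R = simplex_lebesgue m \<Otimes>\<^sub>M count_space R"

definition simplex_plus :: "nat \<Rightarrow> (nat \<Rightarrow> nat) \<Rightarrow> (nat \<Rightarrow> real) set" where
  "simplex_plus m \<pi> = {v \<in> open_simplex m. v (inv \<pi> m) > v m}"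

definition simplex_minus :: "nat \<Rightarrow> (nat \<Rightarrow> nat) \<Rightarrow> (nat \<Rightarrow> real) set" where
  "simplex_minus m \<pi> = {v \<in> open_simplex m. v m > v (inv \<pi> m)}"

definition Delta_plus ::
  "nat \<Rightarrow> (nat \<Rightarrow> nat) set \<Rightarrow> ((nat \<Rightarrow> real) \<times> (nat \<Rightarrow> nat)) set" where
  "Delta_plus m R = {(v, \<pi>). \<pi> \<in> R \<and> v \<in> simplex_plus m \<pi>}"

definition Delta_minus ::
  "nat \<Rightarrow> (nat \<Rightarrow> nat) set \<Rightarrow> ((nat \<Rightarrow> real) \<times> (nat \<Rightarrow> nat)) set" where
  "Delta_minus m R = {(v, \<pi>). \<pi> \<in> R \<and> v \<in> simplex_minus m \<pi>}"

text \<open>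
  \<open>rauzy_T\<close> and \<open>zorich_G\<close> are defined almost everywhere only; both are extended by the identity.
  As an orbit of \<open>rauzy_T\<close> that leaves \<open>\<Delta>\<^sup>+ \<union> \<Delta>\<^sup>-\<close> is constant from then on, the extension creates
  no additional returns.
\<close>

definition rauzy_T ::
  "nat \<Rightarrow> (nat \<Rightarrow> real) \<times> (nat \<Rightarrow> nat) \<Rightarrow> (nat \<Rightarrow> real) \<times> (nat \<Rightarrow> nat)" where
  "rauzy_T m = (\<lambda>(v, \<pi>).
     if v \<in> simplex_plus m \<pi> then
       (vec_normalize m (mat_vec m (mat_inverse_of m (rauzy_mat_a m \<pi>)) v), rauzy_a m \<pi>)
     else if v \<in> simplex_minus m \<pi> then
       (vec_normalize m (mat_vec m (mat_inverse_of m (rauzy_mat_b m \<pi>)) v), rauzy_b m \<pi>)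
     else (v, \<pi>))"

definition return_times ::
  "nat \<Rightarrow> (nat \<Rightarrow> nat) set \<Rightarrow> (nat \<Rightarrow> real) \<times> (nat \<Rightarrow> nat) \<Rightarrow> nat set" where
  "return_times m R x =
     {k. 0 < k \<and> (x \<in> Delta_plus m R \<and> (rauzy_T m ^^ k) x \<in> Delta_minus m R \<or>
                 x \<in> Delta_minus m R \<and> (rauzy_T m ^^ k) x \<in> Delta_plus m R)}"

definition zorich_G ::
  "nat \<Rightarrow> (nat \<Rightarrow> nat) set \<Rightarrow>
     (nat \<Rightarrow> real) \<times> (nat \<Rightarrow> nat) \<Rightarrow> (nat \<Rightarrow> real) \<times> (nat \<Rightarrow> nat)" where
  "zorich_G m R x =
     (if return_times m R x = {} then x else (rauzy_T m ^^ Inf (return_times m R x)) x)"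

text \<open>
  The part of \<open>\<Delta>\<^sup>+\<close> on which all iterates of \<open>\<G>\<close> are defined without recourse to the extension. It
  contains every \<open>(v, \<pi>) \<in> \<Delta>\<^sup>+\<close> with rationally independent coordinates of \<open>v\<close>, hence has full
  Lebesgue measure in \<open>\<Delta>\<^sup>+\<close>, and \<open>\<G>\<^sup>2\<close> maps it to itself.
\<close>

definition Delta_plus_regular ::
  "nat \<Rightarrow> (nat \<Rightarrow> nat) set \<Rightarrow> ((nat \<Rightarrow> real) \<times> (nat \<Rightarrow> nat)) set" where
  "Delta_plus_regular m R =
     {x \<in> Delta_plus m R. \<forall>n. return_times m R ((zorich_G m R ^^ n) x) \<noteq> {}}"

definition zorich_measure ::
  "nat \<Rightarrow> (nat \<Rightarrow> nat) set \<Rightarrow> ((nat \<Rightarrow> real) \<times> (nat \<Rightarrow> nat)) measure \<Rightarrow> bool" where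
  "zorich_measure m R \<nu> \<longleftrightarrow>
     sets \<nu> = sets (Delta_lebesgue m R) \<and>
     prob_space \<nu> \<and>
     absolutely_continuous (Delta_lebesgue m R) \<nu> \<and>
     (\<forall>A\<in>sets \<nu>. emeasure \<nu> (zorich_G m R -` A \<inter> space \<nu>) = emeasure \<nu> A)"

text \<open>
  The $\sigma$-algebra $\bigcap_{n \ge 1} \mathcal{G}^{-2n} \mathcal{B}(\Delta^+)$. On
  \<^const>\<open>Delta_plus_regular\<close>, \<open>vimage_algebra\<close> consists exactly of the preimages of Borel sets.
\<close>

definition tail_sets ::
  "nat \<Rightarrow> (nat \<Rightarrow> nat) set \<Rightarrow> ((nat \<Rightarrow> real) \<times> (nat \<Rightarrow> nat)) set set" where
  "tail_sets m R =
     (\<Inter>n\<in>{1..}. sets (vimage_algebra (Delta_plus_regular m R) (zorich_G m R ^^ (2 * n))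
                    (restrict_space (Delta_lebesgue m R) (Delta_plus m R))))"

end

theory Submission
  imports Defs "HOL-Library.Sublist"
begin

text \<open>
  Almost every orbit of \<open>\<T>\<close> never meets the boundary \<open>\<lambda>\<^sub>m = \<lambda>\<^bsub>\<pi>\<^sup>-\<^sup>1m\<^esub>\<close>. Along such an orbit every letter wins
  infinitely often, so some initial word \<open>q\<close> has a positive matrix. By Poincare recurrence \<open>q\<close> is repeated
  infinitely often for \<open>\<nu>\<close>-almost every point, hence the cylinders around the point shrink to it.

  If a tail set \<open>A\<close> has positive measure, choose such a point that is also a density point of \<open>A\<close>. When
  the orbit returns to the cylinder of \<open>q\<close>, the set \<open>A\<close> fills almost all of the cylinder of a word \<open>w q\<close>, on which the
  inverse branch of \<open>w\<close> has distortion bounded in terms of \<open>q\<close> only. Continuing by fixed words from \<open>q\<close> to all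
  permutations, all with the same number of \<open>\<G>\<^sup>2\<close>-steps, one gets \<open>A = \<G>\<^bsup>-2K\<^esup>B\<close> with \<open>B\<close> almost all of \<open>\<Delta>\<^sup>+\<close>,
  and by invariance \<open>A\<close> itself has almost full measure.
\<close>

subsection \<open>Lebesgue measure on the positive cone and on the simplex\<close>

text \<open>Two obstacles shape the argument. First, the inverse branches of arbitrary words need
  not have uniformly bounded distortion. They come from linear maps that preserve volume, and the
  cone measure of an image is governed by the linear form whose coefficients are the column sums of
  the matrix of \<open>w\<close>. If \<open>M\<close> is the total of all entries, then on vectors
  whose coordinates are all at least \<open>c\<close> times their sum this form lies between
  \<open>c * M\<close> and \<open>M\<close> times the sum. The factor \<open>M\<close> cancels in
  ratios, and for vectors over the cylinder of \<open>q\<close> the constant \<open>c\<close> is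
  read off from the positive matrix of \<open>q\<close>. So the precision required at the density
  point can be fixed before the return time is chosen. Second, a tail set has a different
  \<open>B\<close> for each number of steps. To control one \<open>B\<close> on all slices, the
  words that reach the various permutations must use the same even number of \<G>-steps; this is why
  changes of letter are counted. Smallness is obtained in cone measure and passes to \<nu> by
  absolute continuity; only then does invariance carry it from \<open>B\<close> back to
  \<open>A\<close>.\<close>

abbreviation lebesgue_PiM :: "'i set \<Rightarrow> ('i \<Rightarrow> real) measure" where
  "lebesgue_PiM I \<equiv> PiM I (\<lambda>_. lborel)"

interpretation lborel_product: product_sigma_finite "\<lambda>_::'i. lborel :: real measure"
  by standard

lemma space_lebesgue_PiM: "space (lebesgue_PiM I) = extensional I"
  by (simp add: space_PiM PiE_def)

lemma sets_lebesgue_PiM [measurable_cong]: "sets (lebesgue_PiM I) = sets (PiM I (\<lambda>_. borel))"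
  by (rule sets_PiM_cong) auto

lemma measurable_PiM_shear:
  assumes "i \<in> I" and g [measurable]: "g \<in> borel_measurable (lebesgue_PiM I)"
  shows "(\<lambda>x. x(i := x i + g x)) \<in> measurable (lebesgue_PiM I) (lebesgue_PiM I)"
proof (rule measurable_cong[THEN iffD1])
  show "(\<lambda>j\<in>I. if j = i then x i + g x else x j) = x(i := x i + g x)"
    if "x \<in> space (lebesgue_PiM I)" for x
    using that \<open>i \<in> I\<close> by (auto simp: space_lebesgue_PiM extensional_def)
  show "(\<lambda>x. \<lambda>j\<in>I. if j = i then x i + g x else x j) \<in> measurable (lebesgue_PiM I) (lebesgue_PiM I)"
  proof (rule measurable_restrict)
    fix j assume "j \<in> I"
    then show "(\<lambda>x. if j = i then x i + g x else x j) \<in> measurable (lebesgue_PiM I) lborel"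
      using \<open>i \<in> I\<close> by (cases "j = i") measurable
  qed
qed

text \<open>Fubini in direction \<open>i\<close>: once the other coordinates are fixed,
  \<open>g\<close> is a constant because of \<open>indep\<close>, and the shear becomes a
  translation of the line.\<close>

lemma emeasure_lebesgue_PiM_shear:
  assumes "finite I" "i \<in> I" and g: "g \<in> borel_measurable (lebesgue_PiM I)"
    and indep: "\<And>x y. x \<in> extensional I \<Longrightarrow> g (x(i := y)) = g x"
    and A: "A \<in> sets (lebesgue_PiM I)"
  shows "emeasure (lebesgue_PiM I) {x \<in> extensional I. x(i := x i + g x) \<in> A}
    = emeasure (lebesgue_PiM I) A"
proof -
  define J where "J = I - {i}"
  have J: "finite J" "i \<notin> J" "I = insert i J" using assms by (auto simp: J_def)
  note [measurable] = A g
  note [measurable] = measurable_PiM_shear[OF \<open>i \<in> I\<close> g]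
  have B: "{x \<in> extensional I. x(i := x i + g x) \<in> A} \<in> sets (lebesgue_PiM I)"
    unfolding space_lebesgue_PiM[symmetric] by measurable
  have ext: "x(i := y) \<in> extensional I" if "x \<in> extensional J" for x y
    using that J by (auto simp: extensional_def)
  have "emeasure (lebesgue_PiM I) {x \<in> extensional I. x(i := x i + g x) \<in> A}
     = (\<integral>\<^sup>+x. indicator {x \<in> extensional I. x(i := x i + g x) \<in> A} x \<partial>lebesgue_PiM I)"
    using B by simp
  also have "\<dots> = (\<integral>\<^sup>+x. \<integral>\<^sup>+y. indicator {x \<in> extensional I. x(i := x i + g x) \<in> A} (x(i := y)) \<partial>lborel \<partial>lebesgue_PiM J)"
    using B unfolding J(3) by (intro lborel_product.product_nn_integral_insert J) auto
  also have "\<dots> = (\<integral>\<^sup>+x. \<integral>\<^sup>+y. indicator A (x(i := y)) \<partial>lborel \<partial>lebesgue_PiM J)"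
  proof (rule nn_integral_cong)
    fix x assume "x \<in> space (lebesgue_PiM J)"
    then have x: "x \<in> extensional J" by (simp add: space_lebesgue_PiM)
    define c where "c = g (x(i := 0))"
    have c: "g (x(i := y)) = c" for y
      using indep[OF ext[OF x], of 0 y] by (simp add: c_def)
    have m: "(\<lambda>y. indicator A (x(i := y)) :: ennreal) \<in> borel_measurable borel"
    proof -
      have "(\<lambda>y. x(i := y)) \<in> measurable borel (lebesgue_PiM I)"
        using measurable_component_update[of x J "\<lambda>_. lborel" i] x J by (simp add: space_lebesgue_PiM)
      from measurable_compose[OF this borel_measurable_indicator[OF A]] show ?thesis .
    qed
    have "(\<integral>\<^sup>+y. indicator {x \<in> extensional I. x(i := x i + g x) \<in> A} (x(i := y)) \<partial>lborel)
       = (\<integral>\<^sup>+y. indicator A (x(i := c + 1 * y)) \<partial>lborel)"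
      using ext[OF x] by (intro nn_integral_cong) (auto simp: indicator_def c add.commute)
    also have "\<dots> = (\<integral>\<^sup>+y. indicator A (x(i := y)) \<partial>lborel)"
      using nn_integral_real_affine[OF m, of 1 c] by simp
    finally show "(\<integral>\<^sup>+y. indicator {x \<in> extensional I. x(i := x i + g x) \<in> A} (x(i := y)) \<partial>lborel)
       = (\<integral>\<^sup>+y. indicator A (x(i := y)) \<partial>lborel)" .
  qed
  also have "\<dots> = (\<integral>\<^sup>+x. indicator A x \<partial>lebesgue_PiM I)"
    using A unfolding J(3) by (intro lborel_product.product_nn_integral_insert[symmetric] J) auto
  also have "\<dots> = emeasure (lebesgue_PiM I) A" using A by simp
  finally show ?thesis .
qed

text \<open>A product measure is determined by its values on boxes. The push-forward, multiplied by
  \<open>c ^ card I\<close>, has the right values there because each side contributes a factor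
  \<open>1 / c\<close>.\<close>

lemma emeasure_lebesgue_PiM_scale:
  assumes "finite I" "c > 0" and A: "A \<in> sets (lebesgue_PiM I)"
  shows "emeasure (lebesgue_PiM I) {x \<in> extensional I. (\<lambda>i\<in>I. c * x i) \<in> A}
    = ennreal ((1 / c) ^ card I) * emeasure (lebesgue_PiM I) A"
proof -
  let ?f = "\<lambda>x. \<lambda>i\<in>I. c * x i"
  have f: "?f \<in> measurable (lebesgue_PiM I) (lebesgue_PiM I)" by measurable
  define P where "P = scale_measure (ennreal (c ^ card I)) (distr (lebesgue_PiM I) (lebesgue_PiM I) ?f)"
  have "P = lebesgue_PiM I"
  proof (rule lborel_product.PiM_eqI)
    fix B :: "'a \<Rightarrow> real set" assume B: "\<And>i. i \<in> I \<Longrightarrow> B i \<in> sets lborel"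
    have e: "emeasure lborel ((\<lambda>x. c * x) -` B i) = ennreal (1 / c) * emeasure lborel (B i)" if "i \<in> I" for i
    proof -
      have "emeasure lborel ((\<lambda>x. c * x) -` B i) = emeasure (distr lborel borel (\<lambda>x. c * x)) (B i)"
        using B[OF that] by (subst emeasure_distr) auto
      also have "\<dots> = ennreal (1 / c) * emeasure lborel (B i)"
        using \<open>c > 0\<close> B[OF that] by (subst lborel_distr_mult) (auto simp: emeasure_density nn_integral_cmult inverse_eq_divide)
      finally show ?thesis .
    qed
    have vm: "(\<lambda>x. c * x) -` B i \<in> sets borel" if "i \<in> I" for i
      using B[OF that] by (auto intro!: measurable_sets_borel[of _ borel])
    have "?f -` Pi\<^sub>E I B \<inter> space (lebesgue_PiM I) = Pi\<^sub>E I (\<lambda>i. (\<lambda>x. c * x) -` B i)"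
      by (auto simp: space_lebesgue_PiM PiE_def Pi_def)
    then have "emeasure P (Pi\<^sub>E I B) = ennreal (c ^ card I) * emeasure (lebesgue_PiM I) (Pi\<^sub>E I (\<lambda>i. (\<lambda>x. c * x) -` B i))"
      unfolding P_def using B assms f by (simp add: emeasure_distr sets_PiM_I_finite)
    also have "emeasure (lebesgue_PiM I) (Pi\<^sub>E I (\<lambda>i. (\<lambda>x. c * x) -` B i)) = (\<Prod>i\<in>I. ennreal (1 / c) * emeasure lborel (B i))"
      using B assms by (subst lborel_product.emeasure_PiM) (auto simp: e vm intro!: prod.cong)
    also have "\<dots> = ennreal ((1 / c) ^ card I) * (\<Prod>i\<in>I. emeasure lborel (B i))"
      using \<open>c > 0\<close> by (simp add: prod.distrib ennreal_power)
    also have "ennreal (c ^ card I) * \<dots> = (\<Prod>i\<in>I. emeasure lborel (B i))"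
      using \<open>c > 0\<close> by (simp add: mult.assoc[symmetric] ennreal_mult[symmetric] power_mult_distrib[symmetric])
    finally show "emeasure P (Pi\<^sub>E I B) = (\<Prod>i\<in>I. emeasure lborel (B i))" .
  qed (use assms in \<open>auto simp: P_def\<close>)
  then have "emeasure (lebesgue_PiM I) A = ennreal (c ^ card I) * emeasure (distr (lebesgue_PiM I) (lebesgue_PiM I) ?f) A"
    by (metis P_def emeasure_scale_measure)
  also have "emeasure (distr (lebesgue_PiM I) (lebesgue_PiM I) ?f) A = emeasure (lebesgue_PiM I) {x \<in> extensional I. ?f x \<in> A}"
    using A f by (subst emeasure_distr) (auto simp: space_lebesgue_PiM intro!: arg_cong[where f="emeasure _"])
  finally show ?thesis
    using \<open>c > 0\<close> by (simp add: mult.assoc[symmetric] ennreal_mult[symmetric] power_mult_distrib[symmetric])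
qed

lemma emeasure_lebesgue_PiM_permute:
  assumes "finite I" "\<sigma> permutes I" and A: "A \<in> sets (lebesgue_PiM I)"
  shows "emeasure (lebesgue_PiM I) {x \<in> extensional I. (\<lambda>i\<in>I. x (\<sigma> i)) \<in> A}
    = emeasure (lebesgue_PiM I) A"
proof -
  let ?f = "\<lambda>x. \<lambda>i\<in>I. x (\<sigma> i) :: real"
  have \<sigma>: "\<sigma> i \<in> I" if "i \<in> I" for i using assms(2) that by (simp add: permutes_in_image)
  have f: "?f \<in> measurable (lebesgue_PiM I) (lebesgue_PiM I)" using \<sigma> by measurable
  have "distr (lebesgue_PiM I) (lebesgue_PiM I) ?f = lebesgue_PiM I"
  proof (rule lborel_product.PiM_eqI)
    fix B :: "'a \<Rightarrow> real set" assume B: "\<And>i. i \<in> I \<Longrightarrow> B i \<in> sets lborel"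
    have "?f -` Pi\<^sub>E I B \<inter> space (lebesgue_PiM I) = Pi\<^sub>E I (\<lambda>i. B (inv \<sigma> i))"
    proof (intro equalityI subsetI)
      fix x assume x: "x \<in> ?f -` Pi\<^sub>E I B \<inter> space (lebesgue_PiM I)"
      have "x i \<in> B (inv \<sigma> i)" if "i \<in> I" for i
      proof -
        have "inv \<sigma> i \<in> I" "\<sigma> (inv \<sigma> i) = i"
          using assms(2) that by (simp_all add: permutes_inverses permutes_in_image permutes_inv)
        then show ?thesis using x by (auto simp: PiE_def Pi_def dest!: bspec[of _ _ "inv \<sigma> i"])
      qed
      then show "x \<in> Pi\<^sub>E I (\<lambda>i. B (inv \<sigma> i))" using x by (auto simp: space_lebesgue_PiM PiE_def)
    next
      fix x assume x: "x \<in> Pi\<^sub>E I (\<lambda>i. B (inv \<sigma> i))"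
      have "x (\<sigma> i) \<in> B i" if "i \<in> I" for i
        using x \<sigma>[OF that] permutes_inverses(2)[OF assms(2), of i] by (auto simp: PiE_def Pi_def dest!: bspec[of _ _ "\<sigma> i"])
      then show "x \<in> ?f -` Pi\<^sub>E I B \<inter> space (lebesgue_PiM I)" using x by (auto simp: space_lebesgue_PiM PiE_def)
    qed
    then have "emeasure (distr (lebesgue_PiM I) (lebesgue_PiM I) ?f) (Pi\<^sub>E I B)
        = emeasure (lebesgue_PiM I) (Pi\<^sub>E I (\<lambda>i. B (inv \<sigma> i)))"
      using B assms f by (simp add: emeasure_distr sets_PiM_I_finite)
    also have "\<dots> = (\<Prod>i\<in>I. emeasure lborel (B (inv \<sigma> i)))"
      using B assms by (subst lborel_product.emeasure_PiM) (auto simp: permutes_in_image permutes_inv)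
    also have "\<dots> = (\<Prod>i\<in>I. emeasure lborel (B i))"
      using prod.permute[OF permutes_inv[OF assms(2)], of "\<lambda>i. emeasure lborel (B i)"] by (simp add: comp_def)
    finally show "emeasure (distr (lebesgue_PiM I) (lebesgue_PiM I) ?f) (Pi\<^sub>E I B) = (\<Prod>i\<in>I. emeasure lborel (B i))" .
  qed (use assms in auto)
  then have "emeasure (lebesgue_PiM I) A = emeasure (distr (lebesgue_PiM I) (lebesgue_PiM I) ?f) A" by simp
  also have "\<dots> = emeasure (lebesgue_PiM I) {x \<in> extensional I. ?f x \<in> A}"
    using A f by (subst emeasure_distr) (auto simp: space_lebesgue_PiM intro!: arg_cong[where f="emeasure _"])
  finally show ?thesis by simp
qed

text \<open>Subtracting coordinate \<open>j\<close> from coordinate \<open>i\<close> is a shear that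
  carries the diagonal to the hyperplane \<open>x i = 0\<close>, a box with a null side. The
  boundaries on which \<open>rauzy_T\<close> falls back on the identity are of this kind.\<close>

lemma null_sets_lebesgue_PiM_diagonal:
  assumes "finite I" "i \<in> I" "j \<in> I" "i \<noteq> j"
  shows "{x \<in> extensional I. x i = x j} \<in> null_sets (lebesgue_PiM I)"
proof -
  let ?B = "\<lambda>k. if k = i then {0} else UNIV :: real set"
  have eq: "Pi\<^sub>E I ?B = {x \<in> extensional I. x i = 0}" using assms by (auto simp: PiE_def Pi_def split: if_splits)
  have "emeasure (lebesgue_PiM I) (Pi\<^sub>E I ?B) = 0"
    using assms by (subst lborel_product.emeasure_PiM) (auto intro!: prod_zero bexI[of _ i])
  moreover have S: "Pi\<^sub>E I ?B \<in> sets (lebesgue_PiM I)"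
    using assms by (intro sets_PiM_I_finite) auto
  ultimately have "emeasure (lebesgue_PiM I) {x \<in> extensional I. x(i := x i + (- x j)) \<in> Pi\<^sub>E I ?B} = 0"
    using assms by (subst emeasure_lebesgue_PiM_shear) auto
  also have "{x \<in> extensional I. x(i := x i + (- x j)) \<in> Pi\<^sub>E I ?B} = {x \<in> extensional I. x i = x j}"
    unfolding eq using assms by (auto simp: extensional_def)
  finally have "emeasure (lebesgue_PiM I) {x \<in> extensional I. x i = x j} = 0" .
  moreover have "{x \<in> space (lebesgue_PiM I). x i = x j} \<in> sets (lebesgue_PiM I)"
    using assms by measurable
  ultimately show ?thesis by (simp add: null_sets_def space_lebesgue_PiM)
qed

section \<open>Cones over subsets of the simplex and their volume\<close>

definition pos_cone :: "nat \<Rightarrow> (nat \<Rightarrow> real) set" where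
  "pos_cone m = {v \<in> extensional {1..m}. \<forall>i\<in>{1..m}. 0 < v i}"

definition cone_over :: "nat \<Rightarrow> (nat \<Rightarrow> real) set \<Rightarrow> (nat \<Rightarrow> real) set" where
  "cone_over m B = {v \<in> pos_cone m. vec_normalize m v \<in> B}"

definition sub_simplex :: "nat \<Rightarrow> (nat \<Rightarrow> real) set" where
  "sub_simplex m = {v \<in> pos_cone m. coord_sum m v \<le> 1}"

abbreviation simplex_borel :: "nat \<Rightarrow> (nat \<Rightarrow> real) measure" where
  "simplex_borel m \<equiv> restrict_space (PiM {1..m} (\<lambda>_. borel)) (open_simplex m)"

text \<open>
  The maps on the simplex are projectivizations of linear maps of determinant \<open>\<plusminus>1\<close>. Measuring a set
  by the volume of the cone over it makes their distortion a matter of column sums.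
\<close>

definition cone_measure :: "nat \<Rightarrow> (nat \<Rightarrow> real) measure" where
  "cone_measure m = distr (restrict_space (lebesgue_PiM {1..m}) (sub_simplex m)) (simplex_borel m) (vec_normalize m)"

lemma pos_cone_sets: "pos_cone m \<in> sets (lebesgue_PiM {1..m})"
proof -
  have "{v \<in> space (lebesgue_PiM {1..m}). \<forall>i\<in>{1..m}. 0 < v i} \<in> sets (lebesgue_PiM {1..m})"
    by measurable
  then show ?thesis by (simp add: pos_cone_def space_lebesgue_PiM)
qed

lemma coord_sum_measurable [measurable]: "coord_sum m \<in> borel_measurable (lebesgue_PiM {1..m})"
  unfolding coord_sum_def by measurable

lemma vec_normalize_measurable: "vec_normalize m \<in> measurable (lebesgue_PiM {1..m}) (PiM {1..m} (\<lambda>_. borel))"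
proof -
  have [measurable]: "(\<lambda>v. \<Sum>i = 1..m. v i) \<in> borel_measurable (lebesgue_PiM {1..m})" by measurable
  show ?thesis unfolding vec_normalize_def coord_sum_def by measurable
qed

lemma sub_simplex_sets: "sub_simplex m \<in> sets (lebesgue_PiM {1..m})"
proof -
  have "{v \<in> space (lebesgue_PiM {1..m}). coord_sum m v \<le> 1} \<in> sets (lebesgue_PiM {1..m})"
    by measurable
  moreover have "sub_simplex m = pos_cone m \<inter> {v \<in> space (lebesgue_PiM {1..m}). coord_sum m v \<le> 1}"
    by (auto simp: sub_simplex_def pos_cone_def space_lebesgue_PiM)
  ultimately show ?thesis using pos_cone_sets by auto
qed

lemma open_simplex_sets: "open_simplex m \<in> sets (PiM {1..m} (\<lambda>_. borel))"
proof -
  have "{v \<in> space (lebesgue_PiM {1..m}). coord_sum m v = 1} \<in> sets (lebesgue_PiM {1..m})"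
    by measurable
  moreover have "open_simplex m = pos_cone m \<inter> {v \<in> space (lebesgue_PiM {1..m}). coord_sum m v = 1}"
    by (auto simp: open_simplex_def pos_cone_def space_lebesgue_PiM)
  ultimately show ?thesis using pos_cone_sets by (auto simp: sets_lebesgue_PiM)
qed

lemma space_simplex_borel: "space (simplex_borel m) = open_simplex m"
  using sets.sets_into_space[OF open_simplex_sets[of m]] by (auto simp: space_restrict_space)

lemma coord_sum_pos: "v \<in> pos_cone m \<Longrightarrow> m \<ge> 1 \<Longrightarrow> coord_sum m v > 0"
  unfolding coord_sum_def pos_cone_def by (rule sum_pos) auto

lemma open_simplex_eq: "open_simplex m = {v \<in> pos_cone m. coord_sum m v = 1}"
  by (auto simp: open_simplex_def pos_cone_def)

lemma vec_normalize_pos_cone: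
  assumes "v \<in> pos_cone m" "m \<ge> 1"
  shows "vec_normalize m v \<in> open_simplex m"
  using coord_sum_pos[OF assms] assms
  by (auto simp: open_simplex_def vec_normalize_def pos_cone_def coord_sum_def sum_divide_distrib[symmetric])

lemma vec_normalize_id: "v \<in> open_simplex m \<Longrightarrow> vec_normalize m v = v"
  by (auto simp: open_simplex_def vec_normalize_def extensional_def)

lemma cone_over_sets:
  assumes "m \<ge> 1" "B \<in> sets (simplex_borel m)"
  shows "cone_over m B \<in> sets (lebesgue_PiM {1..m})"
proof -
  have "B \<in> sets (PiM {1..m} (\<lambda>_. borel))"
    using assms(2) open_simplex_sets by (auto simp: sets_restrict_space)
  from measurable_sets[OF vec_normalize_measurable this] pos_cone_sets[of m]
  have "pos_cone m \<inter> (vec_normalize m -` B \<inter> space (lebesgue_PiM {1..m})) \<in> sets (lebesgue_PiM {1..m})" by blast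
  also have "pos_cone m \<inter> (vec_normalize m -` B \<inter> space (lebesgue_PiM {1..m})) = cone_over m B"
    by (auto simp: cone_over_def pos_cone_def space_lebesgue_PiM)
  finally show ?thesis .
qed

lemma vec_normalize_measurable_simplex:
  assumes "m \<ge> 1"
  shows "vec_normalize m \<in> measurable (restrict_space (lebesgue_PiM {1..m}) (sub_simplex m)) (simplex_borel m)"
  using vec_normalize_pos_cone assms
  by (intro measurable_restrict_space2 measurable_restrict_space1 vec_normalize_measurable)
     (auto simp: space_restrict_space sub_simplex_def)

lemma sets_cone_measure [simp]: "sets (cone_measure m) = sets (simplex_borel m)"
  by (simp add: cone_measure_def)

lemma emeasure_cone_measure:
  assumes "m \<ge> 1" "B \<in> sets (simplex_borel m)"
  shows "emeasure (cone_measure m) B = emeasure (lebesgue_PiM {1..m}) (cone_over m B \<inter> {v. coord_sum m v \<le> 1})"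
proof -
  have "emeasure (cone_measure m) B = emeasure (restrict_space (lebesgue_PiM {1..m}) (sub_simplex m))
     (vec_normalize m -` B \<inter> space (restrict_space (lebesgue_PiM {1..m}) (sub_simplex m)))"
    unfolding cone_measure_def using assms
    by (intro emeasure_distr vec_normalize_measurable_simplex) auto
  also have "\<dots> = emeasure (lebesgue_PiM {1..m}) (vec_normalize m -` B \<inter> space (restrict_space (lebesgue_PiM {1..m}) (sub_simplex m)))"
    using sub_simplex_sets[of m] by (intro emeasure_restrict_space) (auto simp: space_restrict_space)
  also have "vec_normalize m -` B \<inter> space (restrict_space (lebesgue_PiM {1..m}) (sub_simplex m)) = cone_over m B \<inter> {v. coord_sum m v \<le> 1}"
    by (auto simp: space_restrict_space space_lebesgue_PiM sub_simplex_def cone_over_def pos_cone_def)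
  finally show ?thesis .
qed

lemma finite_measure_cone_measure:
  assumes "m \<ge> 1"
  shows "finite_measure (cone_measure m)"
proof (rule finite_measureI)
  have "emeasure (cone_measure m) (space (cone_measure m)) \<le> emeasure (lebesgue_PiM {1..m}) (Pi\<^sub>E {1..m} (\<lambda>_. {0..1}))"
  proof -
    have "cone_over m (space (simplex_borel m)) \<inter> {v. coord_sum m v \<le> 1} \<subseteq> Pi\<^sub>E {1..m} (\<lambda>_. {0..1})"
    proof
      fix v assume v: "v \<in> cone_over m (space (simplex_borel m)) \<inter> {v. coord_sum m v \<le> 1}"
      have "v i \<le> coord_sum m v" if "i \<in> {1..m}" for i
        unfolding coord_sum_def using v that by (intro member_le_sum) (auto simp: cone_over_def pos_cone_def less_imp_le)
      then show "v \<in> Pi\<^sub>E {1..m} (\<lambda>_. {0..1})" using v by (force simp: cone_over_def pos_cone_def PiE_def less_imp_le)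
    qed
    then show ?thesis
      unfolding cone_measure_def space_distr
      by (subst cone_measure_def[symmetric], subst emeasure_cone_measure[OF assms])
         (auto intro!: emeasure_mono sets_PiM_I_finite)
  qed
  also have "emeasure (lebesgue_PiM {1..m}) (Pi\<^sub>E {1..m} (\<lambda>_. {0..1})) = 1"
    by (subst lborel_product.emeasure_PiM) auto
  finally show "emeasure (cone_measure m) (space (cone_measure m)) \<noteq> \<infinity>" by (auto simp: top_unique)
qed

text \<open>After a shear that makes the coordinate sum the last coordinate, the section of the cone
  at height \<open>y\<close> is \<open>y\<close> times the trace of \<open>B\<close> in the first
  \<open>m - 1\<close> coordinates. If the cone is null, Fubini gives a null section at some
  \<open>y\<close> between 0 and 1, and rescaling shows that \<open>B\<close> is null for Lebesgue
  measure on the simplex.\<close>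

lemma absolutely_continuous_cone_measure:
  assumes "m \<ge> 2"
  shows "absolutely_continuous (cone_measure m) (simplex_lebesgue m)"
  unfolding absolutely_continuous_def
proof
  fix B assume "B \<in> null_sets (cone_measure m)"
  then have B: "B \<in> sets (simplex_borel m)" and z: "emeasure (cone_measure m) B = 0" by auto
  define J where "J = {1..m - 1}"
  have J: "finite J" "m \<notin> J" "{1..m} = insert m J" using assms by (auto simp: J_def)
  have JI: "{1..m} - {m} = J" using J by auto
  have cs: "coord_sum m v = v m + sum v J" for v
    unfolding coord_sum_def J(3) using J by simp
  define C where "C = cone_over m B \<inter> {v. coord_sum m v \<le> 1}"
  have m1: "m \<ge> 1" using assms by simp
  have C: "C \<in> sets (lebesgue_PiM {1..m})"
  proof -
    have "C = cone_over m B \<inter> {v \<in> space (lebesgue_PiM {1..m}). coord_sum m v \<le> 1}"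
      by (auto simp: C_def cone_over_def pos_cone_def space_lebesgue_PiM)
    moreover have "{v \<in> space (lebesgue_PiM {1..m}). coord_sum m v \<le> 1} \<in> sets (lebesgue_PiM {1..m})" by measurable
    ultimately show ?thesis using cone_over_sets[OF m1 B] by auto
  qed
  define g where "g x = - sum x J" for x :: "nat \<Rightarrow> real"
  have g: "g \<in> borel_measurable (lebesgue_PiM {1..m})"
    unfolding g_def using J by (intro borel_measurable_uminus borel_measurable_sum) auto
  \<comment> \<open>In \<open>C'\<close> the last coordinate records the coordinate sum of the
    corresponding vector of \<open>C\<close>.\<close>
  define C' where "C' = {x \<in> extensional {1..m}. x(m := x m + g x) \<in> C}"
  have gi: "g (x(m := y)) = g x" for x y
    unfolding g_def using J by (auto intro!: sum.cong)
  have "emeasure (lebesgue_PiM {1..m}) C' = emeasure (lebesgue_PiM {1..m}) C"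
    unfolding C'_def using assms gi g C by (intro emeasure_lebesgue_PiM_shear) auto
  also have "\<dots> = 0" using z emeasure_cone_measure[OF m1 B] by (simp add: C_def)
  finally have C'0: "emeasure (lebesgue_PiM {1..m}) C' = 0" .
  have C'S: "C' \<in> sets (lebesgue_PiM {1..m})"
    using measurable_sets[OF measurable_PiM_shear[OF _ g, of m] C] assms
    by (simp add: C'_def space_lebesgue_PiM vimage_def Int_def conj_commute)
  have "0 = (\<integral>\<^sup>+x. indicator C' x \<partial>lebesgue_PiM {1..m})" using C'0 C'S by simp
  also have "\<dots> = (\<integral>\<^sup>+y. \<integral>\<^sup>+x. indicator C' (x(m := y)) \<partial>lebesgue_PiM J \<partial>lborel)"
    using C'S unfolding J(3) by (intro lborel_product.product_nn_integral_insert_rev J) auto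
  finally have "(\<integral>\<^sup>+y. \<integral>\<^sup>+x. indicator C' (x(m := y)) \<partial>lebesgue_PiM J \<partial>lborel) = 0" by simp
  moreover have "(\<lambda>y. \<integral>\<^sup>+x. indicator C' (x(m := y)) \<partial>lebesgue_PiM J) \<in> borel_measurable lborel"
  proof -
    interpret sigma_finite_measure "lebesgue_PiM J" by (rule lborel_product.sigma_finite) fact
    have [measurable]: "C' \<in> sets (lebesgue_PiM (insert m J))" using C'S J by simp
    show ?thesis by measurable
  qed
  ultimately have "AE y in lborel. (\<integral>\<^sup>+x. indicator C' (x(m := y)) \<partial>lebesgue_PiM J) = 0"
    by (subst (asm) nn_integral_0_iff_AE) auto
  moreover have "\<not> (AE y in lborel. \<not> (0 < y \<and> y < (1::real)))"
  proof
    assume "AE y in lborel. \<not> (0 < y \<and> y < (1::real))"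
    then have "{0<..<1::real} \<in> null_sets lborel"
      by (subst AE_iff_null_sets) auto
    then show False by auto
  qed
  ultimately obtain y :: real where y: "0 < y" "y < 1" "(\<integral>\<^sup>+x. indicator C' (x(m := y)) \<partial>lebesgue_PiM J) = 0"
    by (metis (mono_tags, lifting) AE_mp AE_I2)
  define S where "S = {x. (\<forall>i\<in>J. 0 < x i) \<and> (\<Sum>i\<in>J. x i :: real) < 1}"
  define f where "f x = x(m := 1 - (\<Sum>i\<in>J. x i))" for x :: "nat \<Rightarrow> real"
  have S: "S \<inter> space (lebesgue_PiM J) \<in> sets (lebesgue_PiM J)"
  proof -
    have "{x \<in> space (lebesgue_PiM J). (\<forall>i\<in>J. 0 < x i) \<and> (\<Sum>i\<in>J. x i) < 1} \<in> sets (lebesgue_PiM J)"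
      using J(1) by measurable
    also have "{x \<in> space (lebesgue_PiM J). (\<forall>i\<in>J. 0 < x i) \<and> (\<Sum>i\<in>J. x i) < 1} = S \<inter> space (lebesgue_PiM J)"
      by (auto simp: S_def)
    finally show ?thesis .
  qed
  have f: "f \<in> measurable (restrict_space (lebesgue_PiM J) S) (simplex_borel m)"
  proof (rule measurable_restrict_space2)
    show "f \<in> space (restrict_space (lebesgue_PiM J) S) \<rightarrow> open_simplex m"
    proof
      fix x assume x: "x \<in> space (restrict_space (lebesgue_PiM J) S)"
      have "sum (f x) J = sum x J" using J by (auto simp: f_def intro!: sum.cong)
      then have "coord_sum m (f x) = 1" by (simp add: cs) (simp add: f_def)
      then show "f x \<in> open_simplex m"
        using x J unfolding open_simplex_def J(3)
        by (auto simp: f_def S_def space_restrict_space space_lebesgue_PiM extensional_def)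
    qed
    have "f \<in> measurable (lebesgue_PiM J) (PiM {1..m} (\<lambda>_. borel))"
    proof (rule measurable_cong[THEN iffD1])
      show "(\<lambda>j\<in>{1..m}. if j = m then 1 - (\<Sum>i\<in>J. x i) else x j) = f x"
        if "x \<in> space (lebesgue_PiM J)" for x
        using that J by (auto simp: space_lebesgue_PiM extensional_def f_def)
      show "(\<lambda>x. \<lambda>j\<in>{1..m}. if j = m then 1 - (\<Sum>i\<in>J. x i) else x j) \<in> measurable (lebesgue_PiM J) (PiM {1..m} (\<lambda>_. borel))"
      proof (rule measurable_restrict)
        fix j assume "j \<in> {1..m}"
        show "(\<lambda>x. if j = m then 1 - (\<Sum>i\<in>J. x i) else x j) \<in> measurable (lebesgue_PiM J) borel"
        proof (cases "j = m")
          case True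
          have "(\<lambda>x. 1 - (\<Sum>i\<in>J. x i)) \<in> borel_measurable (lebesgue_PiM J)"
            using J(1) by measurable
          with True show ?thesis by (simp only: refl if_True)
        next
          case False
          then have "j \<in> J" using \<open>j \<in> {1..m}\<close> unfolding J(3) by simp
          then have "(\<lambda>x. x j) \<in> borel_measurable (lebesgue_PiM J)" by measurable
          with False show ?thesis by (simp only: not_False_eq_True if_False)
        qed
      qed
    qed
    then show "f \<in> measurable (restrict_space (lebesgue_PiM J) S) (PiM {1..m} (\<lambda>_. borel))"
      by (rule measurable_restrict_space1)
  qed
  have sl: "simplex_lebesgue m = distr (restrict_space (lebesgue_PiM J) S) (simplex_borel m) f"
    by (simp add: simplex_lebesgue_def S_def f_def[abs_def] J_def)
  define B' where "B' = f -` B \<inter> space (restrict_space (lebesgue_PiM J) S)"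
  have B'S: "B' \<in> sets (lebesgue_PiM J)"
  proof -
    obtain X where X: "X \<in> sets (lebesgue_PiM J)" "B' = S \<inter> X"
      using measurable_sets[OF f B] by (auto simp: B'_def sets_restrict_space)
    then have "B' = (S \<inter> space (lebesgue_PiM J)) \<inter> X" using sets.sets_into_space[OF X(1)] by auto
    then show ?thesis using S X(1) by simp
  qed
  have "emeasure (simplex_lebesgue m) B = emeasure (restrict_space (lebesgue_PiM J) S) B'"
    unfolding sl B'_def by (rule emeasure_distr[OF f B])
  also have "\<dots> = emeasure (lebesgue_PiM J) B'"
    using S by (intro emeasure_restrict_space) (auto simp: B'_def space_restrict_space)
  also have "\<dots> = 0"
  proof -
    have eq: "(\<lambda>i\<in>J. (1 / y) * x i) \<in> B' \<longleftrightarrow> x(m := y) \<in> C'" if x: "x \<in> extensional J" for x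
    proof -
      define v where "v = x(m := y - sum x J)"
      have vext: "v \<in> extensional {1..m}" using x J by (auto simp: v_def extensional_def)
      have sv: "sum v J = sum x J" using J by (auto simp: v_def intro!: sum.cong)
      have csv: "coord_sum m v = y" by (simp add: cs sv) (simp add: v_def)
      have C': "x(m := y) \<in> C' \<longleftrightarrow> v \<in> C"
      proof -
        have "g (x(m := y)) = - sum x J" by (simp only: gi) (simp add: g_def)
        moreover have "x(m := y) \<in> extensional {1..m}" using x unfolding J(3) by (auto simp: extensional_def)
        ultimately show ?thesis unfolding C'_def v_def by simp
      qed
      have fx: "f (\<lambda>i\<in>J. (1 / y) * x i) = vec_normalize m v"
      proof
        fix j show "f (\<lambda>i\<in>J. (1 / y) * x i) j = vec_normalize m v j"
          using J y(1) csv by (auto simp: f_def vec_normalize_def v_def field_simps sum_divide_distrib[symmetric])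
      qed
      have "(\<forall>i\<in>J. 0 < (1/y) * x i) \<and> (\<Sum>i\<in>J. (1/y) * x i) < 1 \<longleftrightarrow> v \<in> pos_cone m"
        using J y(1) vext unfolding pos_cone_def J(3)
        by (auto simp: v_def sum_divide_distrib[symmetric] field_simps zero_less_mult_iff)
      moreover have "(\<lambda>i\<in>J. (1 / y) * x i) \<in> space (restrict_space (lebesgue_PiM J) S) \<longleftrightarrow>
         (\<forall>i\<in>J. 0 < (1/y) * x i) \<and> (\<Sum>i\<in>J. (1/y) * x i) < 1"
        by (simp add: space_restrict_space space_lebesgue_PiM S_def)
      ultimately show ?thesis
        unfolding C' B'_def C_def cone_over_def using fx y(2) by (auto simp: csv)
    qed
    have "(\<integral>\<^sup>+x. indicator C' (x(m := y)) \<partial>lebesgue_PiM J)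
       = (\<integral>\<^sup>+x. indicator {x \<in> extensional J. (\<lambda>i\<in>J. (1 / y) * x i) \<in> B'} x \<partial>lebesgue_PiM J)"
      using eq by (intro nn_integral_cong) (auto simp: space_lebesgue_PiM indicator_def simp del: times_divide_eq_left mult_1_left)
    also have "\<dots> = emeasure (lebesgue_PiM J) {x \<in> extensional J. (\<lambda>i\<in>J. (1 / y) * x i) \<in> B'}"
    proof (rule nn_integral_indicator)
      have "(\<lambda>x. \<lambda>i\<in>J. (1 / y) * x i) \<in> measurable (lebesgue_PiM J) (lebesgue_PiM J)" by measurable
      from measurable_sets[OF this B'S]
      show "{x \<in> extensional J. (\<lambda>i\<in>J. (1 / y) * x i) \<in> B'} \<in> sets (lebesgue_PiM J)"
        by (simp add: space_lebesgue_PiM vimage_def Int_def conj_commute)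
    qed
    also have "\<dots> = ennreal ((1 / (1 / y)) ^ card J) * emeasure (lebesgue_PiM J) B'"
      using y J B'S by (intro emeasure_lebesgue_PiM_scale) auto
    finally show ?thesis using y by auto
  qed
  finally show "B \<in> null_sets (simplex_lebesgue m)"
    using B by (auto simp: sl)
qed

subsection \<open>Infinite Rauzy paths: every letter wins infinitely often\<close>

text \<open>The new position of the entry at \<open>j\<close> when the last entry of a row is
  inserted just behind position \<open>p\<close>. The same move acts on the order of the intervals
  under \<open>a\<close> and on the order of their images under \<open>b\<close>.\<close>

definition rauzy_shift :: "nat \<Rightarrow> nat \<Rightarrow> nat \<Rightarrow> nat" where
  "rauzy_shift m p j = (if j \<le> p \<or> m < j then j else if j < m then j + 1 else p + 1)"

lemma incseq_nat_bounded_eventually_const: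
  fixes f :: "nat \<Rightarrow> nat"
  assumes mono: "\<And>n. n \<ge> N \<Longrightarrow> f n \<le> f (Suc n)" and bdd: "\<And>n. n \<ge> N \<Longrightarrow> f n \<le> B"
  obtains M where "M \<ge> N" "\<And>n. n \<ge> M \<Longrightarrow> f n = f M"
proof -
  have mono': "f i \<le> f j" if "N \<le> i" "i \<le> j" for i j
    using that(2)
  proof (induction j rule: dec_induct)
    case (step j)
    then show ?case using mono[of j] that(1) by simp
  qed simp
  define k where "k = Max (f ` {N..})"
  have fin: "finite (f ` {N..})" by (rule finite_subset[of _ "{..B}"]) (use bdd in auto)
  have "k \<in> f ` {N..}" unfolding k_def by (rule Max_in[OF fin]) auto
  then obtain M where M: "M \<ge> N" "f M = k" by auto
  have "f n = f M" if "n \<ge> M" for n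
  proof -
    have "f n \<le> k" unfolding k_def using fin M that by (intro Max_ge) auto
    then show ?thesis using mono'[OF M(1) that] M by simp
  qed
  then show ?thesis using that M by blast
qed

text \<open>
  In one row of the labelled permutation, a letter that is never at the end moves only to the
  right, hence eventually stays put; the letters to its left are then frozen as well and cannot
  be infinitely often the end letter.
\<close>

lemma rauzy_row_frozen:
  fixes t :: "nat \<Rightarrow> nat \<Rightarrow> 'l" and w :: "nat \<Rightarrow> 'l"
  assumes bij: "\<And>n. bij_betw (t n) {1..m} L"
    and Z: "Z \<subseteq> L" "Z \<noteq> {}"
    and step: "\<And>n. n \<ge> N \<Longrightarrow> (t (Suc n) = t n \<and> w n = t n m) \<or>
       (\<exists>p\<in>{1..<m}. t n p = w n \<and> (\<forall>j\<in>{1..m}. t (Suc n) (rauzy_shift m p j) = t n j))"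
    and notlast: "\<And>n. n \<ge> N \<Longrightarrow> t n m \<notin> Z"
    and wW: "\<And>n. n \<ge> N \<Longrightarrow> w n \<in> L - Z"
    and inf: "\<And>\<alpha>. \<alpha> \<in> L - Z \<Longrightarrow> \<exists>\<^sub>\<infinity>n. w n = \<alpha>"
  shows "\<exists>M. \<forall>n\<ge>M. t n ` {1..card Z} = Z"
proof -
  have finL: "finite L" using bij_betw_finite[OF bij[of 0]] by simp
  have finZ: "finite Z" using finL Z finite_subset by blast
  define pos where "pos n \<alpha> = inv_into {1..m} (t n) \<alpha>" for n \<alpha>
  have pos: "pos n \<alpha> \<in> {1..m}" "t n (pos n \<alpha>) = \<alpha>" if "\<alpha> \<in> L" for n \<alpha>
  proof -
    have "\<alpha> \<in> t n ` {1..m}" using bij[of n] that by (simp add: bij_betw_def)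
    from inv_into_into[OF this] f_inv_into_f[OF this]
    show "pos n \<alpha> \<in> {1..m}" "t n (pos n \<alpha>) = \<alpha>" by (simp_all only: pos_def)
  qed
  have posI: "pos n (t n j) = j" if "j \<in> {1..m}" for n j
    using inv_into_f_f[of "t n" "{1..m}" j] bij[of n] that unfolding pos_def bij_betw_def by simp
  have tinj: "i = j" if "t n i = t n j" "i \<in> {1..m}" "j \<in> {1..m}" for n i j
    using posI[of i n] posI[of j n] that by metis
  have pos_step: "pos (Suc n) \<alpha> = pos n \<alpha> \<or>
      (\<exists>p\<in>{1..<m}. t n p = w n \<and> (\<forall>j\<in>{1..m}. t (Suc n) (rauzy_shift m p j) = t n j) \<and>
        pos (Suc n) \<alpha> = rauzy_shift m p (pos n \<alpha>))" if n: "n \<ge> N" and \<alpha>: "\<alpha> \<in> L" for n \<alpha>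
    using step[OF n]
  proof
    assume "t (Suc n) = t n \<and> w n = t n m" then show ?thesis by (simp add: pos_def)
  next
    assume "\<exists>p\<in>{1..<m}. t n p = w n \<and> (\<forall>j\<in>{1..m}. t (Suc n) (rauzy_shift m p j) = t n j)"
    then obtain p where p: "p \<in> {1..<m}" "t n p = w n" "\<forall>j\<in>{1..m}. t (Suc n) (rauzy_shift m p j) = t n j" by blast
    have "rauzy_shift m p (pos n \<alpha>) \<in> {1..m}" using p pos(1)[OF \<alpha>, of n] by (auto simp: rauzy_shift_def)
    moreover have "t (Suc n) (rauzy_shift m p (pos n \<alpha>)) = \<alpha>" using p(3) pos[OF \<alpha>, of n] by auto
    ultimately have "pos (Suc n) \<alpha> = rauzy_shift m p (pos n \<alpha>)" using posI by metis
    then show ?thesis using p by blast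
  qed
  have posZ: "pos n \<alpha> < m" if "n \<ge> N" "\<alpha> \<in> Z" for n \<alpha>
    using pos[of \<alpha> n] notlast[OF that(1)] that Z by (cases "pos n \<alpha> = m") auto
  have mono: "pos n \<alpha> \<le> pos (Suc n) \<alpha>" if "n \<ge> N" "\<alpha> \<in> Z" for n \<alpha>
    using pos_step[OF that(1) subsetD[OF Z(1) that(2)]] posZ[OF that] by (auto simp: rauzy_shift_def)
  \<comment> \<open>All positions are stabilized at once through their sum, a bounded nondecreasing
    sequence of natural numbers.\<close>
  have "(\<Sum>\<alpha>\<in>Z. pos n \<alpha>) \<le> card Z * m" if "n \<ge> N" for n
    using sum_bounded_above[of Z "pos n" m] posZ[OF that] by (auto simp: less_imp_le)
  moreover have "(\<Sum>\<alpha>\<in>Z. pos n \<alpha>) \<le> (\<Sum>\<alpha>\<in>Z. pos (Suc n) \<alpha>)" if "n \<ge> N" for n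
    using mono[OF that] by (rule sum_mono)
  ultimately obtain M where M: "M \<ge> N" "\<And>n. n \<ge> M \<Longrightarrow> (\<Sum>\<alpha>\<in>Z. pos n \<alpha>) = (\<Sum>\<alpha>\<in>Z. pos M \<alpha>)"
    using incseq_nat_bounded_eventually_const[of N "\<lambda>n. \<Sum>\<alpha>\<in>Z. pos n \<alpha>" "card Z * m"] by blast
  have const: "pos (Suc n) \<alpha> = pos n \<alpha>" if n: "n \<ge> M" and \<alpha>: "\<alpha> \<in> Z" for n \<alpha>
  proof (rule ccontr)
    assume ne: "pos (Suc n) \<alpha> \<noteq> pos n \<alpha>"
    have "pos n \<alpha> < pos (Suc n) \<alpha>" using mono[of n \<alpha>] n M(1) \<alpha> ne by simp
    then have "(\<Sum>\<alpha>\<in>Z. pos n \<alpha>) < (\<Sum>\<alpha>\<in>Z. pos (Suc n) \<alpha>)"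
      using mono[of n] n M(1) \<alpha> finZ by (intro sum_strict_mono_ex1) auto
    then show False using M(2)[of n] M(2)[of "Suc n"] n by simp
  qed
  have constM: "pos n \<alpha> = pos M \<alpha>" if n: "n \<ge> M" and \<alpha>: "\<alpha> \<in> Z" for n \<alpha>
    using n by (induction n rule: dec_induct) (use const \<alpha> in auto)
  \<comment> \<open>The rightmost place held by \<open>Z\<close>. An insertion at
    \<open>p < k\<close> would push the letter at \<open>k\<close> to \<open>k + 1\<close>, and
    \<open>p = k\<close> would make a letter of \<open>Z\<close> the winner. So every insertion
    happens to the right of \<open>k\<close>, and the first \<open>k\<close> places are
    frozen.\<close>
  define k where "k = Max (pos M ` Z)"
  have kin: "k \<in> pos M ` Z" unfolding k_def using Z finZ by (intro Max_in) auto
  then obtain \<zeta> where \<zeta>: "\<zeta> \<in> Z" "pos M \<zeta> = k" by auto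
  have k: "k \<in> {1..<m}" using pos(1)[of \<zeta> M] posZ[OF M(1) \<zeta>(1)] \<zeta> Z by auto
  have froz: "t (Suc n) j = t n j \<and> (w n = t n m \<or> (\<exists>p\<in>{1..<m}. k < p \<and> w n = t n p))"
    if n: "n \<ge> M" and j: "j \<in> {1..k}" for n j
  proof -
    have N: "n \<ge> N" using n M by simp
    have \<zeta>L: "\<zeta> \<in> L" using \<zeta> Z by auto
    have pk: "pos n \<zeta> = k" "pos (Suc n) \<zeta> = k" using constM[OF n \<zeta>(1)] const[OF n \<zeta>(1)] \<zeta> by auto
    from step[OF N] show ?thesis
    proof
      assume "\<exists>p\<in>{1..<m}. t n p = w n \<and> (\<forall>j\<in>{1..m}. t (Suc n) (rauzy_shift m p j) = t n j)"
      then obtain p where p: "p \<in> {1..<m}" "t n p = w n" "\<And>j. j \<in> {1..m} \<Longrightarrow> t (Suc n) (rauzy_shift m p j) = t n j" by blast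
      have tk: "t n k = \<zeta>" using pos(2)[OF \<zeta>L, of n] pk by simp
      have "k \<le> p"
      proof (rule ccontr)
        assume "\<not> k \<le> p"
        then have "t (Suc n) (k + 1) = \<zeta>" using p(3)[of k] k tk by (auto simp: rauzy_shift_def)
        then have "pos (Suc n) \<zeta> = k + 1" using posI[of "k+1" "Suc n"] k by auto
        then show False using pk by simp
      qed
      moreover have "k \<noteq> p" using p(2) tk wW[OF N] \<zeta> by auto
      ultimately have "k < p" by simp
      then show ?thesis using p j k p(3)[of j] by (auto simp: rauzy_shift_def)
    qed auto
  qed
  have frozM: "t n j = t M j" if n: "n \<ge> M" and j: "j \<in> {1..k}" for n j
    using n by (induction n rule: dec_induct) (use froz j in auto)
  \<comment> \<open>From \<open>M\<close> on the winner stands at \<open>m\<close> or at a place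
    \<open>p > k\<close>. A letter outside \<open>Z\<close> frozen at one of the first
    \<open>k\<close> places could never win again, although it has to win infinitely often.\<close>
  have sub: "t M j \<in> Z" if j: "j \<in> {1..k}" for j
  proof (rule ccontr)
    assume nZ: "t M j \<notin> Z"
    have "t M j \<in> L" using bij[of M] j k by (auto simp: bij_betw_def)
    then have "\<exists>\<^sub>\<infinity>n. w n = t M j" using inf nZ by auto
    then obtain n where n: "n \<ge> M" "w n = t M j" by (auto simp: INFM_nat_le)
    then have w: "w n = t n j" using frozM[OF n(1) j] by simp
    from froz[OF n(1) j] consider "w n = t n m" | p where "p \<in> {1..<m}" "k < p" "w n = t n p" by blast
    then show False
      by cases (use w j k tinj[of n j m] tinj[of n j] in \<open>fastforce+\<close>)
  qed
  have img: "t M ` {1..k} = Z"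
  proof
    show "Z \<subseteq> t M ` {1..k}"
    proof
      fix \<alpha> assume \<alpha>: "\<alpha> \<in> Z"
      have "pos M \<alpha> \<le> k" unfolding k_def using \<alpha> finZ by (intro Max_ge) auto
      then show "\<alpha> \<in> t M ` {1..k}" using pos[of \<alpha> M] \<alpha> Z by (intro image_eqI[of _ _ "pos M \<alpha>"]) auto
    qed
  qed (use sub in auto)
  have "inj_on (t M) {1..k}" using bij[of M] k by (auto simp: bij_betw_def intro: inj_on_subset)
  then have "card Z = k" using img card_image by fastforce
  then have "t n ` {1..card Z} = Z" if "n \<ge> M" for n
    using img frozM[OF that] by auto
  then show ?thesis by blast
qed

text \<open>A letter that stops winning has constant length from then on, so it cannot lose infinitely
  often: every loss decreases the total length by its own length.\<close>

lemma rauzy_all_letters_win: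
  fixes t b :: "nat \<Rightarrow> nat \<Rightarrow> 'l" and win los :: "nat \<Rightarrow> 'l" and len :: "nat \<Rightarrow> 'l \<Rightarrow> real"
  assumes bijt: "\<And>n. bij_betw (t n) {1..m} L" and bijb: "\<And>n. bij_betw (b n) {1..m} L"
    and m: "m \<ge> 1"
    and step: "\<And>n. (win n = t n m \<and> los n = b n m \<and> t (Suc n) = t n \<and>
         (\<exists>p\<in>{1..<m}. b n p = win n \<and> (\<forall>j\<in>{1..m}. b (Suc n) (rauzy_shift m p j) = b n j))) \<or>
       (win n = b n m \<and> los n = t n m \<and> b (Suc n) = b n \<and>
         (\<exists>p\<in>{1..<m}. t n p = win n \<and> (\<forall>j\<in>{1..m}. t (Suc n) (rauzy_shift m p j) = t n j)))"
    and pos: "\<And>n \<alpha>. \<alpha> \<in> L \<Longrightarrow> len n \<alpha> > 0"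
    and len: "\<And>n \<alpha>. \<alpha> \<in> L \<Longrightarrow> len (Suc n) \<alpha> = (if \<alpha> = win n then len n \<alpha> - len n (los n) else len n \<alpha>)"
    and irred: "\<And>n k. k \<in> {1..<m} \<Longrightarrow> t n ` {1..k} \<noteq> b n ` {1..k}"
    and \<alpha>: "\<alpha> \<in> L"
  shows "\<exists>\<^sub>\<infinity>n. win n = \<alpha>"
proof (rule ccontr)
  assume \<alpha>fin: "\<not> (\<exists>\<^sub>\<infinity>n. win n = \<alpha>)"
  define Z where "Z = {\<alpha>\<in>L. \<not> (\<exists>\<^sub>\<infinity>n. win n = \<alpha>)}"
  have finL: "finite L" using bij_betw_finite[OF bijt[of 0]] by simp
  have Z: "Z \<subseteq> L" "Z \<noteq> {}" "finite Z" using \<alpha> \<alpha>fin finL by (auto simp: Z_def)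
  have last: "t n m \<in> L" "b n m \<in> L" for n using bijt[of n] bijb[of n] m by (auto simp: bij_betw_def)
  have winL: "win n \<in> L" "los n \<in> L" for n using step[of n] last[of n] by auto
  have "\<forall>\<^sub>\<infinity>n. \<forall>\<alpha>\<in>Z. win n \<noteq> \<alpha>"
    using Z by (subst eventually_ball_finite_distrib) (auto simp: Z_def not_INFM)
  then obtain N0 where N0: "\<And>n. n \<ge> N0 \<Longrightarrow> win n \<notin> Z" by (auto simp: MOST_nat_le)
  have lenZ: "len n \<alpha> = len N0 \<alpha>" if "n \<ge> N0" "\<alpha> \<in> Z" for n \<alpha>
    using that(1)
  proof (induction n rule: dec_induct)
    case (step n)
    then show ?case using len[of \<alpha> n] N0[of n] that(2) Z(1) by auto
  qed simp
  define \<Phi> where "\<Phi> n = sum (len n) L" for n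
  have \<Phi>: "\<Phi> n - \<Phi> (Suc n) = len n (los n)" for n
  proof -
    have "\<Phi> n - \<Phi> (Suc n) = (\<Sum>\<alpha>\<in>L. if \<alpha> = win n then len n (los n) else 0)"
      unfolding \<Phi>_def sum_subtractf[symmetric] by (intro sum.cong) (auto simp: len)
    then show ?thesis using finL winL by simp
  qed
  have "decseq \<Phi>" by (rule decseq_SucI) (metis \<Phi> pos winL(2) diff_ge_0_iff_ge less_imp_le)
  moreover have "\<Phi> n \<ge> 0" for n unfolding \<Phi>_def using pos by (intro sum_nonneg) (auto simp: less_imp_le)
  ultimately obtain l where l: "\<Phi> \<longlonglongrightarrow> l" using decseq_convergent[of \<Phi> 0] by metis
  have lim: "(\<lambda>n. len n (los n)) \<longlonglongrightarrow> 0"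
    using tendsto_diff[OF l LIMSEQ_Suc[OF l]] by (simp add: \<Phi>)
  define e where "e = Min (len N0 ` Z)"
  have e: "e > 0" "\<And>\<alpha>. \<alpha> \<in> Z \<Longrightarrow> e \<le> len N0 \<alpha>" unfolding e_def using Z pos by (auto simp: subset_eq)
  from order_tendstoD(2)[OF lim e(1)] obtain N1 where N1: "\<And>n. n \<ge> N1 \<Longrightarrow> len n (los n) < e"
    by (auto simp: eventually_sequentially)
  define N where "N = max N0 N1"
  have winZ: "win n \<notin> Z" and losZ: "los n \<notin> Z" if "n \<ge> N" for n
    using N0[of n] N1[of n] that e(2)[of "los n"] lenZ[of n "los n"] by (auto simp: N_def)
  \<comment> \<open>The letters at the two ends are always the winner and the loser. From
    \<open>N\<close> on neither belongs to \<open>Z\<close>, so both rows satisfy the hypotheses of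
    \<open>rauzy_row_frozen\<close>.\<close>
  have lastZ: "t n m \<notin> Z \<and> b n m \<notin> Z" if "n \<ge> N" for n using step[of n] winZ[OF that] losZ[OF that] by auto
  have inf: "\<exists>\<^sub>\<infinity>n. win n = \<alpha>" if "\<alpha> \<in> L - Z" for \<alpha> using that by (auto simp: Z_def)
  have "\<exists>M. \<forall>n\<ge>M. t n ` {1..card Z} = Z"
    using bijt Z(1,2)
  proof (rule rauzy_row_frozen)
    show "(t (Suc n) = t n \<and> win n = t n m) \<or> (\<exists>p\<in>{1..<m}. t n p = win n \<and>
        (\<forall>j\<in>{1..m}. t (Suc n) (rauzy_shift m p j) = t n j))" for n
      using step[of n] by blast
    show "t n m \<notin> Z" "win n \<in> L - Z" if "n \<ge> N" for n using lastZ[OF that] winZ[OF that] winL by auto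
  qed (rule inf)
  then obtain M1 where M1: "\<And>n. n \<ge> M1 \<Longrightarrow> t n ` {1..card Z} = Z" by blast
  have "\<exists>M. \<forall>n\<ge>M. b n ` {1..card Z} = Z"
    using bijb Z(1,2)
  proof (rule rauzy_row_frozen)
    show "(b (Suc n) = b n \<and> win n = b n m) \<or> (\<exists>p\<in>{1..<m}. b n p = win n \<and>
        (\<forall>j\<in>{1..m}. b (Suc n) (rauzy_shift m p j) = b n j))" for n
      using step[of n] by blast
    show "b n m \<notin> Z" "win n \<in> L - Z" if "n \<ge> N" for n using lastZ[OF that] winZ[OF that] winL by auto
  qed (rule inf)
  then obtain M2 where M2: "\<And>n. n \<ge> M2 \<Longrightarrow> b n ` {1..card Z} = Z" by blast
  \<comment> \<open>Both rows now begin with the same set \<open>Z\<close>, which is nonempty and,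
    since some letter wins, proper; \<open>irred\<close> forbids this.\<close>
  have "card Z \<ge> 1" using Z by (simp add: Suc_le_eq card_gt_0_iff)
  moreover have "Z \<subset> L" using winZ[of N] winL(1)[of N] Z by auto
  then have "card Z < m" using psubset_card_mono[OF finL] bij_betw_same_card[OF bijt[of 0]] by simp
  ultimately show False using irred[of "card Z" "max M1 M2"] M1 M2 by auto
qed

text \<open>\<open>S n \<alpha>\<close> stands for the support of column \<alpha> of a matrix
  product. Supports only grow, so they become constant, and from then on the support of each winner
  lies in that of its loser. Let \<open>U\<close> be the letters whose support contains \<alpha>. A
  winner outside \<open>U\<close> takes part in the next step, and whether it wins or loses there,
  the next winner is outside \<open>U\<close> again. As \<alpha> belongs to \<open>U\<close> and
  wins again, all late winners are in \<open>U\<close>, and every letter is among them.\<close>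

lemma rauzy_supports_full:
  fixes win los :: "nat \<Rightarrow> 'l" and S :: "nat \<Rightarrow> 'l \<Rightarrow> 'l set"
  assumes finL: "finite L" and winL: "\<And>n. win n \<in> L" "\<And>n. los n \<in> L"
    and keep: "\<And>n. win n = win (Suc n) \<or> win n = los (Suc n)"
    and inf: "\<And>\<alpha>. \<alpha> \<in> L \<Longrightarrow> \<exists>\<^sub>\<infinity>n. win n = \<alpha>"
    and S0: "\<And>\<alpha>. \<alpha> \<in> L \<Longrightarrow> \<alpha> \<in> S 0 \<alpha>" and SL: "\<And>n \<alpha>. \<alpha> \<in> L \<Longrightarrow> S n \<alpha> \<subseteq> L"
    and step: "\<And>n \<alpha>. \<alpha> \<in> L \<Longrightarrow> S (Suc n) \<alpha> = (if \<alpha> = los n then S n \<alpha> \<union> S n (win n) else S n \<alpha>)"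
  shows "\<exists>n. \<forall>\<alpha>\<in>L. S n \<alpha> = L"
proof -
  have mono: "S n \<alpha> \<subseteq> S (Suc n) \<alpha>" if "\<alpha> \<in> L" for n \<alpha> using step[OF that] by auto
  have fin: "finite (S n \<alpha>)" if "\<alpha> \<in> L" for n \<alpha> using SL[OF that] finL finite_subset by blast
  have "(\<Sum>\<alpha>\<in>L. card (S n \<alpha>)) \<le> card L * card L" for n
    using sum_bounded_above[of L "\<lambda>\<alpha>. card (S n \<alpha>)" "card L"] SL finL by (simp add: card_mono)
  moreover have "(\<Sum>\<alpha>\<in>L. card (S n \<alpha>)) \<le> (\<Sum>\<alpha>\<in>L. card (S (Suc n) \<alpha>))" for n
    using mono fin by (intro sum_mono card_mono)
  ultimately obtain N where N: "\<And>n. n \<ge> N \<Longrightarrow> (\<Sum>\<alpha>\<in>L. card (S n \<alpha>)) = (\<Sum>\<alpha>\<in>L. card (S N \<alpha>))"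
    using incseq_nat_bounded_eventually_const[of 0 "\<lambda>n. \<Sum>\<alpha>\<in>L. card (S n \<alpha>)" "card L * card L"] by blast
  have const: "S (Suc n) \<alpha> = S n \<alpha>" if n: "n \<ge> N" and \<alpha>: "\<alpha> \<in> L" for n \<alpha>
  proof (rule ccontr)
    assume "S (Suc n) \<alpha> \<noteq> S n \<alpha>"
    then have "card (S n \<alpha>) < card (S (Suc n) \<alpha>)" using mono[OF \<alpha>, of n] fin[OF \<alpha>] by (auto intro!: psubset_card_mono)
    then have "(\<Sum>\<alpha>\<in>L. card (S n \<alpha>)) < (\<Sum>\<alpha>\<in>L. card (S (Suc n) \<alpha>))"
      using \<alpha> finL card_mono[OF fin mono] by (intro sum_strict_mono_ex1) auto
    then show False using N[of n] N[of "Suc n"] n by simp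
  qed
  have constN: "S n \<alpha> = S N \<alpha>" if "n \<ge> N" "\<alpha> \<in> L" for n \<alpha>
    using that by (induction n rule: dec_induct) (use const in auto)
  have incl: "S N (win n) \<subseteq> S N (los n)" if "n \<ge> N" for n
    using step[OF winL(2), of n n] const[OF that winL(2), of n] constN[OF that] winL by auto
  have "S N \<beta> = L" if \<beta>: "\<beta> \<in> L" for \<beta>
  proof -
    have "\<alpha> \<in> S N \<beta>" if \<alpha>: "\<alpha> \<in> L" for \<alpha>
    proof -
      define U where "U = {\<gamma>\<in>L. \<alpha> \<in> S N \<gamma>}"
      have \<alpha>n: "\<alpha> \<in> S n \<alpha>" for n by (induction n) (use S0 mono \<alpha> in auto)
      have U: "los n \<in> U" if "n \<ge> N" "win n \<in> U" for n
        using incl[OF that(1)] that winL by (auto simp: U_def)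
      have stay: "win n \<notin> U \<Longrightarrow> win (n + k) \<notin> U" if n: "n \<ge> N" for n k
      proof (induction k)
        case (Suc k)
        then show ?case using keep[of "n + k"] U[of "Suc (n + k)"] n by auto
      qed simp
      have "win n \<in> U" if n: "n \<ge> N" for n
      proof (rule ccontr)
        assume nU: "win n \<notin> U"
        obtain n' where "n' \<ge> n" "win n' = \<alpha>" using inf[OF \<alpha>] by (auto simp: INFM_nat_le)
        moreover have "\<alpha> \<in> U" using \<alpha> \<alpha>n by (simp add: U_def)
        ultimately show False using stay[OF n nU, of "n' - n"] by simp
      qed
      moreover obtain n where "n \<ge> N" "win n = \<beta>" using inf[OF \<beta>] by (auto simp: INFM_nat_le)
      ultimately show ?thesis by (auto simp: U_def)
    qed
    then show ?thesis using SL[OF \<beta>] by blast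
  qed
  then show ?thesis by blast
qed

subsection \<open>Rauzy steps and their matrices\<close>

lemma rauzy_shift_permutes:
  assumes "p \<in> {1..<m}"
  shows "rauzy_shift m p permutes {1..m}"
proof (rule bij_imp_permutes)
  have inj: "inj_on (rauzy_shift m p) {1..m}"
    using assms by (auto simp: inj_on_def rauzy_shift_def split: if_splits)
  moreover have "rauzy_shift m p ` {1..m} \<subseteq> {1..m}" using assms by (auto simp: rauzy_shift_def)
  ultimately show "bij_betw (rauzy_shift m p) {1..m} {1..m}"
    by (simp add: bij_betw_def endo_inj_surj)
  show "rauzy_shift m p x = x" if "x \<notin> {1..m}" for x
    using assms that by (auto simp: rauzy_shift_def not_le)
qed

text \<open>Letters of words are booleans: \<open>True\<close> stands for \<open>a\<close>, the case
  of \<open>Delta_plus\<close>, and \<open>False\<close> for \<open>b\<close>, the case of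
  \<open>Delta_minus\<close>.\<close>

definition rauzy_step :: "nat \<Rightarrow> bool \<Rightarrow> (nat \<Rightarrow> nat) \<Rightarrow> nat \<Rightarrow> nat" where
  "rauzy_step m x \<pi> = (if x then rauzy_a m \<pi> else rauzy_b m \<pi>)"

definition step_mat :: "nat \<Rightarrow> bool \<Rightarrow> (nat \<Rightarrow> nat) \<Rightarrow> nat \<Rightarrow> nat \<Rightarrow> real" where
  "step_mat m x \<pi> = (if x then rauzy_mat_a m \<pi> else rauzy_mat_b m \<pi>)"

definition winner :: "nat \<Rightarrow> bool \<Rightarrow> (nat \<Rightarrow> nat) \<Rightarrow> nat" where
  "winner m x \<pi> = (if x then inv \<pi> m else m)"

definition loser :: "nat \<Rightarrow> bool \<Rightarrow> (nat \<Rightarrow> nat) \<Rightarrow> nat" where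
  "loser m x \<pi> = (if x then m else inv \<pi> m)"

text \<open>Where the interval with index \<open>i\<close> is found after the step. Only
  \<open>a\<close> reorders the intervals; \<open>b\<close> reorders their images.\<close>

definition step_perm :: "nat \<Rightarrow> bool \<Rightarrow> (nat \<Rightarrow> nat) \<Rightarrow> nat \<Rightarrow> nat" where
  "step_perm m x \<pi> = (if x then rauzy_shift m (inv \<pi> m) else id)"

definition unstep :: "nat \<Rightarrow> bool \<Rightarrow> (nat \<Rightarrow> nat) \<Rightarrow> (nat \<Rightarrow> real) \<Rightarrow> nat \<Rightarrow> real" where
  "unstep m x \<pi> v = mat_vec m (mat_inverse_of m (step_mat m x \<pi>)) v"

definition mat_mul :: "nat \<Rightarrow> (nat \<Rightarrow> nat \<Rightarrow> real) \<Rightarrow> (nat \<Rightarrow> nat \<Rightarrow> real) \<Rightarrow> nat \<Rightarrow> nat \<Rightarrow> real" where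
  "mat_mul m A B i j = (\<Sum>k=1..m. A i k * B k j)"

lemma mat_mul_assoc: "mat_mul m (mat_mul m A B) C = mat_mul m A (mat_mul m B C)"
  by (simp add: mat_mul_def sum_distrib_left sum_distrib_right mult.assoc fun_eq_iff)
     (intro allI sum.swap)

lemma mat_vec_mat_mul: "mat_vec m (mat_mul m A B) u = mat_vec m A (mat_vec m B u)"
proof
  fix i show "mat_vec m (mat_mul m A B) u i = mat_vec m A (mat_vec m B u) i"
  proof (cases "i \<in> {1..m}")
    case True
    then show ?thesis
      by (simp add: mat_vec_def mat_mul_def sum_distrib_left sum_distrib_right mult.assoc) (rule sum.swap)
  next
    case False
    then show ?thesis by (simp only: mat_vec_def restrict_apply if_False)
  qed
qed

lemma mat_mul_id_left: "i \<in> {1..m} \<Longrightarrow> mat_mul m mat_id B i j = B i j"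
  by (simp add: mat_mul_def mat_id_def of_bool_def if_distrib[of "\<lambda>x. x * _"] cong: if_cong)

lemma mat_mul_id_right: "j \<in> {1..m} \<Longrightarrow> mat_mul m B mat_id i j = B i j"
  by (simp add: mat_mul_def mat_id_def of_bool_def if_distrib[of "\<lambda>x. _ * x"] cong: if_cong)

lemma mat_vec_id: "mat_vec m mat_id u = restrict u {1..m}"
  by (auto simp: mat_vec_def mat_id_def of_bool_def fun_eq_iff if_distrib[of "\<lambda>x. x * _"] cong: if_cong)

text \<open>The chosen inverse is determined only at indices in \<open>{1..m}\<close>; there it
  equals \<open>B\<close> by the usual uniqueness argument for two-sided inverses.\<close>

lemma mat_inverse_of_eq:
  assumes B: "\<forall>i\<in>{1..m}. \<forall>j\<in>{1..m}. mat_mul m A B i j = mat_id i j \<and> mat_mul m B A i j = mat_id i j"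
    and i: "i \<in> {1..m}" and j: "j \<in> {1..m}"
  shows "mat_inverse_of m A i j = B i j"
proof -
  let ?C = "mat_inverse_of m A"
  have C: "\<forall>i\<in>{1..m}. \<forall>j\<in>{1..m}. mat_mul m A ?C i j = mat_id i j \<and> mat_mul m ?C A i j = mat_id i j"
    using someI[of "\<lambda>B. \<forall>i\<in>{1..m}. \<forall>j\<in>{1..m}. mat_mul m A B i j = mat_id i j \<and> mat_mul m B A i j = mat_id i j" B] B
    unfolding mat_inverse_of_def mat_mul_def by blast
  have "?C i j = mat_mul m ?C mat_id i j" by (rule mat_mul_id_right[OF j, symmetric])
  also have "\<dots> = mat_mul m ?C (mat_mul m A B) i j"
    unfolding mat_mul_def[of m ?C] using B j by (intro sum.cong) auto
  also have "\<dots> = mat_mul m (mat_mul m ?C A) B i j" by (simp add: mat_mul_assoc)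
  also have "\<dots> = mat_mul m mat_id B i j"
    unfolding mat_mul_def[of m _ B] using C i by (intro sum.cong) auto
  also have "\<dots> = B i j" by (rule mat_mul_id_left[OF i])
  finally show ?thesis .
qed

lemma irreducible_permD: "irreducible_perm m \<pi> \<Longrightarrow> \<pi> permutes {1..m}"
  by (simp add: irreducible_perm_def)

section \<open>Elementary Rauzy moves on irreducible permutations\<close>

context
  fixes m :: nat
  assumes m: "m \<ge> 2"
begin

lemma irreducible_last:
  assumes "irreducible_perm m \<pi>"
  shows "\<pi> m \<in> {1..<m}" "inv \<pi> m \<in> {1..<m}"
proof -
  have P: "\<pi> permutes {1..m}" using assms by (rule irreducible_permD)
  have "\<pi> m \<noteq> m"
  proof
    assume e: "\<pi> m = m"
    have I: "{1..m} = insert m {1..m - 1}" using m by auto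
    have "\<pi> ` {1..m - 1} = \<pi> ` ({1..m} - {m})" using m by (intro arg_cong[where f="image \<pi>"]) auto
    also have "\<dots> = \<pi> ` {1..m} - \<pi> ` {m}" by (rule image_set_diff) (rule permutes_inj[OF P])
    also have "\<dots> = {1..m - 1}" using permutes_image[OF P] e m by auto
    finally have "\<pi> ` {1..m - 1} = {1..m - 1}" .
    moreover have "m - 1 \<in> {1..m}" using m by auto
    ultimately have "m - 1 = m" using assms unfolding irreducible_perm_def by blast
    then show False using m by simp
  qed
  moreover have "\<pi> m \<in> {1..m}" "inv \<pi> m \<in> {1..m}"
    using permutes_in_image[OF P, of m] permutes_in_image[OF permutes_inv[OF P], of m] m by auto
  moreover have "inv \<pi> m \<noteq> m" using \<open>\<pi> m \<noteq> m\<close> permutes_inverses(1)[OF P, of m] by metis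
  ultimately show "\<pi> m \<in> {1..<m}" "inv \<pi> m \<in> {1..<m}" by auto
qed

lemma rauzy_a_shift:
  assumes "irreducible_perm m \<pi>" "j \<in> {1..m}"
  shows "rauzy_a m \<pi> (rauzy_shift m (inv \<pi> m) j) = \<pi> j"
  using irreducible_last[OF assms(1)] assms(2) by (auto simp: rauzy_a_def rauzy_shift_def)

lemma rauzy_b_shift:
  assumes "irreducible_perm m \<pi>" "j \<in> {1..m}"
  shows "rauzy_b m \<pi> j = rauzy_shift m (\<pi> m) (\<pi> j)"
proof -
  have "\<pi> j \<in> {1..m}" using permutes_in_image[OF irreducible_permD[OF assms(1)]] assms(2) by simp
  then show ?thesis using irreducible_last[OF assms(1)] assms(2) by (auto simp: rauzy_b_def rauzy_shift_def)
qed

lemma rauzy_a_eq: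
  assumes "irreducible_perm m \<pi>" shows "rauzy_a m \<pi> = \<pi> \<circ> inv (rauzy_shift m (inv \<pi> m))"
proof -
  let ?s = "rauzy_shift m (inv \<pi> m)"
  have s: "?s permutes {1..m}" using irreducible_last(2)[OF assms] by (rule rauzy_shift_permutes)
  show ?thesis
  proof
    fix j show "rauzy_a m \<pi> j = (\<pi> \<circ> inv ?s) j"
    proof (cases "j \<in> {1..m}")
      case True
      then have "inv ?s j \<in> {1..m}" using permutes_in_image[OF permutes_inv[OF s]] by blast
      from rauzy_a_shift[OF assms this] show ?thesis by (simp add: permutes_inverses[OF s])
    next
      case False
      then have "inv ?s j = j" by (rule permutes_not_in[OF permutes_inv[OF s]])
      then show ?thesis using False permutes_not_in[OF irreducible_permD[OF assms]] by (auto simp: rauzy_a_def)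
    qed
  qed
qed

lemma rauzy_a_permutes:
  assumes "irreducible_perm m \<pi>" shows "rauzy_a m \<pi> permutes {1..m}"
  unfolding rauzy_a_eq[OF assms]
  by (intro permutes_compose permutes_inv rauzy_shift_permutes irreducible_last(2) irreducible_permD assms)

lemma rauzy_b_eq:
  assumes "irreducible_perm m \<pi>" shows "rauzy_b m \<pi> = rauzy_shift m (\<pi> m) \<circ> \<pi>"
proof -
  let ?s = "rauzy_shift m (\<pi> m)"
  have s: "?s permutes {1..m}" using irreducible_last(1)[OF assms] by (rule rauzy_shift_permutes)
  show ?thesis
  proof
    fix j show "rauzy_b m \<pi> j = (?s \<circ> \<pi>) j"
    proof (cases "j \<in> {1..m}")
      case True
      from rauzy_b_shift[OF assms this] show ?thesis by simp
    next
      case False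
      then have "\<pi> j = j" by (rule permutes_not_in[OF irreducible_permD[OF assms]])
      then show ?thesis using False permutes_not_in[OF s False] by (auto simp: rauzy_b_def)
    qed
  qed
qed

lemma rauzy_b_permutes:
  assumes "irreducible_perm m \<pi>" shows "rauzy_b m \<pi> permutes {1..m}"
  unfolding rauzy_b_eq[OF assms]
  by (intro permutes_compose rauzy_shift_permutes irreducible_last(1) irreducible_permD assms)

text \<open>An invariant initial segment \<open>{1..k}\<close> of the new permutation with
  \<open>k < m\<close> cannot reach the entries that were moved. On it the old and the new
  permutation agree, so it would already be invariant under \<pi>.\<close>

lemma irreducible_rauzy_step:
  assumes "irreducible_perm m \<pi>" shows "irreducible_perm m (rauzy_step m x \<pi>)"
proof -
  have P: "\<pi> permutes {1..m}" using assms by (rule irreducible_permD)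
  note last = irreducible_last[OF assms]
  have "k = m" if k: "k \<in> {1..m}" and im: "rauzy_step m x \<pi> ` {1..k} = {1..k}" for k
  proof (rule ccontr)
    assume "k \<noteq> m"
    then have km: "k < m" using k by simp
    have "\<forall>j\<in>{1..k}. rauzy_step m x \<pi> j = \<pi> j"
    proof (cases x)
      case True
      have "rauzy_a m \<pi> (inv \<pi> m) = m"
        using last permutes_inverses(1)[OF P, of m] by (auto simp: rauzy_a_def)
      then have "\<not> inv \<pi> m \<le> k" using im True km last
        by (auto simp: rauzy_step_def set_eq_iff image_iff) (metis One_nat_def atLeastAtMost_iff linorder_not_less)
      then show ?thesis using True km by (auto simp: rauzy_step_def rauzy_a_def)
    next
      case False
      have "rauzy_b m \<pi> m = \<pi> m" using m by (auto simp: rauzy_b_def)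
      moreover have "inj (rauzy_b m \<pi>)" using rauzy_b_permutes[OF assms] by (rule permutes_inj)
      ultimately have "\<pi> m \<notin> {1..k}"
        using im False km by (simp add: rauzy_step_def) (metis atLeastAtMost_iff image_iff injD linorder_not_less)
      then have q: "k < \<pi> m" using last by auto
      show ?thesis
      proof
        fix j assume j: "j \<in> {1..k}"
        then have "rauzy_b m \<pi> j \<in> {1..k}" using im False by (auto simp: rauzy_step_def)
        then have "rauzy_b m \<pi> j < \<pi> m" using q by simp
        then show "rauzy_step m x \<pi> j = \<pi> j" using False j km by (auto simp: rauzy_step_def rauzy_b_def split: if_splits)
      qed
    qed
    then have "\<pi> ` {1..k} = {1..k}" using im by (metis (no_types, lifting) image_cong)
    then show False using assms k \<open>k \<noteq> m\<close> by (auto simp: irreducible_perm_def)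
  qed
  moreover have "rauzy_step m x \<pi> permutes {1..m}"
    using rauzy_a_permutes[OF assms] rauzy_b_permutes[OF assms] by (simp add: rauzy_step_def)
  ultimately show ?thesis by (auto simp: irreducible_perm_def)
qed

lemma winner_loser:
  assumes "irreducible_perm m \<pi>"
  shows "winner m x \<pi> \<in> {1..m}" "loser m x \<pi> \<in> {1..m}" "winner m x \<pi> \<noteq> loser m x \<pi>"
  using irreducible_last[OF assms] m by (auto simp: winner_def loser_def)

lemma step_perm_permutes:
  assumes "irreducible_perm m \<pi>" shows "step_perm m x \<pi> permutes {1..m}"
  using rauzy_shift_permutes[OF irreducible_last(2)[OF assms]] by (simp add: step_perm_def permutes_id)

text \<open>A uniform description for \<open>a\<close> and \<open>b\<close>: a permutation matrix
  with one additional unit entry. As a linear map it is a permutation of the coordinates followed by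
  the shear that adds the loser's coordinate to the winner's.\<close>

lemma step_mat_eq:
  assumes "irreducible_perm m \<pi>" "i \<in> {1..m}"
  shows "step_mat m x \<pi> i j =
    of_bool (j = step_perm m x \<pi> i) + of_bool (i = winner m x \<pi> \<and> j = step_perm m x \<pi> (loser m x \<pi>))"
proof (cases x)
  case False
  then show ?thesis
    by (auto simp: step_mat_def rauzy_mat_b_def mat_id_def mat_unit_def step_perm_def winner_def loser_def)
next
  case True
  define p where "p = inv \<pi> m"
  have p: "p \<in> {1..<m}" using irreducible_last[OF assms(1)] by (simp add: p_def)
  have "(\<Sum>q = 1..p. mat_unit q q i j) = (\<Sum>q = 1..p. if q = i then of_bool (j = i) else 0)"
    by (intro sum.cong) (auto simp: mat_unit_def)
  also have "\<dots> = of_bool (i \<le> p \<and> j = i)" using assms by auto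
  finally have 1: "(\<Sum>q = 1..p. mat_unit q q i j) = of_bool (i \<le> p \<and> j = i)" .
  have "(\<Sum>q = p..m - 1. mat_unit q (q + 1) i j) = (\<Sum>q = p..m - 1. if q = i then of_bool (j = i + 1) else 0)"
    by (intro sum.cong) (auto simp: mat_unit_def)
  also have "\<dots> = of_bool (p \<le> i \<and> i < m \<and> j = i + 1)" using assms p by auto
  finally have 2: "(\<Sum>q = p..m - 1. mat_unit q (q + 1) i j) = of_bool (p \<le> i \<and> i < m \<and> j = i + 1)" .
  have "step_mat m x \<pi> i j = of_bool (i \<le> p \<and> j = i) + mat_unit m (p + 1) i j + of_bool (p \<le> i \<and> i < m \<and> j = i + 1)"
    using True unfolding step_mat_def rauzy_mat_a_def p_def[symmetric] by (simp only: if_True 1 2)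
  then show ?thesis using True assms p
    unfolding step_perm_def winner_def loser_def p_def[symmetric]
    by (auto simp: mat_unit_def rauzy_shift_def)
qed

lemma step_mat_nonneg: "step_mat m x \<pi> i j \<ge> 0"
  by (simp add: step_mat_def rauzy_mat_a_def rauzy_mat_b_def mat_id_def mat_unit_def sum_nonneg)

lemma mat_vec_step_mat:
  assumes "irreducible_perm m \<pi>" "i \<in> {1..m}"
  shows "mat_vec m (step_mat m x \<pi>) u i = u (step_perm m x \<pi> i)
    + (if i = winner m x \<pi> then u (step_perm m x \<pi> (loser m x \<pi>)) else 0)"
proof -
  let ?s = "step_perm m x \<pi>"
  have s: "?s i \<in> {1..m}" "?s (loser m x \<pi>) \<in> {1..m}"
    using permutes_in_image[OF step_perm_permutes[OF assms(1)]] assms winner_loser[OF assms(1)] by blast+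
  have "mat_vec m (step_mat m x \<pi>) u i = (\<Sum>j=1..m. (if j = ?s i then u j else 0) +
     (if j = ?s (loser m x \<pi>) then if i = winner m x \<pi> then u j else 0 else 0))"
    using assms(2) unfolding mat_vec_def restrict_def
    by (auto intro!: sum.cong simp: step_mat_eq[OF assms] distrib_right)
  also have "\<dots> = u (?s i) + (if i = winner m x \<pi> then u (?s (loser m x \<pi>)) else 0)"
    using s by (simp add: sum.distrib)
  finally show ?thesis .
qed

lemma unstep_step_perm:
  assumes "irreducible_perm m \<pi>" "i \<in> {1..m}"
  shows "unstep m x \<pi> v (step_perm m x \<pi> i) = v i - (if i = winner m x \<pi> then v (loser m x \<pi>) else 0)"
proof -
  let ?s = "step_perm m x \<pi>" and ?w = "winner m x \<pi>" and ?l = "loser m x \<pi>"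
  let ?A = "step_mat m x \<pi>"
  note S = step_perm_permutes[OF assms(1), of x]
  note wl = winner_loser[OF assms(1), of x]
  have sin: "?s i \<in> {1..m} \<longleftrightarrow> i \<in> {1..m}" for i by (rule permutes_in_image[OF S])
  have sinj: "?s i = ?s j \<longleftrightarrow> i = j" for i j using permutes_inj[OF S] by (auto dest: injD)
  \<comment> \<open>The explicit inverse: subtract the loser's coordinate from the winner's, then
    move every coordinate to its new place.\<close>
  define B :: "nat \<Rightarrow> nat \<Rightarrow> real" where "B k j = of_bool (k = ?s j) - of_bool (k = ?s ?w \<and> j = ?l)" for k j
  have AB: "mat_mul m ?A B i j = mat_id i j" if i: "i \<in> {1..m}" for i j
  proof -
    have "mat_mul m ?A B i j = mat_vec m ?A (\<lambda>k. B k j) i" using i by (simp add: mat_mul_def mat_vec_def)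
    also have "\<dots> = mat_id i j"
      unfolding mat_vec_step_mat[OF assms(1) i] using wl by (auto simp: B_def mat_id_def sinj)
    finally show ?thesis .
  qed
  have Bv: "mat_vec m B v (?s i) = v i - (if i = ?w then v ?l else 0)" if i: "i \<in> {1..m}" for i v
  proof -
    have "mat_vec m B v (?s i) = (\<Sum>j=1..m. (if j = i then v j else 0) - (if j = ?l then if i = ?w then v j else 0 else 0))"
      using sin[of i] i unfolding mat_vec_def restrict_def
      by (auto intro!: sum.cong simp: B_def sinj left_diff_distrib)
    also have "\<dots> = v i - (if i = ?w then v ?l else 0)" using i wl by (simp add: sum_subtractf)
    finally show ?thesis .
  qed
  have BA: "mat_mul m B ?A i j = mat_id i j" if i: "i \<in> {1..m}" for i j
  proof -
    obtain i' where i': "i = ?s i'" "i' \<in> {1..m}" using i permutes_image[OF S] by (metis imageE)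
    have "mat_mul m B ?A i j = mat_vec m B (\<lambda>k. ?A k j) i" using i by (simp add: mat_mul_def mat_vec_def)
    also have "\<dots> = mat_id i j"
      unfolding i'(1) Bv[OF i'(2)] step_mat_eq[OF assms(1) i'(2)] step_mat_eq[OF assms(1) wl(2)]
      using wl by (auto simp: mat_id_def)
    finally show ?thesis .
  qed
  have "unstep m x \<pi> v (?s i) = mat_vec m B v (?s i)"
  proof -
    have "mat_inverse_of m ?A (?s i) j = B (?s i) j" if "j \<in> {1..m}" for j
      using AB BA sin[of i] assms(2) that by (intro mat_inverse_of_eq) auto
    then show ?thesis by (auto simp: unstep_def mat_vec_def intro!: sum.cong)
  qed
  then show ?thesis using Bv[OF assms(2)] by simp
qed

end

subsection \<open>Words, cylinders and itineraries\<close>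

definition scale_vec :: "nat \<Rightarrow> real \<Rightarrow> (nat \<Rightarrow> real) \<Rightarrow> nat \<Rightarrow> real" where
  "scale_vec m c v = (\<lambda>i\<in>{1..m}. c * v i)"

definition col_sum :: "nat \<Rightarrow> (nat \<Rightarrow> nat \<Rightarrow> real) \<Rightarrow> nat \<Rightarrow> real" where
  "col_sum m A j = (\<Sum>i=1..m. A i j)"

fun word_mat :: "nat \<Rightarrow> (nat \<Rightarrow> nat) \<Rightarrow> bool list \<Rightarrow> nat \<Rightarrow> nat \<Rightarrow> real" where
  "word_mat m \<pi> [] = mat_id"
| "word_mat m \<pi> (x # w) = mat_mul m (step_mat m x \<pi>) (word_mat m (rauzy_step m x \<pi>) w)"

abbreviation word_map :: "nat \<Rightarrow> (nat \<Rightarrow> nat) \<Rightarrow> bool list \<Rightarrow> (nat \<Rightarrow> real) \<Rightarrow> nat \<Rightarrow> real" where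
  "word_map m \<pi> w \<equiv> mat_vec m (word_mat m \<pi> w)"

definition rauzy_path :: "nat \<Rightarrow> (nat \<Rightarrow> nat) \<Rightarrow> bool list \<Rightarrow> nat \<Rightarrow> nat" where
  "rauzy_path m \<pi> w = fold (rauzy_step m) w \<pi>"

text \<open>The points whose itinerary under \<open>rauzy_T\<close> begins with \<open>w\<close>
  (see \<open>cyl_iff_typed\<close>). Describing them as an image of the cone displays the inverse
  branch and gives measurability.\<close>

definition cyl :: "nat \<Rightarrow> (nat \<Rightarrow> nat) \<Rightarrow> bool list \<Rightarrow> (nat \<Rightarrow> real) set" where
  "cyl m \<pi> w = open_simplex m \<inter> word_map m \<pi> w ` pos_cone m"

text \<open>The next letter of the itinerary is \<open>x\<close>. If neither letter qualifies, the
  point lies where \<open>rauzy_T\<close> was extended by the identity.\<close>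

definition typed :: "nat \<Rightarrow> bool \<Rightarrow> (nat \<Rightarrow> real) \<times> (nat \<Rightarrow> nat) \<Rightarrow> bool" where
  "typed m x = (\<lambda>(v, \<pi>). v \<in> open_simplex m \<and> v (loser m x \<pi>) < v (winner m x \<pi>))"

lemma rauzy_path_simps [simp]: "rauzy_path m \<pi> [] = \<pi>" "rauzy_path m \<pi> (x # w) = rauzy_path m (rauzy_step m x \<pi>) w"
  "rauzy_path m \<pi> (w @ w') = rauzy_path m (rauzy_path m \<pi> w) w'"
  by (simp_all add: rauzy_path_def)

declare word_mat.simps [simp del]

lemma mat_vec_extensional: "mat_vec m A u \<in> extensional {1..m}"
  by (simp add: mat_vec_def)

lemmas mat_vec_extensional' [simp] = mat_vec_extensional[unfolded One_nat_def]

lemma mat_vec_scale: "mat_vec m A (scale_vec m c u) = scale_vec m c (mat_vec m A u)"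
  by (auto simp: mat_vec_def scale_vec_def fun_eq_iff sum_distrib_left intro!: sum.cong)

lemma coord_sum_mat_vec: "coord_sum m (mat_vec m A u) = (\<Sum>j=1..m. col_sum m A j * u j)"
  by (simp add: coord_sum_def mat_vec_def col_sum_def sum_distrib_right) (rule sum.swap)

lemma coord_sum_scale: "coord_sum m (scale_vec m c u) = c * coord_sum m u"
  by (simp add: coord_sum_def scale_vec_def sum_distrib_left)

lemma vec_normalize_scale: "c > 0 \<Longrightarrow> vec_normalize m (scale_vec m c u) = vec_normalize m u"
  by (auto simp: vec_normalize_def coord_sum_scale fun_eq_iff) (simp add: scale_vec_def)

lemma vec_normalize_eq_scale: "vec_normalize m u = scale_vec m (1 / coord_sum m u) u"
  by (simp add: vec_normalize_def scale_vec_def)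

lemma scale_pos_cone: "c > 0 \<Longrightarrow> u \<in> pos_cone m \<Longrightarrow> scale_vec m c u \<in> pos_cone m"
  by (auto simp: pos_cone_def scale_vec_def)

lemma scale_scale: "scale_vec m c (scale_vec m d u) = scale_vec m (c * d) u"
  by (auto simp: scale_vec_def fun_eq_iff)

lemma pos_cone_ext: "u \<in> pos_cone m \<Longrightarrow> u \<in> extensional {1..m}"
  by (simp add: pos_cone_def)

lemma scale_one: "u \<in> extensional {1..m} \<Longrightarrow> scale_vec m 1 u = u"
  by (auto simp: scale_vec_def extensional_def)

lemma open_simplexD: "v \<in> open_simplex m \<Longrightarrow> v \<in> pos_cone m" "v \<in> open_simplex m \<Longrightarrow> coord_sum m v = 1"
  by (auto simp: open_simplex_eq)

context
  fixes m :: nat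
  assumes m: "m \<ge> 2"
begin

lemma step_perm_cases:
  assumes "irreducible_perm m \<pi>" "k \<in> {1..m}"
  obtains i where "i \<in> {1..m}" "k = step_perm m x \<pi> i"
  using permutes_image[OF step_perm_permutes[OF m assms(1)]] assms(2) by (metis imageE)

lemma extensional_step_eqI:
  assumes "irreducible_perm m \<pi>" "u \<in> extensional {1..m}" "v \<in> extensional {1..m}"
    and "\<And>i. i \<in> {1..m} \<Longrightarrow> u (step_perm m x \<pi> i) = v (step_perm m x \<pi> i)"
  shows "u = v"
  using assms(2,3)
proof (rule extensionalityI)
  fix k assume "k \<in> {1..m}"
  then show "u k = v k" using assms(4) by (metis step_perm_cases[OF assms(1)])
qed

lemma step_unstep:
  assumes "irreducible_perm m \<pi>" "v \<in> extensional {1..m}"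
  shows "mat_vec m (step_mat m x \<pi>) (unstep m x \<pi> v) = v"
proof (rule extensionalityI[OF mat_vec_extensional assms(2)])
  fix i assume i: "i \<in> {1..m}"
  show "mat_vec m (step_mat m x \<pi>) (unstep m x \<pi> v) i = v i"
    unfolding mat_vec_step_mat[OF m assms(1) i] unstep_step_perm[OF m assms(1) i]
      unstep_step_perm[OF m assms(1) winner_loser(2)[OF m assms(1)]]
    using winner_loser(3)[OF m assms(1), of x] by auto
qed

lemma unstep_step:
  assumes "irreducible_perm m \<pi>" "u \<in> extensional {1..m}"
  shows "unstep m x \<pi> (mat_vec m (step_mat m x \<pi>) u) = u"
proof (rule extensional_step_eqI[OF assms(1) _ assms(2)])
  show "unstep m x \<pi> (mat_vec m (step_mat m x \<pi>) u) \<in> extensional {1..m}" by (simp add: unstep_def)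
  fix i assume i: "i \<in> {1..m}"
  show "unstep m x \<pi> (mat_vec m (step_mat m x \<pi>) u) (step_perm m x \<pi> i) = u (step_perm m x \<pi> i)"
    unfolding unstep_step_perm[OF m assms(1) i] mat_vec_step_mat[OF m assms(1) i]
      mat_vec_step_mat[OF m assms(1) winner_loser(2)[OF m assms(1)]]
    using winner_loser(3)[OF m assms(1), of x] by auto
qed

lemma step_pos_cone:
  assumes "irreducible_perm m \<pi>" "u \<in> pos_cone m"
  shows "mat_vec m (step_mat m x \<pi>) u \<in> pos_cone m"
    "mat_vec m (step_mat m x \<pi>) u (loser m x \<pi>) < mat_vec m (step_mat m x \<pi>) u (winner m x \<pi>)"
proof -
  note S = step_perm_permutes[OF m assms(1), of x] and wl = winner_loser[OF m assms(1), of x]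
  have p: "u (step_perm m x \<pi> i) > 0" if "i \<in> {1..m}" for i
    using assms(2) permutes_in_image[OF S, of i] that by (simp add: pos_cone_def)
  show "mat_vec m (step_mat m x \<pi>) u \<in> pos_cone m"
    unfolding pos_cone_def using p wl by (auto simp: mat_vec_step_mat[OF m assms(1)] add_pos_pos)
  show "mat_vec m (step_mat m x \<pi>) u (loser m x \<pi>) < mat_vec m (step_mat m x \<pi>) u (winner m x \<pi>)"
    using p[OF wl(1)] wl by (simp add: mat_vec_step_mat[OF m assms(1)])
qed

lemma unstep_pos_cone:
  assumes "irreducible_perm m \<pi>" "v \<in> pos_cone m" "v (loser m x \<pi>) < v (winner m x \<pi>)"
  shows "unstep m x \<pi> v \<in> pos_cone m"
proof -
  have "unstep m x \<pi> v k > 0" if k: "k \<in> {1..m}" for k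
  proof -
    obtain i where i: "i \<in> {1..m}" "k = step_perm m x \<pi> i" using step_perm_cases[OF assms(1) k] .
    then show ?thesis using assms by (simp add: unstep_step_perm[OF m assms(1)] pos_cone_def)
  qed
  then show ?thesis by (simp add: pos_cone_def unstep_def)
qed

lemma unstep_scale: "unstep m x \<pi> (scale_vec m c v) = scale_vec m c (unstep m x \<pi> v)"
  by (simp add: unstep_def mat_vec_scale)

text \<open>The image is the preimage under \<open>unstep\<close>, which is a shear followed by a
  permutation of the coordinates; both preserve volume.\<close>

lemma emeasure_step_image:
  assumes ir: "irreducible_perm m \<pi>" and A: "A \<in> sets (lebesgue_PiM {1..m})"
  shows "mat_vec m (step_mat m x \<pi>) ` A \<in> sets (lebesgue_PiM {1..m})"
    "emeasure (lebesgue_PiM {1..m}) (mat_vec m (step_mat m x \<pi>) ` A) = emeasure (lebesgue_PiM {1..m}) A"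
proof -
  let ?L = "lebesgue_PiM {1..m}" and ?s = "step_perm m x \<pi>" and ?w = "winner m x \<pi>" and ?l = "loser m x \<pi>"
  note wl = winner_loser[OF m ir, of x]
  have S: "?s permutes {1..m}" by (rule step_perm_permutes[OF m ir])
  have S': "inv ?s permutes {1..m}" by (rule permutes_inv[OF S])
  have Aext: "A \<subseteq> extensional {1..m}" using sets.sets_into_space[OF A] by (simp add: space_lebesgue_PiM)
  define A1 where "A1 = {v \<in> extensional {1..m}. (\<lambda>i\<in>{1..m}. v (inv ?s i)) \<in> A}"
  have A1: "A1 \<in> sets ?L"
  proof -
    have "inv ?s i \<in> {1..m}" if "i \<in> {1..m}" for i using permutes_in_image[OF S'] that by blast
    then have "(\<lambda>v. \<lambda>i\<in>{1..m}. v (inv ?s i)) \<in> measurable ?L ?L"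
      by (intro measurable_restrict measurable_component_singleton)
    from measurable_sets[OF this A] show ?thesis
      by (simp add: A1_def space_lebesgue_PiM vimage_def Int_def conj_commute)
  qed
  have g: "(\<lambda>v. - v ?l) \<in> borel_measurable ?L"
    using measurable_component_singleton[OF wl(2), of "\<lambda>_. lborel"] by simp
  define A2 where "A2 = {v \<in> extensional {1..m}. v(?w := v ?w + (- v ?l)) \<in> A1}"
  have A2: "A2 \<in> sets ?L"
    using measurable_sets[OF measurable_PiM_shear[OF wl(1) g] A1]
    by (simp add: A2_def space_lebesgue_PiM vimage_def Int_def conj_commute)
  have un: "unstep m x \<pi> v = (\<lambda>i\<in>{1..m}. (v(?w := v ?w + (- v ?l))) (inv ?s i))" for v
  proof (rule extensional_step_eqI[OF ir])
    fix i assume i: "i \<in> {1..m}"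
    then have "?s i \<in> {1..m}" using permutes_in_image[OF S] by blast
    then show "unstep m x \<pi> v (?s i) = (\<lambda>i\<in>{1..m}. (v(?w := v ?w + (- v ?l))) (inv ?s i)) (?s i)"
      using unstep_step_perm[OF m ir i, of x v] permutes_inverses[OF S] by simp
  qed (simp_all add: unstep_def)
  have "mat_vec m (step_mat m x \<pi>) ` A = {v \<in> extensional {1..m}. unstep m x \<pi> v \<in> A}"
  proof (intro equalityI subsetI)
    fix v assume "v \<in> mat_vec m (step_mat m x \<pi>) ` A"
    then show "v \<in> {v \<in> extensional {1..m}. unstep m x \<pi> v \<in> A}" using Aext unstep_step[OF ir] by auto
  next
    fix v assume "v \<in> {v \<in> extensional {1..m}. unstep m x \<pi> v \<in> A}"
    then show "v \<in> mat_vec m (step_mat m x \<pi>) ` A"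
      by (intro image_eqI[of _ _ "unstep m x \<pi> v"]) (auto simp: step_unstep[OF ir])
  qed
  also have "\<dots> = A2"
  proof -
    have "v(?w := v ?w + (- v ?l)) \<in> extensional {1..m}" if "v \<in> extensional {1..m}" for v :: "nat \<Rightarrow> real"
      using that wl(1) by (auto simp: extensional_def)
    then show ?thesis by (auto simp: A2_def A1_def un)
  qed
  finally have eq: "mat_vec m (step_mat m x \<pi>) ` A = A2" .
  then show "mat_vec m (step_mat m x \<pi>) ` A \<in> sets ?L" using A2 by simp
  have "emeasure ?L A2 = emeasure ?L A1"
    unfolding A2_def using wl g A1 by (intro emeasure_lebesgue_PiM_shear) auto
  also have "\<dots> = emeasure ?L A"
    unfolding A1_def by (rule emeasure_lebesgue_PiM_permute[OF _ S' A]) simp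
  finally show "emeasure ?L (mat_vec m (step_mat m x \<pi>) ` A) = emeasure ?L A" by (simp add: eq)
qed

section \<open>Matrix products along words, inverse branches and cylinders\<close>

lemma word_map_Nil: "u \<in> extensional {1..m} \<Longrightarrow> word_map m \<pi> [] u = u"
  by (simp only: word_mat.simps mat_vec_id extensional_restrict)

lemma word_map_Cons: "word_map m \<pi> (x # w) u = mat_vec m (step_mat m x \<pi>) (word_map m (rauzy_step m x \<pi>) w u)"
  by (simp only: word_mat.simps mat_vec_mat_mul)

lemma word_map_append: "word_map m \<pi> (w @ w') u = word_map m \<pi> w (word_map m (rauzy_path m \<pi> w) w' u)"
proof (induction w arbitrary: \<pi>)
  case Nil
  then show ?case by (simp add: word_map_Nil[OF mat_vec_extensional])
next
  case (Cons x w)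
  then show ?case by (simp only: append_Cons word_map_Cons rauzy_path_simps)
qed

lemma irreducible_rauzy_path: "irreducible_perm m \<pi> \<Longrightarrow> irreducible_perm m (rauzy_path m \<pi> w)"
  by (induction w arbitrary: \<pi>) (simp_all add: irreducible_rauzy_step[OF m])

lemma word_map_pos_cone:
  "irreducible_perm m \<pi> \<Longrightarrow> u \<in> pos_cone m \<Longrightarrow> word_map m \<pi> w u \<in> pos_cone m"
proof (induction w arbitrary: \<pi>)
  case Nil then show ?case using word_map_Nil[OF pos_cone_ext] by simp
next
  case (Cons x w)
  then show ?case by (simp only: word_map_Cons step_pos_cone irreducible_rauzy_step[OF m])
qed

lemma word_mat_nonneg: "i \<in> {1..m} \<Longrightarrow> word_mat m \<pi> w i j \<ge> 0"
proof (induction w arbitrary: \<pi> i)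
  case Nil then show ?case by (simp add: mat_id_def word_mat.simps)
next
  case (Cons x w)
  then show ?case by (auto simp: mat_mul_def word_mat.simps step_mat_nonneg[OF m] intro!: sum_nonneg mult_nonneg_nonneg)
qed

lemma col_sum_word_mat_ge_1:
  "irreducible_perm m \<pi> \<Longrightarrow> j \<in> {1..m} \<Longrightarrow> col_sum m (word_mat m \<pi> w) j \<ge> 1"
proof (induction w arbitrary: \<pi>)
  case Nil
  have "(\<Sum>i=1..m. mat_id i j) = (\<Sum>i=1..m. if i = j then 1 else 0)"
    by (intro sum.cong) (auto simp: mat_id_def)
  then show ?case using Nil by (simp add: col_sum_def word_mat.simps)
next
  case (Cons x w)
  let ?B = "word_mat m (rauzy_step m x \<pi>) w"
  have ge: "col_sum m (step_mat m x \<pi>) k \<ge> 1" if k: "k \<in> {1..m}" for k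
  proof -
    obtain i where i: "i \<in> {1..m}" "k = step_perm m x \<pi> i" using step_perm_cases[OF Cons.prems(1) k] .
    have "1 \<le> step_mat m x \<pi> i k" using step_mat_eq[OF m Cons.prems(1) i(1), of x k] i(2) by simp
    also have "\<dots> \<le> col_sum m (step_mat m x \<pi>) k"
      unfolding col_sum_def using i(1) by (intro member_le_sum) (auto simp: step_mat_nonneg[OF m])
    finally show ?thesis .
  qed
  have "1 \<le> col_sum m ?B j" using Cons irreducible_rauzy_step[OF m] by blast
  also have "\<dots> = (\<Sum>k=1..m. 1 * ?B k j)" by (simp add: col_sum_def)
  also have "\<dots> \<le> (\<Sum>k=1..m. col_sum m (step_mat m x \<pi>) k * ?B k j)"
    using ge word_mat_nonneg by (intro sum_mono mult_right_mono) auto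
  also have "\<dots> = col_sum m (word_mat m \<pi> (x # w)) j"
    by (simp add: col_sum_def mat_mul_def word_mat.simps sum_distrib_right) (rule sum.swap)
  finally show ?case .
qed

lemma emeasure_word_image:
  assumes "irreducible_perm m \<pi>" "A \<in> sets (lebesgue_PiM {1..m})"
  shows "word_map m \<pi> w ` A \<in> sets (lebesgue_PiM {1..m})
    \<and> emeasure (lebesgue_PiM {1..m}) (word_map m \<pi> w ` A) = emeasure (lebesgue_PiM {1..m}) A"
  using assms(1)
proof (induction w arbitrary: \<pi>)
  case Nil
  have "word_map m \<pi> [] ` A = A"
  proof -
    have "A \<subseteq> extensional {1..m}" using sets.sets_into_space[OF assms(2)] by (simp add: space_lebesgue_PiM)
    then have "word_map m \<pi> [] u = u" if "u \<in> A" for u by (rule word_map_Nil[OF subsetD]) fact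
    then show ?thesis by simp
  qed
  then show ?case using assms(2) by simp
next
  case (Cons x w)
  have "word_map m \<pi> (x # w) ` A = mat_vec m (step_mat m x \<pi>) ` (word_map m (rauzy_step m x \<pi>) w ` A)"
    unfolding image_image by (rule image_cong) (simp_all only: word_map_Cons)
  then show ?case
    using Cons.IH[OF irreducible_rauzy_step[OF m Cons.prems]]
      emeasure_step_image[OF Cons.prems, of "word_map m (rauzy_step m x \<pi>) w ` A" x]
    by (simp only: simp_thms)
qed

lemma cyl_sets:
  assumes "irreducible_perm m \<pi>" shows "cyl m \<pi> w \<in> sets (simplex_borel m)"
proof -
  have "word_map m \<pi> w ` pos_cone m \<in> sets (PiM {1..m} (\<lambda>_. borel))"
    using emeasure_word_image[OF assms pos_cone_sets] by (simp add: sets_lebesgue_PiM)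
  then show ?thesis by (auto simp: cyl_def sets_restrict_space)
qed

lemma cyl_subset: "cyl m \<pi> w \<subseteq> open_simplex m"
  by (simp add: cyl_def)

lemma cyl_prefix: "irreducible_perm m \<pi> \<Longrightarrow> cyl m \<pi> (w @ w') \<subseteq> cyl m \<pi> w"
  unfolding cyl_def using word_map_pos_cone[OF irreducible_rauzy_path] by (auto simp: word_map_append)

lemma cyl_Nil: "cyl m \<pi> [] = open_simplex m"
  unfolding cyl_def using word_map_Nil[OF pos_cone_ext] open_simplexD(1) by (auto simp: image_iff)

text \<open>A linear image of the cone is invariant under positive scaling, so membership may be
  tested before or after normalization.\<close>

lemma normalize_mem_image_iff:
  assumes "u \<in> pos_cone m"
  shows "vec_normalize m u \<in> word_map m \<pi> w ` pos_cone m \<longleftrightarrow> u \<in> word_map m \<pi> w ` pos_cone m"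
proof
  have c: "coord_sum m u > 0" using coord_sum_pos[OF assms] m by simp
  {
    assume "vec_normalize m u \<in> word_map m \<pi> w ` pos_cone m"
    then obtain z where z: "z \<in> pos_cone m" "scale_vec m (1 / coord_sum m u) u = word_map m \<pi> w z"
      by (auto simp: vec_normalize_eq_scale)
    have "u = scale_vec m (coord_sum m u) (scale_vec m (1 / coord_sum m u) u)"
      using c pos_cone_ext[OF assms] by (simp add: scale_scale scale_one)
    also have "\<dots> = word_map m \<pi> w (scale_vec m (coord_sum m u) z)" by (simp only: z(2) mat_vec_scale)
    finally show "u \<in> word_map m \<pi> w ` pos_cone m" using scale_pos_cone[OF c z(1)] by blast
  next
    assume "u \<in> word_map m \<pi> w ` pos_cone m"
    then obtain z where z: "z \<in> pos_cone m" "u = word_map m \<pi> w z" by auto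
    then have "vec_normalize m u = word_map m \<pi> w (scale_vec m (1 / coord_sum m u) z)"
      by (simp only: mat_vec_scale vec_normalize_eq_scale)
    then show "vec_normalize m u \<in> word_map m \<pi> w ` pos_cone m" using scale_pos_cone[of "1 / coord_sum m u" z] c z(1) by simp
  }
qed

lemma cyl_Cons:
  assumes "irreducible_perm m \<pi>" "v \<in> open_simplex m"
  shows "v \<in> cyl m \<pi> (x # w) \<longleftrightarrow> v (loser m x \<pi>) < v (winner m x \<pi>) \<and>
     vec_normalize m (unstep m x \<pi> v) \<in> cyl m (rauzy_step m x \<pi>) w"
proof -
  note v = open_simplexD(1)[OF assms(2)]
  have "v \<in> word_map m \<pi> (x # w) ` pos_cone m \<longleftrightarrow> v (loser m x \<pi>) < v (winner m x \<pi>) \<and>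
     unstep m x \<pi> v \<in> word_map m (rauzy_step m x \<pi>) w ` pos_cone m"
  proof safe
    fix u assume u: "u \<in> pos_cone m" "v = word_map m \<pi> (x # w) u"
    let ?u = "word_map m (rauzy_step m x \<pi>) w u"
    have P: "?u \<in> pos_cone m" using word_map_pos_cone[OF irreducible_rauzy_step[OF m assms(1)] u(1)] .
    show "word_map m \<pi> (x # w) u (loser m x \<pi>) < word_map m \<pi> (x # w) u (winner m x \<pi>)"
      unfolding word_map_Cons by (rule step_pos_cone[OF assms(1) P])
    show "unstep m x \<pi> (word_map m \<pi> (x # w) u) \<in> word_map m (rauzy_step m x \<pi>) w ` pos_cone m"
      unfolding word_map_Cons unstep_step[OF assms(1) pos_cone_ext[OF P]] using u by blast
  next
    fix u assume u: "u \<in> pos_cone m" "unstep m x \<pi> v = word_map m (rauzy_step m x \<pi>) w u"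
    have "v = word_map m \<pi> (x # w) u"
      unfolding word_map_Cons u(2)[symmetric] using step_unstep[OF assms(1) pos_cone_ext[OF v]] by simp
    then show "v \<in> word_map m \<pi> (x # w) ` pos_cone m" using u by blast
  qed
  moreover have "vec_normalize m (unstep m x \<pi> v) \<in> open_simplex m"
    if "v (loser m x \<pi>) < v (winner m x \<pi>)"
    using vec_normalize_pos_cone[OF unstep_pos_cone[OF assms(1) v that]] m by simp
  ultimately show ?thesis
    using normalize_mem_image_iff[OF unstep_pos_cone[OF assms(1) v], of x "rauzy_step m x \<pi>" w] assms(2)
    unfolding cyl_def by blast
qed

lemma typed_exclusive: "typed m x y \<Longrightarrow> typed m x' y \<Longrightarrow> x = x'"
  by (cases x; cases x') (auto simp: typed_def winner_def loser_def)

lemma rauzy_T_typed: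
  assumes "typed m x (v, \<pi>)"
  shows "rauzy_T m (v, \<pi>) = (vec_normalize m (unstep m x \<pi> v), rauzy_step m x \<pi>)"
  using assms
  by (cases x) (auto simp: typed_def rauzy_T_def winner_def loser_def simplex_plus_def simplex_minus_def
      unstep_def step_mat_def rauzy_step_def)

lemma cyl_iff_typed:
  assumes "irreducible_perm m \<pi>" "v \<in> open_simplex m"
  shows "v \<in> cyl m \<pi> w \<longleftrightarrow> (\<forall>i<length w. typed m (w ! i) ((rauzy_T m ^^ i) (v, \<pi>)))"
  using assms
proof (induction w arbitrary: v \<pi>)
  case Nil then show ?case by (simp add: cyl_Nil)
next
  case (Cons x w)
  show ?case
  proof (cases "typed m x (v, \<pi>)")
    case True
    let ?v = "vec_normalize m (unstep m x \<pi> v)"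
    have l: "v (loser m x \<pi>) < v (winner m x \<pi>)" using True by (simp add: typed_def)
    have v: "?v \<in> open_simplex m"
      using vec_normalize_pos_cone[OF unstep_pos_cone[OF Cons.prems(1) open_simplexD(1)[OF Cons.prems(2)] l]] m by simp
    have "v \<in> cyl m \<pi> (x # w) \<longleftrightarrow> ?v \<in> cyl m (rauzy_step m x \<pi>) w"
      using cyl_Cons[OF Cons.prems] l by simp
    also have "\<dots> \<longleftrightarrow> (\<forall>i<length w. typed m (w ! i) ((rauzy_T m ^^ i) (?v, rauzy_step m x \<pi>)))"
      by (rule Cons.IH[OF irreducible_rauzy_step[OF m Cons.prems(1)] v])
    also have "\<dots> \<longleftrightarrow> (\<forall>i<length w. typed m ((x # w) ! Suc i) ((rauzy_T m ^^ Suc i) (v, \<pi>)))"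
      by (simp add: funpow_swap1 rauzy_T_typed[OF True])
    also have "\<dots> \<longleftrightarrow> (\<forall>i<length (x # w). typed m ((x # w) ! i) ((rauzy_T m ^^ i) (v, \<pi>)))"
      using True by (auto simp: less_Suc_eq_0_disj)
    finally show ?thesis .
  next
    case False
    then show ?thesis using Cons.prems cyl_Cons[OF Cons.prems, of x w] by (auto simp: typed_def)
  qed
qed

text \<open>The projectivized \<open>word_map\<close> is thus the inverse branch of the iterate of
  \<open>rauzy_T\<close> along \<open>w\<close>.\<close>

lemma rauzy_T_word_map:
  assumes "irreducible_perm m \<pi>" "u \<in> pos_cone m"
  shows "(rauzy_T m ^^ length w) (vec_normalize m (word_map m \<pi> w u), \<pi>) = (vec_normalize m u, rauzy_path m \<pi> w)"
  using assms
proof (induction w arbitrary: \<pi>)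
  case Nil then show ?case using word_map_Nil[OF pos_cone_ext] by simp
next
  case (Cons x w)
  let ?u = "word_map m (rauzy_step m x \<pi>) w u"
  let ?c = "1 / coord_sum m (mat_vec m (step_mat m x \<pi>) ?u)"
  have P: "?u \<in> pos_cone m" using word_map_pos_cone[OF irreducible_rauzy_step[OF m Cons.prems(1)] Cons.prems(2)] .
  have v: "vec_normalize m (word_map m \<pi> (x # w) u) = mat_vec m (step_mat m x \<pi>) (scale_vec m ?c ?u)"
    unfolding word_map_Cons vec_normalize_eq_scale by (simp only: mat_vec_scale)
  have c: "?c > 0" using coord_sum_pos[OF step_pos_cone(1)[OF Cons.prems(1) P]] m by simp
  have su: "scale_vec m ?c ?u \<in> pos_cone m" using scale_pos_cone[OF c P] .
  have o: "vec_normalize m (word_map m \<pi> (x # w) u) \<in> open_simplex m"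
    using vec_normalize_pos_cone[OF word_map_pos_cone[OF Cons.prems]] m by simp
  have t: "typed m x (vec_normalize m (word_map m \<pi> (x # w) u), \<pi>)"
    using o step_pos_cone(2)[OF Cons.prems(1) su] unfolding typed_def v by simp
  have "rauzy_T m (vec_normalize m (word_map m \<pi> (x # w) u), \<pi>) = (vec_normalize m ?u, rauzy_step m x \<pi>)"
    unfolding rauzy_T_typed[OF t] unfolding v unstep_step[OF Cons.prems(1) pos_cone_ext[OF su]] vec_normalize_scale[OF c] ..
  then show ?case using Cons.IH[OF irreducible_rauzy_step[OF m Cons.prems(1)] Cons.prems(2)]
    by (simp add: funpow_swap1)
qed

end

context
  fixes m :: nat
  assumes m: "m \<ge> 2"
begin

lemma word_mat_append:
  "i \<in> {1..m} \<Longrightarrow> word_mat m \<pi> (w @ w') i j = mat_mul m (word_mat m \<pi> w) (word_mat m (rauzy_path m \<pi> w) w') i j"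
proof (induction w arbitrary: \<pi> i)
  case Nil
  then show ?case by (simp add: word_mat.simps mat_mul_id_left)
next
  case (Cons y w)
  have "word_mat m \<pi> ((y # w) @ w') i j
      = mat_mul m (step_mat m y \<pi>) (mat_mul m (word_mat m (rauzy_step m y \<pi>) w) (word_mat m (rauzy_path m \<pi> (y # w)) w')) i j"
    unfolding append_Cons word_mat.simps mat_mul_def[of m "step_mat m y \<pi>"]
    using Cons.IH[of _ "rauzy_step m y \<pi>"] Cons.prems by (intro sum.cong) auto
  then show ?case by (simp only: word_mat.simps mat_mul_assoc)
qed

lemma word_mat_snoc:
  assumes "i \<in> {1..m}" "j \<in> {1..m}"
  shows "word_mat m \<pi> (w @ [x]) i j = mat_mul m (word_mat m \<pi> w) (step_mat m x (rauzy_path m \<pi> w)) i j"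
  using assms by (simp add: word_mat_append word_mat.simps mat_mul_assoc[symmetric] mat_mul_id_right)

text \<open>
  The letters of the two rows are tracked: \<open>t n\<close> and \<open>b n\<close> list the original names of the letters
  in the order of the intervals and of their images after \<open>n\<close> steps.
\<close>

lemma rauzy_orbit_words:
  assumes ir: "irreducible_perm m \<pi>" and v: "v \<in> open_simplex m"
    and s: "\<And>n. typed m (s n) ((rauzy_T m ^^ n) (v, \<pi>))"
  shows "\<exists>n. \<forall>i\<in>{1..m}. \<forall>j\<in>{1..m}. word_mat m \<pi> (map s [0..<n]) i j > 0"
    and "\<exists>\<^sub>\<infinity>n. s n = x"
proof -
  define P where "P n = rauzy_path m \<pi> (map s [0..<n])" for n
  have P0: "P 0 = \<pi>" and PS: "P (Suc n) = rauzy_step m (s n) (P n)" for n by (simp_all add: P_def)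
  have irP: "irreducible_perm m (P n)" for n unfolding P_def by (rule irreducible_rauzy_path[OF m ir])
  define \<sigma> where "\<sigma> n = step_perm m (s n) (P n)" for n
  define w where "w n = winner m (s n) (P n)" for n
  define l where "l n = loser m (s n) (P n)" for n
  have \<sigma>: "\<sigma> n permutes {1..m}" for n unfolding \<sigma>_def by (rule step_perm_permutes[OF m irP])
  have wl: "w n \<in> {1..m}" "l n \<in> {1..m}" "w n \<noteq> l n" for n
    unfolding w_def l_def using winner_loser[OF m irP] by auto
  \<comment> \<open>Lengths without normalization: \<open>rauzy_all_letters_win\<close> needs the
    winner to lose exactly the length of the loser. \<open>Tu\<close> relates them to the orbit on
    the simplex.\<close>
  define u where "u = rec_nat v (\<lambda>n. unstep m (s n) (P n))"
  have u0: "u 0 = v" and uS: "u (Suc n) = unstep m (s n) (P n) (u n)" for n by (simp_all add: u_def)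
  have Tu: "u n \<in> pos_cone m \<and> (rauzy_T m ^^ n) (v, \<pi>) = (vec_normalize m (u n), P n)" for n
  proof (induction n)
    case 0 then show ?case using v by (simp add: u0 P0 open_simplexD vec_normalize_id)
  next
    case (Suc n)
    then have un: "u n \<in> pos_cone m" and T: "(rauzy_T m ^^ n) (v, \<pi>) = (vec_normalize m (u n), P n)" by auto
    have c: "coord_sum m (u n) > 0" using coord_sum_pos[OF un] m by simp
    have ty: "typed m (s n) (vec_normalize m (u n), P n)" using s[of n] T by simp
    then have "u n (l n) < u n (w n)"
      using c wl[of n] by (auto simp: typed_def vec_normalize_def w_def l_def divide_less_cancel)
    then have uS_pos: "u (Suc n) \<in> pos_cone m"
      using unstep_pos_cone[OF m irP un, of "s n" n] by (simp add: uS w_def l_def)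
    have "(rauzy_T m ^^ Suc n) (v, \<pi>) = rauzy_T m (vec_normalize m (u n), P n)" using T by simp
    also have "\<dots> = (vec_normalize m (unstep m (s n) (P n) (vec_normalize m (u n))), P (Suc n))"
      by (simp add: rauzy_T_typed[OF m ty] PS)
    also have "vec_normalize m (unstep m (s n) (P n) (vec_normalize m (u n))) = vec_normalize m (u (Suc n))"
      unfolding vec_normalize_eq_scale[of m "u n"] unstep_scale[OF m] uS
      by (rule vec_normalize_scale) (use c in simp)
    finally show ?case using uS_pos by simp
  qed
  define t where "t = rec_nat id (\<lambda>n f. f \<circ> inv (\<sigma> n))"
  have t0: "t 0 = id" and tS: "t (Suc n) = t n \<circ> inv (\<sigma> n)" for n by (simp_all add: t_def)
  have t: "t n permutes {1..m}" for n
  proof (induction n)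
    case 0 show ?case unfolding t0 by (rule permutes_id)
  next
    case (Suc n) then show ?case unfolding tS by (intro permutes_compose permutes_inv \<sigma>)
  qed
  have invtS: "inv (t (Suc n)) = \<sigma> n \<circ> inv (t n)" for n
    unfolding tS using permutes_bij[OF t[of n]] permutes_bij[OF permutes_inv[OF \<sigma>[of n]]]
    by (simp add: o_inv_distrib permutes_inv_inv[OF \<sigma>])
  have tS\<sigma>: "t (Suc n) (\<sigma> n j) = t n j" for n j by (simp add: tS permutes_inverses[OF \<sigma>])
  \<comment> \<open>The image interval at place \<open>j\<close> is that of the interval at place
    \<open>inv (P n) j\<close>.\<close>
  define b where "b n = t n \<circ> inv (P n)" for n
  have Pp: "P n permutes {1..m}" for n by (rule irreducible_permD[OF irP])
  have bp: "b n permutes {1..m}" for n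
    unfolding b_def by (intro permutes_compose permutes_inv t Pp)
  define win where "win n = t n (w n)" for n
  define los where "los n = t n (l n)" for n
  define len where "len n \<alpha> = u n (inv (t n) \<alpha>)" for n \<alpha>
  \<comment> \<open>Under \<open>a\<close> the winner is the last letter of the bottom row, which is
    kept, and the top row is shifted; under \<open>b\<close> the rows exchange roles.
    \<open>keep_row\<close> records that the winner stays at the end of its row and so takes part in
    the next step.\<close>
  have step: "(win n = t n m \<and> los n = b n m \<and> t (Suc n) = t n \<and>
         (\<exists>p\<in>{1..<m}. b n p = win n \<and> (\<forall>j\<in>{1..m}. b (Suc n) (rauzy_shift m p j) = b n j))) \<or>
       (win n = b n m \<and> los n = t n m \<and> b (Suc n) = b n \<and>
         (\<exists>p\<in>{1..<m}. t n p = win n \<and> (\<forall>j\<in>{1..m}. t (Suc n) (rauzy_shift m p j) = t n j)))"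
    and keep_row: "if s n then b (Suc n) = b n \<and> win n = b n m else t (Suc n) = t n \<and> win n = t n m" for n
  proof -
    let ?A = "win n = t n m \<and> los n = b n m \<and> t (Suc n) = t n \<and>
         (\<exists>p\<in>{1..<m}. b n p = win n \<and> (\<forall>j\<in>{1..m}. b (Suc n) (rauzy_shift m p j) = b n j))"
    let ?B = "win n = b n m \<and> los n = t n m \<and> b (Suc n) = b n \<and>
         (\<exists>p\<in>{1..<m}. t n p = win n \<and> (\<forall>j\<in>{1..m}. t (Suc n) (rauzy_shift m p j) = t n j))"
    have B: ?B if "s n"
    proof -
      have \<sigma>n: "\<sigma> n = rauzy_shift m (inv (P n) m)" using that by (simp add: \<sigma>_def step_perm_def)
      have "inv (P (Suc n)) = \<sigma> n \<circ> inv (P n)"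
        using that permutes_bij[OF Pp[of n]] permutes_bij[OF permutes_inv[OF \<sigma>[of n]]]
        by (simp add: PS rauzy_step_def rauzy_a_eq[OF m irP] \<sigma>n[symmetric] o_inv_distrib permutes_inv_inv[OF \<sigma>])
      then have "b (Suc n) = b n" by (simp add: b_def fun_eq_iff tS\<sigma>)
      moreover have "\<forall>j. t (Suc n) (rauzy_shift m (inv (P n) m) j) = t n j" using tS\<sigma> \<sigma>n by metis
      ultimately show ?thesis using that irreducible_last(2)[OF m irP[of n]]
        by (auto simp: win_def los_def w_def l_def winner_def loser_def b_def)
    qed
    have A: ?A if "\<not> s n"
    proof -
      have \<sigma>n: "\<sigma> n = id" using that by (simp add: \<sigma>_def step_perm_def)
      let ?\<rho> = "rauzy_shift m (P n m)"
      have \<rho>: "?\<rho> permutes {1..m}" by (rule rauzy_shift_permutes[OF irreducible_last(1)[OF m irP]])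
      have tt: "t (Suc n) = t n" by (simp add: tS \<sigma>n inv_id)
      have "inv (P (Suc n)) = inv (P n) \<circ> inv ?\<rho>"
        using that permutes_bij[OF Pp[of n]] permutes_bij[OF \<rho>]
        by (simp add: PS rauzy_step_def rauzy_b_eq[OF m irP] o_inv_distrib)
      then have "b (Suc n) (?\<rho> j) = b n j" for j by (simp add: b_def tt permutes_inverses[OF \<rho>])
      moreover have "b n (P n m) = t n m" by (simp add: b_def permutes_inverses[OF Pp])
      ultimately show ?thesis using that irreducible_last(1)[OF m irP[of n]] tt
        by (auto simp: win_def los_def w_def l_def winner_def loser_def) (auto simp: b_def)
    qed
    show "?A \<or> ?B" using A B by blast
    show "if s n then b (Suc n) = b n \<and> win n = b n m else t (Suc n) = t n \<and> win n = t n m"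
      using A B by auto
  qed
  have lastP: "inv (t n) \<alpha> \<in> {1..m} \<longleftrightarrow> \<alpha> \<in> {1..m}" for n \<alpha>
    by (rule permutes_in_image[OF permutes_inv[OF t]])
  have wins: "\<exists>\<^sub>\<infinity>n. win n = \<alpha>" if \<alpha>: "\<alpha> \<in> {1..m}" for \<alpha>
  proof (rule rauzy_all_letters_win[where t = t and b = b and len = len and L = "{1..m}" and m = m and los = los])
    show "bij_betw (t n) {1..m} {1..m}" "bij_betw (b n) {1..m} {1..m}" for n
      using t bp by (auto intro: permutes_imp_bij)
    show "len n \<alpha> > 0" if "\<alpha> \<in> {1..m}" for n \<alpha>
      using Tu[of n] lastP[of n \<alpha>] that by (auto simp: len_def pos_cone_def)
    show "len (Suc n) \<alpha> = (if \<alpha> = win n then len n \<alpha> - len n (los n) else len n \<alpha>)"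
      if "\<alpha> \<in> {1..m}" for n \<alpha>
    proof -
      let ?i = "inv (t n) \<alpha>"
      have i: "?i \<in> {1..m}" "t n ?i = \<alpha>" using lastP that permutes_inverses(1)[OF t] by auto
      have "len (Suc n) \<alpha> = unstep m (s n) (P n) (u n) (step_perm m (s n) (P n) ?i)"
        by (simp add: len_def invtS uS \<sigma>_def)
      also have "\<dots> = u n ?i - (if ?i = w n then u n (l n) else 0)"
        unfolding unstep_step_perm[OF m irP i(1)] w_def l_def ..
      also have "?i = w n \<longleftrightarrow> \<alpha> = win n"
        using i permutes_inverses(2)[OF t] by (auto simp: win_def)
      finally show ?thesis by (simp add: len_def los_def permutes_inverses(2)[OF t])
    qed
    show "t n ` {1..k} \<noteq> b n ` {1..k}" if k: "k \<in> {1..<m}" for n k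
    proof
      assume "t n ` {1..k} = b n ` {1..k}"
      then have "t n ` {1..k} = t n ` (inv (P n) ` {1..k})" by (simp add: b_def image_comp)
      then have "{1..k} = inv (P n) ` {1..k}" using permutes_inj[OF t] by (simp add: inj_image_eq_iff)
      then have "P n ` {1..k} = P n ` (inv (P n) ` {1..k})" by simp
      also have "\<dots> = {1..k}" by (simp add: image_image permutes_inverses[OF Pp])
      finally have "P n ` {1..k} = {1..k}" .
      moreover have "k \<in> {1..m}" using k by auto
      ultimately have "k = m" using irP[of n] unfolding irreducible_perm_def by blast
      then show False using k by simp
    qed
  qed (use step \<alpha> m in auto)
  show "\<exists>\<^sub>\<infinity>n. s n = x"
  proof (rule ccontr)
    assume "\<not> (\<exists>\<^sub>\<infinity>n. s n = x)"
    then obtain N where N: "\<And>n. n \<ge> N \<Longrightarrow> s n = (\<not> x)" by (auto simp: MOST_nat_le not_INFM)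
    \<comment> \<open>If one letter of the itinerary were eventually absent, the row ending with the
      winner would never change again and the winner would be constant; but the letters 1 and 2 both
      win infinitely often.\<close>
    have const: "win n = win N" if "n \<ge> N" for n
      using that
    proof (induction n rule: dec_induct)
      case (step n)
      then show ?case using N[of n] N[of "Suc n"] keep_row[of n] keep_row[of "Suc n"] by (cases x) auto
    qed simp
    have "1 \<in> {1..m}" "2 \<in> {1..m}" using m by auto
    from wins[OF this(1)] wins[OF this(2)] obtain n n' where "n \<ge> N" "win n = 1" "n' \<ge> N" "win n' = 2"
      unfolding INFM_nat_le by metis
    then show False using const by (metis one_eq_numeral_iff num.distinct(1))
  qed
  \<comment> \<open>The support of the column that belongs to the original letter \<alpha>.
    Multiplication by the next step matrix adds the winner's column to the loser's
    (\<open>H\<close>), which is the update rule of \<open>rauzy_supports_full\<close>.\<close>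
  define S where "S n \<alpha> = {i\<in>{1..m}. word_mat m \<pi> (map s [0..<n]) i (inv (t n) \<alpha>) > 0}" for n \<alpha>
  have "\<exists>n. \<forall>\<alpha>\<in>{1..m}. S n \<alpha> = {1..m}"
  proof (rule rauzy_supports_full[where win = win and los = los])
    show "win n \<in> {1..m}" "los n \<in> {1..m}" for n
      using wl[of n] permutes_in_image[OF t] by (auto simp: win_def los_def)
    show "win n = win (Suc n) \<or> win n = los (Suc n)" for n
      using keep_row[of n] step[of "Suc n"] by (cases "s n") auto
    show "\<alpha> \<in> S 0 \<alpha>" if "\<alpha> \<in> {1..m}" for \<alpha> using that by (simp add: S_def t0 word_mat.simps mat_id_def inv_id)
    show "S n \<alpha> \<subseteq> {1..m}" for n \<alpha> by (auto simp: S_def)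
    show "S (Suc n) \<alpha> = (if \<alpha> = los n then S n \<alpha> \<union> S n (win n) else S n \<alpha>)" if \<alpha>: "\<alpha> \<in> {1..m}" for n \<alpha>
    proof -
      let ?H = "word_mat m \<pi> (map s [0..<n])" and ?j = "inv (t n) \<alpha>"
      have j: "?j \<in> {1..m}" "\<sigma> n ?j \<in> {1..m}" using lastP \<alpha> permutes_in_image[OF \<sigma>] by auto
      have inj: "\<sigma> n i = \<sigma> n k \<longleftrightarrow> i = k" for i k using permutes_inj[OF \<sigma>] by (auto dest: injD)
      have H: "word_mat m \<pi> (map s [0..<Suc n]) i (\<sigma> n ?j) = ?H i ?j + (if ?j = l n then ?H i (w n) else 0)"
        if i: "i \<in> {1..m}" for i
      proof -
        have "word_mat m \<pi> (map s [0..<Suc n]) i (\<sigma> n ?j) = (\<Sum>k=1..m. ?H i k * step_mat m (s n) (P n) k (\<sigma> n ?j))"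
          using word_mat_snoc[OF i j(2), of \<pi> "map s [0..<n]" "s n"] by (simp add: mat_mul_def P_def)
        also have "\<dots> = (\<Sum>k=1..m. (if k = ?j then ?H i k else 0) + (if k = w n then if ?j = l n then ?H i k else 0 else 0))"
          by (intro sum.cong) (auto simp: step_mat_eq[OF m irP] \<sigma>_def[symmetric] w_def[symmetric] l_def[symmetric] inj distrib_left)
        also have "\<dots> = ?H i ?j + (if ?j = l n then ?H i (w n) else 0)"
          using j wl[of n] by (simp add: sum.distrib)
        finally show ?thesis .
      qed
      have "?j = l n \<longleftrightarrow> \<alpha> = los n" unfolding los_def using permutes_inverses[OF t[of n]] by metis
      moreover have "inv (t n) (win n) = w n" by (simp add: win_def permutes_inverses[OF t])
      moreover have "?H i ?j \<ge> 0" "?H i (w n) \<ge> 0" if "i \<in> {1..m}" for i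
        using that by (auto intro: word_mat_nonneg[OF m])
      ultimately have e: "?j = l n \<longleftrightarrow> \<alpha> = los n" "inv (t n) (win n) = w n"
        and nn: "\<And>i. i \<in> {1..m} \<Longrightarrow> ?H i ?j \<ge> 0 \<and> ?H i (w n) \<ge> 0" by auto
      have "i \<in> S (Suc n) \<alpha> \<longleftrightarrow> i \<in> (if \<alpha> = los n then S n \<alpha> \<union> S n (win n) else S n \<alpha>)" for i
      proof (cases "i \<in> {1..m}")
        case True
        have "i \<in> S (Suc n) \<alpha> \<longleftrightarrow> ?H i ?j + (if \<alpha> = los n then ?H i (w n) else 0) > 0"
          unfolding e(1)[symmetric] H[OF True, symmetric] using True
          by (simp add: S_def invtS del: upt_Suc)
        moreover have "i \<in> S n \<alpha> \<longleftrightarrow> ?H i ?j > 0" "i \<in> S n (win n) \<longleftrightarrow> ?H i (w n) > 0"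
          using True by (simp_all add: S_def e(2))
        ultimately show ?thesis using nn[OF True] by auto
      qed (auto simp: S_def)
      then show ?thesis by blast
    qed
  qed (use wins in auto)
  then obtain n where n: "\<And>\<alpha>. \<alpha> \<in> {1..m} \<Longrightarrow> S n \<alpha> = {1..m}" by blast
  have "word_mat m \<pi> (map s [0..<n]) i j > 0" if "i \<in> {1..m}" "j \<in> {1..m}" for i j
  proof -
    have "t n j \<in> {1..m}" using permutes_in_image[OF t] that(2) by blast
    then have "i \<in> S n (t n j)" using n that(1) by blast
    then show ?thesis by (simp add: S_def permutes_inverses(2)[OF t])
  qed
  then show "\<exists>n. \<forall>i\<in>{1..m}. \<forall>j\<in>{1..m}. word_mat m \<pi> (map s [0..<n]) i j > 0" by blast
qed

end

subsection \<open>Contraction of cylinders\<close>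

text \<open>In each row the entries divided by their column sums lie in an interval of length
  \<open>d\<close>. The normalized columns span the closure of a cylinder, so \<open>d\<close>
  bounds its width in every coordinate.\<close>

definition row_osc :: "nat \<Rightarrow> (nat \<Rightarrow> nat \<Rightarrow> real) \<Rightarrow> real \<Rightarrow> bool" where
  "row_osc m A d \<longleftrightarrow> (\<forall>i\<in>{1..m}. \<exists>a. \<forall>j\<in>{1..m}. a * col_sum m A j \<le> A i j \<and> A i j \<le> (a + d) * col_sum m A j)"

lemma col_sum_mat_mul: "col_sum m (mat_mul m A B) j = (\<Sum>k=1..m. col_sum m A k * B k j)"
  by (simp add: col_sum_def mat_mul_def sum_distrib_right) (rule sum.swap)

lemma row_osc_mono: "row_osc m A d \<Longrightarrow> d \<le> d' \<Longrightarrow> (\<And>j. j \<in> {1..m} \<Longrightarrow> col_sum m A j \<ge> 0) \<Longrightarrow> row_osc m A d'"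
  unfolding row_osc_def by (meson add_left_mono mult_right_mono order_trans)

text \<open>
  Doeblin's argument: the columns of \<open>A * B\<close>, normalized by their sums, are averages of the
  normalized columns of \<open>A\<close>, and all these averages share a part of weight \<open>c\<close>.
\<close>

lemma row_osc_mat_mul:
  assumes A: "row_osc m A d" and c: "0 \<le> c" "c \<le> 1"
    and s: "\<And>k. k \<in> {1..m} \<Longrightarrow> col_sum m A k > 0"
    and B: "\<And>k j. k \<in> {1..m} \<Longrightarrow> j \<in> {1..m} \<Longrightarrow> 0 \<le> B k j \<and> c * col_sum m B j \<le> B k j"
  shows "row_osc m (mat_mul m A B) ((1 - c) * d)"
  unfolding row_osc_def
proof
  fix i assume i: "i \<in> {1..m}"
  obtain a where a: "\<And>k. k \<in> {1..m} \<Longrightarrow> a * col_sum m A k \<le> A i k"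
      "\<And>k. k \<in> {1..m} \<Longrightarrow> A i k \<le> (a + d) * col_sum m A k"
    using A i unfolding row_osc_def by blast
  define D where "D k = A i k - a * col_sum m A k" for k
  have D: "0 \<le> D k" "D k \<le> d * col_sum m A k" if "k \<in> {1..m}" for k
    using a[OF that] by (auto simp: D_def algebra_simps)
  define \<Sigma> where "\<Sigma> = (\<Sum>k=1..m. col_sum m A k)"
  have \<Sigma>: "\<Sigma> > 0" unfolding \<Sigma>_def using s i by (intro sum_pos) auto
  \<comment> \<open>\<open>a + \<rho>\<close> is the mean of the normalized entries of row
    \<open>i\<close>, weighted by the column sums. The lower bound moves from \<open>a\<close>
    towards it by \<open>c * \<rho>\<close> and the upper bound from \<open>a + d\<close> by
    \<open>c * (d - \<rho>)\<close>, which leaves the length \<open>(1 - c) * d\<close>.\<close>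
  define \<rho> where "\<rho> = (\<Sum>k=1..m. D k) / \<Sigma>"
  have \<rho>: "(\<Sum>k=1..m. D k) = \<rho> * \<Sigma>" using \<Sigma> by (simp add: \<rho>_def)
  have \<rho>0: "0 \<le> \<rho>" unfolding \<rho>_def using \<Sigma> D by (intro divide_nonneg_pos sum_nonneg) auto
  have \<rho>d: "\<rho> \<le> d"
  proof -
    have "(\<Sum>k=1..m. D k) \<le> (\<Sum>k=1..m. d * col_sum m A k)" using D by (intro sum_mono) auto
    then show ?thesis using \<Sigma> by (simp add: \<rho>_def pos_divide_le_eq \<Sigma>_def sum_distrib_left)
  qed
  show "\<exists>a'. \<forall>j\<in>{1..m}. a' * col_sum m (mat_mul m A B) j \<le> mat_mul m A B i j \<and>
      mat_mul m A B i j \<le> (a' + (1 - c) * d) * col_sum m (mat_mul m A B) j"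
  proof (intro exI[of _ "a + c * \<rho>"] ballI)
    fix j assume j: "j \<in> {1..m}"
    define q where "q = col_sum m B j"
    define V where "V = col_sum m (mat_mul m A B) j"
    have Bq: "B k j \<le> q" if "k \<in> {1..m}" for k
      unfolding q_def col_sum_def using B j that by (intro member_le_sum) auto
    have Bc: "c * q \<le> B k j" "0 \<le> B k j" if "k \<in> {1..m}" for k using B[OF that j] by (auto simp: q_def)
    have V: "V = (\<Sum>k=1..m. col_sum m A k * B k j)" by (simp add: V_def col_sum_mat_mul)
    have "V \<le> (\<Sum>k=1..m. col_sum m A k * q)"
      unfolding V using Bq s by (intro sum_mono mult_left_mono) (auto simp: less_imp_le)
    then have Vq: "V \<le> q * \<Sigma>" by (simp add: \<Sigma>_def sum_distrib_left mult.commute)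
    have E: "mat_mul m A B i j = a * V + (\<Sum>k=1..m. D k * B k j)"
      by (simp add: mat_mul_def V D_def sum_distrib_left left_diff_distrib sum_subtractf mult.assoc)
    have "c * \<rho> * V \<le> c * \<rho> * (q * \<Sigma>)" using Vq c \<rho>0 by (intro mult_left_mono) auto
    also have "\<dots> = (\<Sum>k=1..m. D k * (c * q))" unfolding sum_distrib_right[symmetric] \<rho> by (simp add: mult_ac)
    also have "\<dots> \<le> (\<Sum>k=1..m. D k * B k j)" using D Bc by (intro sum_mono mult_left_mono) auto
    finally have lo: "c * \<rho> * V \<le> (\<Sum>k=1..m. D k * B k j)" .
    \<comment> \<open>The estimate \<open>lo\<close> again, with the complementary weights
      \<open>d * col_sum m A k - D k\<close> in place of \<open>D k\<close>.\<close>
    have "c * (d - \<rho>) * V \<le> c * (d - \<rho>) * (q * \<Sigma>)" using Vq c \<rho>d by (intro mult_left_mono) auto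
    also have "\<dots> = (\<Sum>k=1..m. (d * col_sum m A k - D k) * (c * q))"
      by (simp only: sum_distrib_right[symmetric] sum_subtractf sum_distrib_left[symmetric] \<rho> \<Sigma>_def[symmetric])
         (simp add: algebra_simps)
    also have "\<dots> \<le> (\<Sum>k=1..m. (d * col_sum m A k - D k) * B k j)"
      using D Bc by (intro sum_mono mult_left_mono) auto
    also have "\<dots> = d * V - (\<Sum>k=1..m. D k * B k j)"
      by (simp add: V left_diff_distrib sum_subtractf sum_distrib_left mult.assoc)
    finally have hi: "(\<Sum>k=1..m. D k * B k j) \<le> d * V - c * (d - \<rho>) * V" by simp
    show "(a + c * \<rho>) * col_sum m (mat_mul m A B) j \<le> mat_mul m A B i j \<and>
      mat_mul m A B i j \<le> (a + c * \<rho> + (1 - c) * d) * col_sum m (mat_mul m A B) j"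
      using lo hi unfolding V_def[symmetric] E by (simp add: algebra_simps)
  qed
qed

lemma positive_mat_col_ratio:
  assumes "m \<ge> 1" "\<And>k j. k \<in> {1..m} \<Longrightarrow> j \<in> {1..m} \<Longrightarrow> (B k j :: real) > 0"
  obtains c where "0 < c" "c \<le> 1" "\<And>k j. k \<in> {1..m} \<Longrightarrow> j \<in> {1..m} \<Longrightarrow> c * col_sum m B j \<le> B k j"
proof -
  define X where "X = (\<lambda>(k, j). B k j / col_sum m B j) ` ({1..m} \<times> {1..m})"
  have X: "finite X" "X \<noteq> {}" using assms(1) by (auto simp: X_def)
  have cs: "col_sum m B j > 0" if "j \<in> {1..m}" for j
    unfolding col_sum_def using assms that by (intro sum_pos) auto
  have pos: "Min X > 0" using X assms(2) cs by (auto simp: X_def)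
  have le: "Min X * col_sum m B j \<le> B k j" if "k \<in> {1..m}" "j \<in> {1..m}" for k j
  proof -
    have "Min X \<le> B k j / col_sum m B j" using X that by (intro Min_le) (auto simp: X_def)
    then show ?thesis using cs[OF that(2)] by (simp add: pos_le_divide_eq)
  qed
  have "Min X \<le> 1"
  proof -
    have "Min X * col_sum m B 1 \<le> B 1 1" using le assms(1) by auto
    also have "\<dots> \<le> col_sum m B 1"
      unfolding col_sum_def using assms by (intro member_le_sum) (auto simp: less_imp_le)
    finally show ?thesis using cs[of 1] assms(1) by auto
  qed
  then show ?thesis using that pos le by blast
qed

context
  fixes m :: nat
  assumes m: "m \<ge> 2"
begin

lemma row_osc_cong:
  assumes "\<And>i j. i \<in> {1..m} \<Longrightarrow> j \<in> {1..m} \<Longrightarrow> A i j = B i j"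
  shows "row_osc m A d \<longleftrightarrow> row_osc m B d"
proof -
  have "col_sum m A j = col_sum m B j" if "j \<in> {1..m}" for j
    using assms that by (auto simp: col_sum_def)
  then show ?thesis using assms unfolding row_osc_def by auto
qed

lemma row_osc_word_append:
  assumes ir: "irreducible_perm m \<pi>" and d: "row_osc m (word_mat m \<pi> w) d" and c: "0 \<le> c" "c \<le> 1"
    and B: "\<And>k j. k \<in> {1..m} \<Longrightarrow> j \<in> {1..m} \<Longrightarrow>
      c * col_sum m (word_mat m (rauzy_path m \<pi> w) w') j \<le> word_mat m (rauzy_path m \<pi> w) w' k j"
  shows "row_osc m (word_mat m \<pi> (w @ w')) ((1 - c) * d)"
proof -
  have "row_osc m (mat_mul m (word_mat m \<pi> w) (word_mat m (rauzy_path m \<pi> w) w')) ((1 - c) * d)"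
  proof (rule row_osc_mat_mul[OF d c])
    show "col_sum m (word_mat m \<pi> w) k > 0" if "k \<in> {1..m}" for k
      using col_sum_word_mat_ge_1[OF m ir that, of w] by simp
  qed (use B word_mat_nonneg[OF m] in auto)
  then show ?thesis
    using row_osc_cong[of "word_mat m \<pi> (w @ w')"] word_mat_append[OF m] by blast
qed

text \<open>The case \<open>c = 0\<close>: averaging never widens the interval.\<close>

lemma row_osc_word_extend:
  assumes ir: "irreducible_perm m \<pi>" and d: "row_osc m (word_mat m \<pi> w) d"
  shows "row_osc m (word_mat m \<pi> (w @ w')) d"
  using row_osc_word_append[OF ir d, of 0 w'] word_mat_nonneg[OF m] by simp

lemma row_osc_Nil: "row_osc m (word_mat m \<pi> []) 1"
  unfolding row_osc_def
proof (intro ballI exI[of _ 0] conjI)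
  fix i j assume j: "j \<in> {1..m}" and i: "i \<in> {1..m}"
  have "col_sum m (word_mat m \<pi> []) j = (\<Sum>i=1..m. if i = j then 1 else 0)"
    unfolding col_sum_def by (intro sum.cong) (auto simp: mat_id_def word_mat.simps)
  then show "0 * col_sum m (word_mat m \<pi> []) j \<le> word_mat m \<pi> [] i j"
    "word_mat m \<pi> [] i j \<le> (0 + 1) * col_sum m (word_mat m \<pi> []) j"
    using j by (auto simp: mat_id_def word_mat.simps)
qed

text \<open>Coordinate \<open>i\<close> of a point of the cylinder is a mean of the entries of row
  \<open>i\<close> divided by their column sums; the weights add up to 1 because the point lies on
  the simplex.\<close>

lemma cyl_small:
  assumes ir: "irreducible_perm m \<pi>" and d: "row_osc m (word_mat m \<pi> w) d"
    and v: "v \<in> cyl m \<pi> w" and z: "z \<in> cyl m \<pi> w" and i: "i \<in> {1..m}"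
  shows "\<bar>z i - v i\<bar> \<le> d"
proof -
  let ?H = "word_mat m \<pi> w"
  obtain a where a: "\<And>j. j \<in> {1..m} \<Longrightarrow> a * col_sum m ?H j \<le> ?H i j \<and> ?H i j \<le> (a + d) * col_sum m ?H j"
    using d i unfolding row_osc_def by blast
  have "a \<le> y i \<and> y i \<le> a + d" if "y \<in> cyl m \<pi> w" for y
  proof -
    have yim: "y \<in> word_map m \<pi> w ` pos_cone m" and y: "y \<in> open_simplex m"
      using that unfolding cyl_def by (rule IntD2, rule IntD1)
    from yim obtain u where u0: "y = word_map m \<pi> w u" "u \<in> pos_cone m" by (rule imageE)
    note u = u0(2) u0(1) y
    have up: "u j \<ge> 0" if "j \<in> {1..m}" for j using u(1) that by (auto simp: pos_cone_def less_imp_le)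
    have S: "(\<Sum>j=1..m. col_sum m ?H j * u j) = 1"
      using open_simplexD(2)[OF u(3)] unfolding u(2) coord_sum_mat_vec .
    have yi: "y i = (\<Sum>j=1..m. ?H i j * u j)" using i by (simp add: u(2) mat_vec_def)
    have "a * (\<Sum>j=1..m. col_sum m ?H j * u j) \<le> y i"
      unfolding yi sum_distrib_left mult.assoc[symmetric]
      using a up by (intro sum_mono mult_right_mono) auto
    moreover have "y i \<le> (a + d) * (\<Sum>j=1..m. col_sum m ?H j * u j)"
      unfolding yi sum_distrib_left mult.assoc[symmetric]
      using a up by (intro sum_mono mult_right_mono) auto
    ultimately show ?thesis unfolding S by simp
  qed
  from this[OF v] this[OF z] show ?thesis by auto
qed

text \<open>Each occurrence of \<open>q\<close> contracts by the same factor \<open>1 - c\<close>,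
  where \<open>c\<close> depends only on \<open>q\<close>, and nothing expands in between.\<close>

lemma row_osc_recurrent:
  assumes ir: "irreducible_perm m \<pi>"
    and pos: "\<And>k j. k \<in> {1..m} \<Longrightarrow> j \<in> {1..m} \<Longrightarrow> word_mat m \<pi>' q k j > 0"
    and rec: "\<exists>\<^sub>\<infinity>N. rauzy_path m \<pi> (map s [0..<N]) = \<pi>' \<and> map s [N..<N + length q] = q"
    and e: "e > 0"
  shows "\<exists>N. \<forall>n\<ge>N. row_osc m (word_mat m \<pi> (map s [0..<n])) e"
proof -
  obtain c where c: "0 < c" "c \<le> 1" "\<And>k j. k \<in> {1..m} \<Longrightarrow> j \<in> {1..m} \<Longrightarrow> c * col_sum m (word_mat m \<pi>' q) j \<le> word_mat m \<pi>' q k j"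
    using positive_mat_col_ratio[of m "word_mat m \<pi>' q"] pos m by auto
  have later: "row_osc m (word_mat m \<pi> (map s [0..<n])) d"
    if "row_osc m (word_mat m \<pi> (map s [0..<N])) d" "N \<le> n" for n N d
  proof -
    have "map s [0..<n] = map s [0..<N] @ map s [N..<n]" using that(2) by (metis map_append upt_add_eq_append le_add_diff_inverse zero_le)
    then show ?thesis using row_osc_word_extend[OF ir that(1)] by simp
  qed
  have "\<exists>N. row_osc m (word_mat m \<pi> (map s [0..<N])) ((1 - c) ^ k)" for k
  proof (induction k)
    case 0 show ?case using row_osc_Nil by (intro exI[of _ 0]) simp
  next
    case (Suc k)
    then obtain N where N: "row_osc m (word_mat m \<pi> (map s [0..<N])) ((1 - c) ^ k)" by blast
    \<comment> \<open>\<open>N\<close> is the end of the occurrences already used, so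
      \<open>N' \<ge> N\<close> makes the new occurrence disjoint from them and the factors
      multiply.\<close>
    obtain N' where N': "N' \<ge> N" "rauzy_path m \<pi> (map s [0..<N']) = \<pi>'" "map s [N'..<N' + length q] = q"
      using rec unfolding INFM_nat_le by blast
    have "map s [0..<N' + length q] = map s [0..<N'] @ q"
      using N'(3) by (metis map_append upt_add_eq_append zero_le)
    moreover have "row_osc m (word_mat m \<pi> (map s [0..<N'] @ q)) ((1 - c) * (1 - c) ^ k)"
      using row_osc_word_append[OF ir later[OF N N'(1)], of c q] c N'(2) by auto
    ultimately show ?case by (intro exI[of _ "N' + length q"]) simp
  qed
  moreover obtain k where k: "(1 - c) ^ k < e" using real_arch_pow_inv[of e "1 - c"] e c by auto
  ultimately obtain N where N: "row_osc m (word_mat m \<pi> (map s [0..<N])) ((1 - c) ^ k)" by blast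
  have "row_osc m (word_mat m \<pi> (map s [0..<N])) e"
  proof (rule row_osc_mono[OF N])
    show "col_sum m (word_mat m \<pi> (map s [0..<N])) j \<ge> 0" if "j \<in> {1..m}" for j
      using col_sum_word_mat_ge_1[OF m ir that, of "map s [0..<N]"] by simp
  qed (use k in simp)
  then show ?thesis using later by blast
qed

end

subsection \<open>Density points for cylinders\<close>

text \<open>
  Among the cylinders that are bad and contained in a fixed open set, those given by minimal words
  are disjoint and cover all the others; this replaces a Vitali covering.
\<close>

lemma cylinder_density:
  fixes M :: "'a::{second_countable_topology, complete_space} measure" and C :: "bool list \<Rightarrow> 'a set"
  assumes sb: "sets M = sets borel" and fin: "finite_measure M"
    and C: "\<And>w. C w \<in> sets M"
    and pre: "\<And>u v. C (u @ v) \<subseteq> C u"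
    and disj: "\<And>u v. \<not> prefix u v \<Longrightarrow> \<not> prefix v u \<Longrightarrow> C u \<inter> C v = {}"
    and A: "A \<in> sets M" and \<delta>: "\<delta> > 0"
  shows "\<exists>N\<in>null_sets M. \<forall>x\<in>A - N. \<exists>U. open U \<and> x \<in> U \<and>
     (\<forall>w. x \<in> C w \<longrightarrow> C w \<subseteq> U \<longrightarrow> emeasure M (C w - A) < ennreal \<delta> * emeasure M (C w))"
proof -
  interpret finite_measure M by (rule fin)
  define bad where "bad w \<longleftrightarrow> ennreal \<delta> * emeasure M (C w) \<le> emeasure M (C w - A)" for w
  define V where "V U = (\<Union>w\<in>{w. bad w \<and> C w \<subseteq> U}. C w)" for U
  have VS: "V U \<in> sets M" for U unfolding V_def using C by (intro sets.countable_UN') auto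
  have Vm: "ennreal \<delta> * emeasure M (V U) \<le> emeasure M (U - A)" if U: "open U" for U
  proof -
    define W where "W = {w. bad w \<and> C w \<subseteq> U}"
    define W0 where "W0 = {w\<in>W. \<forall>v\<in>W. prefix v w \<longrightarrow> v = w}"
    have US: "U \<in> sets M" using U sb by auto
    have "\<exists>v\<in>W0. prefix v w" if "w \<in> W" for w
      using that
    proof (induction w rule: length_induct)
      case (1 w)
      show ?case
      proof (cases "w \<in> W0")
        case False
        then obtain v where v: "v \<in> W" "prefix v w" "v \<noteq> w" using 1 by (auto simp: W0_def)
        then have "length v < length w" by (metis prefix_length_less strict_prefixI)
        then obtain v' where "v' \<in> W0" "prefix v' v" using 1 v by blast
        then show ?thesis using v prefix_order.trans by blast
      qed auto
    qed
    then have "V U \<subseteq> (\<Union>w\<in>W0. C w)" unfolding V_def W_def[symmetric] using pre by (fastforce simp: prefix_def)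
    moreover have "(\<Union>w\<in>W0. C w) \<subseteq> V U" by (auto simp: V_def W0_def W_def)
    ultimately have VW: "V U = (\<Union>w\<in>W0. C w)" by auto
    have dj: "disjoint_family_on C W0"
      unfolding disjoint_family_on_def using disj by (auto simp: W0_def)
    have "ennreal \<delta> * emeasure M (V U) = ennreal \<delta> * (\<integral>\<^sup>+w. emeasure M (C w) \<partial>count_space W0)"
      unfolding VW using C dj by (subst emeasure_UN_countable) auto
    also have "\<dots> = (\<integral>\<^sup>+w. ennreal \<delta> * emeasure M (C w) \<partial>count_space W0)"
      by (rule nn_integral_cmult[symmetric]) simp
    also have "\<dots> \<le> (\<integral>\<^sup>+w. emeasure M (C w - A) \<partial>count_space W0)"
      by (rule nn_integral_mono) (auto simp: W0_def W_def bad_def)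
    also have "\<dots> = emeasure M (\<Union>w\<in>W0. C w - A)"
      using C A dj by (intro emeasure_UN_countable[symmetric]) (auto simp: disjoint_family_on_def)
    also have "\<dots> \<le> emeasure M (U - A)"
      using A US by (intro emeasure_mono) (auto simp: W0_def W_def)
    finally show ?thesis .
  qed
  \<comment> \<open>Outer regularity: the bad cylinders inside \<open>U n\<close> have a union of
    measure at most that of \<open>U n - A\<close> divided by \<delta>, which tends to 0. A point of
    \<open>A\<close> outside the null set \<open>N\<close> avoids all bad cylinders inside some
    \<open>U n\<close>, and that \<open>U n\<close> is the required neighbourhood.\<close>
  have "\<exists>U. open U \<and> A \<subseteq> U \<and> emeasure M (U - A) \<le> ennreal (1 / Suc n)" for n
  proof -
    have "emeasure M A < emeasure M A + ennreal (1 / Suc n)"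
      using emeasure_finite[of A] by (simp add: ennreal_less_zero_iff less_top[symmetric])
    moreover have "emeasure M A = (INF U\<in>{U. A \<subseteq> U \<and> open U}. emeasure M U)"
      using A sb emeasure_finite[of "space M"] by (intro outer_regular) auto
    ultimately obtain U where U: "A \<subseteq> U" "open U" "emeasure M U < emeasure M A + ennreal (1 / Suc n)"
      by (auto simp: INF_less_iff)
    have "emeasure M (U - A) = emeasure M U - emeasure M A"
      using A U sb emeasure_finite[of A] by (intro emeasure_Diff) auto
    also have "\<dots> \<le> ennreal (1 / Suc n)"
      using U(3) emeasure_finite[of A] by (subst ennreal_minus_le_iff) (auto intro: less_imp_le)
    finally show ?thesis using U by blast
  qed
  then obtain U where U: "\<And>n. open (U n)" "\<And>n. A \<subseteq> U n" "\<And>n. emeasure M (U n - A) \<le> ennreal (1 / Suc n)"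
    by metis
  define N where "N = (\<Inter>n. V (U n))"
  have NS: "N \<in> sets M" unfolding N_def using VS by auto
  have "ennreal \<delta> * emeasure M N \<le> ennreal (1 / Suc n)" for n
  proof -
    have "ennreal \<delta> * emeasure M N \<le> ennreal \<delta> * emeasure M (V (U n))"
      using VS by (intro mult_left_mono emeasure_mono) (auto simp: N_def)
    also have "\<dots> \<le> ennreal (1 / Suc n)" using Vm[OF U(1)] U(3) order_trans by blast
    finally show ?thesis .
  qed
  moreover have "(\<lambda>n. ennreal (1 / Suc n)) \<longlonglongrightarrow> ennreal 0"
    by (intro tendsto_ennrealI lim_1_over_real_power LIMSEQ_Suc[OF lim_1_over_n])
  ultimately have "ennreal \<delta> * emeasure M N \<le> 0"
    by (intro LIMSEQ_le_const) auto
  then have "N \<in> null_sets M" using NS \<delta> by (auto simp: null_sets_def)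
  moreover have "\<exists>U. open U \<and> x \<in> U \<and>
     (\<forall>w. x \<in> C w \<longrightarrow> C w \<subseteq> U \<longrightarrow> emeasure M (C w - A) < ennreal \<delta> * emeasure M (C w))" if x: "x \<in> A - N" for x
  proof -
    obtain n where n: "x \<notin> V (U n)" using x by (auto simp: N_def)
    then have "\<forall>w. x \<in> C w \<longrightarrow> C w \<subseteq> U n \<longrightarrow> \<not> bad w" by (auto simp: V_def)
    then show ?thesis using U(1,2)[of n] x by (intro exI[of _ "U n"]) (auto simp: bad_def not_le)
  qed
  ultimately show ?thesis by blast
qed

subsection \<open>Bounded distortion\<close>

definition mat_total :: "nat \<Rightarrow> (nat \<Rightarrow> nat \<Rightarrow> real) \<Rightarrow> real" where
  "mat_total m A = (\<Sum>j=1..m. col_sum m A j)"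

definition word_img :: "nat \<Rightarrow> (nat \<Rightarrow> nat) \<Rightarrow> bool list \<Rightarrow> (nat \<Rightarrow> real) set \<Rightarrow> (nat \<Rightarrow> real) set" where
  "word_img m \<pi> w E = (\<lambda>y. vec_normalize m (word_map m \<pi> w y)) ` E"

context
  fixes m :: nat
  assumes m: "m \<ge> 2"
begin

lemma m_ge_1: "m \<ge> 1" using m by simp

lemma vec_normalize_word_map:
  assumes "u \<in> pos_cone m"
  shows "vec_normalize m (word_map m \<pi> w (vec_normalize m u)) = vec_normalize m (word_map m \<pi> w u)"
  using coord_sum_pos[OF assms m_ge_1]
  unfolding vec_normalize_eq_scale[of m u] mat_vec_scale by (intro vec_normalize_scale) simp

lemma scale_vec_normalize:
  assumes "u \<in> pos_cone m" shows "scale_vec m (coord_sum m u) (vec_normalize m u) = u"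
  using coord_sum_pos[OF assms m_ge_1] pos_cone_ext[OF assms]
  unfolding vec_normalize_eq_scale scale_scale by (simp add: scale_one)

lemma coord_sum_le_measurable: "{v \<in> extensional {1..m}. coord_sum m v \<le> t} \<in> sets (lebesgue_PiM {1..m})"
proof -
  have "{v \<in> space (lebesgue_PiM {1..m}). coord_sum m v \<le> t} \<in> sets (lebesgue_PiM {1..m})" by measurable
  then show ?thesis by (simp add: space_lebesgue_PiM)
qed

lemma cone_over_le_sets:
  assumes "E \<in> sets (simplex_borel m)"
  shows "cone_over m E \<inter> {v. coord_sum m v \<le> t} \<in> sets (lebesgue_PiM {1..m})"
proof -
  have "cone_over m E \<inter> {v. coord_sum m v \<le> t} = cone_over m E \<inter> {v \<in> extensional {1..m}. coord_sum m v \<le> t}"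
    by (auto simp: cone_over_def pos_cone_def)
  then show ?thesis using cone_over_sets[OF m_ge_1 assms] coord_sum_le_measurable[of t] by auto
qed

lemma emeasure_cone_over_le:
  assumes E: "E \<in> sets (simplex_borel m)" and t: "t > 0"
  shows "emeasure (lebesgue_PiM {1..m}) (cone_over m E \<inter> {v. coord_sum m v \<le> t})
    = ennreal (t ^ m) * emeasure (cone_measure m) E"
proof -
  let ?A = "cone_over m E \<inter> {v. coord_sum m v \<le> 1}"
  have p: "scale_vec m (1 / t) x \<in> pos_cone m \<longleftrightarrow> x \<in> pos_cone m" if "x \<in> extensional {1..m}" for x
    using t that by (auto simp: pos_cone_def scale_vec_def zero_less_divide_iff)
  have "cone_over m E \<inter> {v. coord_sum m v \<le> t} = {x \<in> extensional {1..m}. (\<lambda>i\<in>{1..m}. (1 / t) * x i) \<in> ?A}"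
    using t p pos_cone_ext vec_normalize_scale[of "1 / t" m] unfolding scale_vec_def[symmetric]
    by (auto simp: cone_over_def coord_sum_scale)
  then show ?thesis
    using emeasure_lebesgue_PiM_scale[of "{1..m}" "1 / t" ?A] t cone_over_le_sets[OF E, of 1]
      emeasure_cone_measure[OF m_ge_1 E] by simp
qed

lemma cone_over_word_img:
  assumes ir: "irreducible_perm m \<pi>" and E: "E \<subseteq> open_simplex m"
  shows "cone_over m (word_img m \<pi> w E) = word_map m \<pi> w ` cone_over m E"
proof (intro equalityI subsetI)
  fix v assume "v \<in> cone_over m (word_img m \<pi> w E)"
  then obtain y where v: "v \<in> pos_cone m" and y: "y \<in> E" "vec_normalize m v = vec_normalize m (word_map m \<pi> w y)"
    unfolding cone_over_def word_img_def by blast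
  have yp: "y \<in> pos_cone m" using y E open_simplexD by blast
  have wy: "word_map m \<pi> w y \<in> pos_cone m" by (rule word_map_pos_cone[OF m ir yp])
  define c where "c = coord_sum m v * (1 / coord_sum m (word_map m \<pi> w y))"
  have c: "c > 0" unfolding c_def using coord_sum_pos[OF v m_ge_1] coord_sum_pos[OF wy m_ge_1] by simp
  have "v = scale_vec m (coord_sum m v) (vec_normalize m (word_map m \<pi> w y))"
    unfolding y(2)[symmetric] by (rule scale_vec_normalize[OF v, symmetric])
  also have "\<dots> = word_map m \<pi> w (scale_vec m c y)"
    unfolding vec_normalize_eq_scale scale_scale mat_vec_scale c_def ..
  finally have "v = word_map m \<pi> w (scale_vec m c y)" .
  moreover have "scale_vec m c y \<in> cone_over m E"
    unfolding cone_over_def using scale_pos_cone[OF c yp] y(1) E vec_normalize_scale[OF c] vec_normalize_id by auto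
  ultimately show "v \<in> word_map m \<pi> w ` cone_over m E" by blast
next
  fix v assume "v \<in> word_map m \<pi> w ` cone_over m E"
  then obtain u where u0: "v = word_map m \<pi> w u" and "u \<in> cone_over m E" by (rule imageE)
  then have u: "u \<in> pos_cone m" "vec_normalize m u \<in> E" by (auto simp: cone_over_def)
  show "v \<in> cone_over m (word_img m \<pi> w E)"
    unfolding cone_over_def word_img_def u0 using word_map_pos_cone[OF m ir u(1)] u(2) vec_normalize_word_map[OF u(1)]
    by (intro CollectI conjI image_eqI[of _ _ "vec_normalize m u"]) simp_all
qed

lemma word_img_subset:
  assumes "irreducible_perm m \<pi>" "E \<subseteq> open_simplex m"
  shows "word_img m \<pi> w E \<subseteq> open_simplex m"
  unfolding word_img_def
  using vec_normalize_pos_cone[OF word_map_pos_cone[OF m assms(1)] m_ge_1] assms(2) open_simplexD(1) by blast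

lemma word_img_sets:
  assumes ir: "irreducible_perm m \<pi>" and E: "E \<in> sets (simplex_borel m)"
  shows "word_img m \<pi> w E \<in> sets (simplex_borel m)"
proof -
  have Es: "E \<subseteq> open_simplex m" using sets.sets_into_space[OF E] unfolding space_simplex_borel .
  have "word_img m \<pi> w E = open_simplex m \<inter> cone_over m (word_img m \<pi> w E)"
    using word_img_subset[OF ir Es, of w] by (auto simp: cone_over_def open_simplexD vec_normalize_id subset_eq)
  moreover have "cone_over m (word_img m \<pi> w E) \<in> sets (PiM {1..m} (\<lambda>_. borel))"
    using emeasure_word_image[OF m ir cone_over_sets[OF m_ge_1 E]]
    by (simp add: cone_over_word_img[OF ir Es] sets_lebesgue_PiM)
  ultimately show ?thesis by (auto simp: sets_restrict_space)
qed

text \<open>\<open>word_map\<close> preserves volume, and the coordinate sum of an image is the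
  linear form given by the column sums. Hence the measure of an image is the volume of the original
  cone, cut off by this form instead of the coordinate sum.\<close>

lemma emeasure_word_img:
  assumes ir: "irreducible_perm m \<pi>" and E: "E \<in> sets (simplex_borel m)"
  shows "emeasure (cone_measure m) (word_img m \<pi> w E) =
    emeasure (lebesgue_PiM {1..m}) (cone_over m E \<inter> {u. (\<Sum>j=1..m. col_sum m (word_mat m \<pi> w) j * u j) \<le> 1})"
    and "cone_over m E \<inter> {u. (\<Sum>j=1..m. col_sum m (word_mat m \<pi> w) j * u j) \<le> 1} \<in> sets (lebesgue_PiM {1..m})"
proof -
  let ?B = "cone_over m E \<inter> {u. (\<Sum>j=1..m. col_sum m (word_mat m \<pi> w) j * u j) \<le> 1}"
  have Es: "E \<subseteq> open_simplex m" using sets.sets_into_space[OF E] unfolding space_simplex_borel .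
  have "{u \<in> space (lebesgue_PiM {1..m}). (\<Sum>j=1..m. col_sum m (word_mat m \<pi> w) j * u j) \<le> 1} \<in> sets (lebesgue_PiM {1..m})"
    by measurable
  moreover have "?B = cone_over m E \<inter> {u \<in> space (lebesgue_PiM {1..m}). (\<Sum>j=1..m. col_sum m (word_mat m \<pi> w) j * u j) \<le> 1}"
    by (auto simp: cone_over_def pos_cone_def space_lebesgue_PiM)
  ultimately show B: "?B \<in> sets (lebesgue_PiM {1..m})"
    using cone_over_sets[OF m_ge_1 E] by auto
  have "cone_over m (word_img m \<pi> w E) \<inter> {v. coord_sum m v \<le> 1} = word_map m \<pi> w ` ?B"
    unfolding cone_over_word_img[OF ir Es] by (auto simp: coord_sum_mat_vec)
  then show "emeasure (cone_measure m) (word_img m \<pi> w E) = emeasure (lebesgue_PiM {1..m}) ?B"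
    using emeasure_cone_measure[OF m_ge_1 word_img_sets[OF ir E]] emeasure_word_image[OF m ir B] by simp
qed

lemma mat_total_pos: "irreducible_perm m \<pi> \<Longrightarrow> mat_total m (word_mat m \<pi> w) > 0"
  unfolding mat_total_def using col_sum_word_mat_ge_1[OF m, of \<pi> _ w] m
  by (intro sum_pos) (auto intro: less_le_trans[OF zero_less_one])

text \<open>On the whole cone the form of the column sums is at most \<open>mat_total\<close> times
  the coordinate sum, so the cut-off cone contains a scaled copy of the standard one. The exponent
  \<open>m\<close> is its scaling degree.\<close>

lemma cone_measure_le_word_img:
  assumes ir: "irreducible_perm m \<pi>" and E: "E \<in> sets (simplex_borel m)"
  shows "emeasure (cone_measure m) E \<le> ennreal (mat_total m (word_mat m \<pi> w) ^ m) * emeasure (cone_measure m) (word_img m \<pi> w E)"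
proof -
  let ?M = "mat_total m (word_mat m \<pi> w)" and ?s = "col_sum m (word_mat m \<pi> w)"
  have M: "?M > 0" by (rule mat_total_pos[OF ir])
  have "(\<Sum>j=1..m. ?s j * u j) \<le> ?M * coord_sum m u" if u: "u \<in> pos_cone m" for u
  proof -
    have "u j \<le> coord_sum m u" if "j \<in> {1..m}" for j
      unfolding coord_sum_def using u that by (intro member_le_sum) (auto simp: pos_cone_def less_imp_le)
    moreover have "?s j \<ge> 0" if "j \<in> {1..m}" for j using col_sum_word_mat_ge_1[OF m ir that, of w] by simp
    ultimately show ?thesis
      unfolding mat_total_def sum_distrib_right by (intro sum_mono mult_left_mono) auto
  qed
  then have "cone_over m E \<inter> {v. coord_sum m v \<le> 1 / ?M} \<subseteq> cone_over m E \<inter> {u. (\<Sum>j=1..m. ?s j * u j) \<le> 1}"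
    using M by (auto simp: cone_over_def field_simps intro: order_trans)
  then have "ennreal ((1 / ?M) ^ m) * emeasure (cone_measure m) E \<le> emeasure (cone_measure m) (word_img m \<pi> w E)"
    using emeasure_word_img[OF ir E, of w] M
    by (subst emeasure_cone_over_le[OF E, symmetric]) (auto intro!: emeasure_mono)
  then have "ennreal (?M ^ m) * (ennreal ((1 / ?M) ^ m) * emeasure (cone_measure m) E)
      \<le> ennreal (?M ^ m) * emeasure (cone_measure m) (word_img m \<pi> w E)"
    by (rule mult_left_mono) simp
  then show ?thesis
    using M by (simp add: mult.assoc[symmetric] ennreal_mult[symmetric] power_mult_distrib[symmetric])
qed

text \<open>On balanced vectors the form is at least \<open>c * mat_total\<close> times the
  coordinate sum. This matches the opposite estimate up to the factor \<open>(1 / c) ^ m\<close>,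
  independently of \<open>w\<close>.\<close>

lemma cone_measure_word_img_le:
  assumes ir: "irreducible_perm m \<pi>" and E: "E \<in> sets (simplex_borel m)" and c: "c > 0"
    and bal: "\<And>u j. u \<in> cone_over m E \<Longrightarrow> j \<in> {1..m} \<Longrightarrow> c * coord_sum m u \<le> u j"
  shows "emeasure (cone_measure m) (word_img m \<pi> w E)
    \<le> ennreal ((1 / (c * mat_total m (word_mat m \<pi> w))) ^ m) * emeasure (cone_measure m) E"
proof -
  let ?M = "mat_total m (word_mat m \<pi> w)" and ?s = "col_sum m (word_mat m \<pi> w)"
  have M: "?M > 0" by (rule mat_total_pos[OF ir])
  have "?M * (c * coord_sum m u) \<le> (\<Sum>j=1..m. ?s j * u j)" if u: "u \<in> cone_over m E" for u
  proof -
    have "?s j \<ge> 0" if "j \<in> {1..m}" for j using col_sum_word_mat_ge_1[OF m ir that, of w] by simp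
    then show ?thesis
      unfolding mat_total_def sum_distrib_right using bal[OF u] by (intro sum_mono mult_left_mono) auto
  qed
  then have "cone_over m E \<inter> {u. (\<Sum>j=1..m. ?s j * u j) \<le> 1} \<subseteq> cone_over m E \<inter> {v. coord_sum m v \<le> 1 / (c * ?M)}"
    using M c by (fastforce simp: field_simps)
  then have "emeasure (cone_measure m) (word_img m \<pi> w E)
    \<le> emeasure (lebesgue_PiM {1..m}) (cone_over m E \<inter> {v. coord_sum m v \<le> 1 / (c * ?M)})"
    unfolding emeasure_word_img(1)[OF ir E] by (rule emeasure_mono) (rule cone_over_le_sets[OF E])
  then show ?thesis using M c by (subst (asm) emeasure_cone_over_le[OF E]) auto
qed

text \<open>Vectors over the cylinder of \<open>q\<close> are positive combinations of the columns
  of its matrix, and balance is inherited from the columns.\<close>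

lemma cyl_balanced:
  assumes q: "\<And>k j. k \<in> {1..m} \<Longrightarrow> j \<in> {1..m} \<Longrightarrow> c * col_sum m (word_mat m \<pi> q) j \<le> word_mat m \<pi> q k j"
    and u: "u \<in> cone_over m (cyl m \<pi> q)" and k: "k \<in> {1..m}"
  shows "c * coord_sum m u \<le> u k"
proof -
  have up: "u \<in> pos_cone m" using u by (simp add: cone_over_def)
  have "vec_normalize m u \<in> word_map m \<pi> q ` pos_cone m" using u by (auto simp: cone_over_def cyl_def)
  then have "u \<in> word_map m \<pi> q ` pos_cone m" using normalize_mem_image_iff[OF m up] by blast
  then obtain z where z: "u = word_map m \<pi> q z" "z \<in> pos_cone m" by (rule imageE)
  have "c * coord_sum m u = (\<Sum>j=1..m. (c * col_sum m (word_mat m \<pi> q) j) * z j)"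
    unfolding z(1) coord_sum_mat_vec sum_distrib_left mult.assoc ..
  also have "\<dots> \<le> (\<Sum>j=1..m. word_mat m \<pi> q k j * z j)"
    using q[OF k] z(2) by (intro sum_mono mult_right_mono) (auto simp: pos_cone_def less_imp_le)
  also have "\<dots> = u k" using k by (simp add: z(1) mat_vec_def)
  finally show ?thesis .
qed

lemma mat_total_append:
  assumes ir: "irreducible_perm m \<pi>"
  shows "mat_total m (word_mat m \<pi> (w @ v)) \<le> mat_total m (word_mat m \<pi> w) * mat_total m (word_mat m (rauzy_path m \<pi> w) v)"
proof -
  let ?A = "word_mat m \<pi> w" and ?B = "word_mat m (rauzy_path m \<pi> w) v"
  have B: "?B k j \<ge> 0" if "k \<in> {1..m}" for k j using that by (rule word_mat_nonneg[OF m])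
  have "mat_total m (word_mat m \<pi> (w @ v)) = (\<Sum>j=1..m. col_sum m (mat_mul m ?A ?B) j)"
    unfolding mat_total_def col_sum_def using word_mat_append[OF m] by (intro sum.cong) auto
  also have "\<dots> = (\<Sum>k=1..m. col_sum m ?A k * (\<Sum>j=1..m. ?B k j))"
    unfolding col_sum_mat_mul sum_distrib_left by (rule sum.swap)
  also have "\<dots> \<le> (\<Sum>k=1..m. col_sum m ?A k * mat_total m ?B)"
  proof (intro sum_mono mult_left_mono)
    fix k assume k: "k \<in> {1..m}"
    have "?B k j \<le> col_sum m ?B j" if "j \<in> {1..m}" for j
      unfolding col_sum_def using B k by (intro member_le_sum) auto
    then show "(\<Sum>j=1..m. ?B k j) \<le> mat_total m ?B" unfolding mat_total_def by (intro sum_mono) auto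
    show "0 \<le> col_sum m ?A k" using col_sum_word_mat_ge_1[OF m ir k, of w] by simp
  qed
  also have "\<dots> = mat_total m ?A * mat_total m ?B" by (simp add: mat_total_def sum_distrib_right)
  finally show ?thesis .
qed

lemma cyl_append_subset_word_img:
  assumes ir: "irreducible_perm m \<pi>"
  shows "cyl m \<pi> (w @ q) \<subseteq> word_img m \<pi> w (cyl m (rauzy_path m \<pi> w) q)"
proof
  fix z assume z: "z \<in> cyl m \<pi> (w @ q)"
  then have zo: "z \<in> open_simplex m" and "z \<in> word_map m \<pi> (w @ q) ` pos_cone m" by (simp_all add: cyl_def)
  then obtain u where u: "z = word_map m \<pi> (w @ q) u" "u \<in> pos_cone m" by blast
  let ?y = "word_map m (rauzy_path m \<pi> w) q u"
  have y: "?y \<in> pos_cone m" by (rule word_map_pos_cone[OF m irreducible_rauzy_path[OF m ir] u(2)])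
  have "vec_normalize m ?y \<in> cyl m (rauzy_path m \<pi> w) q"
    unfolding cyl_def using vec_normalize_pos_cone[OF y m_ge_1] normalize_mem_image_iff[OF m y] u(2) by blast
  moreover have "z = vec_normalize m (word_map m \<pi> w (vec_normalize m ?y))"
    unfolding vec_normalize_word_map[OF y] word_map_append[OF m, symmetric] u(1)[symmetric] vec_normalize_id[OF zo] ..
  ultimately show "z \<in> word_img m \<pi> w (cyl m (rauzy_path m \<pi> w) q)" unfolding word_img_def by blast
qed

text \<open>The cylinder of \<open>w @ q\<close> has at most \<open>(1 / (c * M)) ^ m\<close> of the
  total measure, while pulling \<open>F\<close> back along \<open>w @ q @ r\<close> shrinks it at
  most by \<open>(M * C) ^ m\<close>. The total \<open>M\<close> of the uncontrolled word
  \<open>w\<close> cancels, so the remaining constant involves only \<delta>, \<open>c\<close> and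
  the matrix of \<open>q @ r\<close>.\<close>

lemma bounded_distortion:
  assumes ir: "irreducible_perm m \<pi>" and c: "c > 0"
    and q: "\<And>k j. k \<in> {1..m} \<Longrightarrow> j \<in> {1..m} \<Longrightarrow>
      c * col_sum m (word_mat m (rauzy_path m \<pi> w) q) j \<le> word_mat m (rauzy_path m \<pi> w) q k j"
    and F: "F \<in> sets (simplex_borel m)" and A: "A \<in> sets (simplex_borel m)"
    and sub: "word_img m \<pi> (w @ q @ r) F \<subseteq> cyl m \<pi> (w @ q) - A"
    and \<delta>: "\<delta> \<ge> 0" "emeasure (cone_measure m) (cyl m \<pi> (w @ q) - A) \<le> ennreal \<delta> * emeasure (cone_measure m) (cyl m \<pi> (w @ q))"
  shows "emeasure (cone_measure m) F
    \<le> ennreal (\<delta> * (mat_total m (word_mat m (rauzy_path m \<pi> w) (q @ r)) / c) ^ m) * emeasure (cone_measure m) (open_simplex m)"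
proof -
  let ?K = "emeasure (cone_measure m)"
  let ?M = "mat_total m (word_mat m \<pi> w)" and ?C = "mat_total m (word_mat m (rauzy_path m \<pi> w) (q @ r))"
  have irw: "irreducible_perm m (rauzy_path m \<pi> w)" by (rule irreducible_rauzy_path[OF m ir])
  have M: "?M > 0" "?C > 0" using mat_total_pos ir irw by auto
  have cs: "cyl m \<pi> (w @ q) \<in> sets (simplex_borel m)" by (rule cyl_sets[OF m ir])
  have os: "open_simplex m \<in> sets (simplex_borel m)" using cyl_sets[OF m ir, of "[]"] by (simp add: cyl_Nil[OF m])
  have "?K (cyl m \<pi> (w @ q)) \<le> ?K (word_img m \<pi> w (cyl m (rauzy_path m \<pi> w) q))"
    using cyl_append_subset_word_img[OF ir] word_img_sets[OF ir cyl_sets[OF m irw]] by (intro emeasure_mono) auto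
  also have "\<dots> \<le> ennreal ((1 / (c * ?M)) ^ m) * ?K (cyl m (rauzy_path m \<pi> w) q)"
    by (rule cone_measure_word_img_le[OF ir cyl_sets[OF m irw] c cyl_balanced[OF q]])
  also have "\<dots> \<le> ennreal ((1 / (c * ?M)) ^ m) * ?K (open_simplex m)"
    using os cyl_subset[OF m] by (intro mult_left_mono emeasure_mono) auto
  finally have 1: "?K (cyl m \<pi> (w @ q)) \<le> ennreal ((1 / (c * ?M)) ^ m) * ?K (open_simplex m)" .
  have "?K F \<le> ennreal (mat_total m (word_mat m \<pi> (w @ q @ r)) ^ m) * ?K (word_img m \<pi> (w @ q @ r) F)"
    by (rule cone_measure_le_word_img[OF ir F])
  also have "\<dots> \<le> ennreal ((?M * ?C) ^ m) * ?K (cyl m \<pi> (w @ q) - A)"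
    using mat_total_append[OF ir, of w "q @ r"] mat_total_pos[OF ir, of "w @ q @ r"] sub cs A
    by (intro mult_mono ennreal_leI power_mono emeasure_mono) auto
  also have "\<dots> \<le> ennreal ((?M * ?C) ^ m) * (ennreal \<delta> * (ennreal ((1 / (c * ?M)) ^ m) * ?K (open_simplex m)))"
    by (intro mult_left_mono order_trans[OF \<delta>(2)] 1) auto
  also have "\<dots> = ennreal ((?M * ?C) ^ m * \<delta> * (1 / (c * ?M)) ^ m) * ?K (open_simplex m)"
    using M c \<delta>(1) by (simp add: ennreal_mult mult.assoc)
  also have "(?M * ?C) ^ m * \<delta> * (1 / (c * ?M)) ^ m = \<delta> * (?C / c) ^ m"
    using M c by (simp add: power_mult_distrib power_divide)
  finally show ?thesis .
qed

end

subsection \<open>Words with a prescribed number of changes\<close>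

text \<open>Every change of letter in an itinerary is one step of \<open>\<G>\<close>.\<close>

fun changes :: "bool list \<Rightarrow> nat" where
  "changes (x # y # l) = (if x = y then 0 else 1) + changes (y # l)"
| "changes _ = 0"

lemma changes_append: "changes (l @ x # l') = changes (l @ [x]) + changes (x # l')"
  by (induction l rule: changes.induct) auto

lemma changes_snoc: "changes (l @ [x, y]) = changes (l @ [x]) + (if x = y then 0 else 1)"
  using changes_append[of l x "[y]"] by simp

text \<open>The word has length \<open>Suc N\<close>, so that a change between the times
  \<open>N - 1\<close> and \<open>N\<close> is counted.\<close>

definition changes_upto :: "(nat \<Rightarrow> bool) \<Rightarrow> nat \<Rightarrow> nat" where
  "changes_upto s N = changes (map s [0..<Suc N])"

lemma changes_upto_0 [simp]: "changes_upto s 0 = 0"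
  by (simp add: changes_upto_def)

lemma changes_upto_Suc: "changes_upto s (Suc N) = changes_upto s N + (if s N = s (Suc N) then 0 else 1)"
  using changes_snoc[of "map s [0..<N]" "s N" "s (Suc N)"] by (simp add: changes_upto_def)

lemma even_changes_upto: "even (changes_upto s N) \<longleftrightarrow> s N = s 0"
proof (induction N)
  case (Suc N)
  then show ?case by (auto simp: changes_upto_Suc)
qed simp

lemma changes_upto_le: "changes_upto s N \<le> N"
proof (induction N)
  case (Suc N)
  then show ?case by (auto simp: changes_upto_Suc)
qed simp

lemma changes_upto_surj:
  assumes "\<And>x. \<exists>\<^sub>\<infinity>n. s n = x"
  shows "\<exists>N. changes_upto s N = k"
proof (induction k)
  case 0 show ?case by (rule exI[of _ 0]) simp
next
  case (Suc k)
  then obtain N where N: "changes_upto s N = k" by blast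
  obtain i where "i \<ge> N" "s i = (\<not> s N)" using assms unfolding INFM_nat_le by blast
  then have ex: "\<exists>j. s (N + j) \<noteq> s N" by (metis le_add_diff_inverse)
  define j where "j = (LEAST j. s (N + j) \<noteq> s N)"
  have j: "s (N + j) \<noteq> s N" unfolding j_def by (rule LeastI_ex[OF ex])
  have less: "s (N + i) = s N" if "i < j" for i using not_less_Least[of i] that unfolding j_def by blast
  have const: "changes_upto s (N + i) = k" if "i < j" for i
    using that
  proof (induction i)
    case (Suc i)
    then show ?case using less[of i] less[of "Suc i"] by (simp add: changes_upto_Suc)
  qed (simp add: N)
  obtain i where i: "j = Suc i" using j by (cases j) auto
  have "changes_upto s (N + j) = Suc k"
    using const[of i] less[of i] j i by (simp add: changes_upto_Suc)
  then show ?case by blast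
qed

text \<open>The itinerary of two \<G>-steps starting in \<open>Delta_plus\<close>: a run of
  \<open>a\<close> followed by a run of \<open>b\<close>.\<close>

definition block :: "bool list \<Rightarrow> bool" where
  "block w \<longleftrightarrow> (\<exists>i\<ge>1. \<exists>l\<ge>1. w = replicate i True @ replicate l False)"

lemma even_changes: "l \<noteq> [] \<Longrightarrow> even (changes l) \<longleftrightarrow> hd l = last l"
  by (induction l rule: changes.induct) auto

lemma changes_append_True: "w \<noteq> [] \<Longrightarrow> hd w \<Longrightarrow> changes (l @ w @ [True]) = changes (l @ [True]) + changes (w @ [True])"
  using changes_append[of l True "tl w @ [True]"] by (cases w) auto

lemma changes_replicate: "changes (replicate (Suc i) x) = 0"
  by (induction i) auto

text \<open>The appended \<open>True\<close> is the first letter of whatever follows; it supplies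
  the second change, which completes the second \<G>-step.\<close>

lemma changes_block:
  assumes "block w"
  shows "changes (w @ [True]) = 2 \<and> w \<noteq> [] \<and> hd w \<and> \<not> last w"
proof -
  obtain i l where w: "w = replicate (Suc i) True @ replicate (Suc l) False"
    using assms unfolding block_def by (metis Suc_le_D One_nat_def)
  have e: "replicate (Suc i) x = replicate i x @ [x]" for i and x :: bool by (simp add: replicate_append_same)
  have "changes (w @ [True]) = changes (replicate i True @ True # (False # replicate l False) @ [True])"
    unfolding w e[of i] by simp
  also have "\<dots> = changes (replicate i True @ [True]) + changes (True # (False # replicate l False) @ [True])"
    by (rule changes_append)
  also have "replicate i True @ [True] = replicate (Suc i) True" by (rule e[symmetric])
  also have "(False # replicate l False) @ [True] = replicate l False @ False # [True]"
    using e[of l False] by simp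
  also have "changes (True # replicate l False @ False # [True]) = Suc (changes (replicate l False @ False # [True]))"
    by (cases l) auto
  also have "changes (replicate l False @ False # [True]) = changes (replicate l False @ [False]) + changes (False # [True])"
    by (rule changes_append)
  also have "replicate l False @ [False] = replicate (Suc l) False" by (rule e[symmetric])
  finally have "changes (w @ [True]) = 2" by (simp only: changes_replicate) simp
  then show ?thesis by (simp add: w)
qed

section \<open>Connecting the permutations of a Rauzy class by blocks\<close>

context
  fixes m :: nat and R :: "(nat \<Rightarrow> nat) set"
  assumes m: "m \<ge> 2" and R: "rauzy_class m R"
begin

lemma rauzy_class_irreducible:
  assumes "\<pi> \<in> R" shows "irreducible_perm m \<pi>"
proof -
  obtain \<pi>\<^sub>0 where \<pi>\<^sub>0: "irreducible_perm m \<pi>\<^sub>0" "R = rauzy_orbit m \<pi>\<^sub>0" using R by (auto simp: rauzy_class_def)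
  have "\<pi> \<in> rauzy_orbit m \<pi>\<^sub>0 \<Longrightarrow> irreducible_perm m \<pi>"
    by (induction rule: rauzy_orbit.induct)
       (use \<pi>\<^sub>0(1) irreducible_rauzy_step[OF m, of _ True] irreducible_rauzy_step[OF m, of _ False] in
         \<open>auto simp: rauzy_step_def\<close>)
  then show ?thesis using assms \<pi>\<^sub>0 by simp
qed

lemma rauzy_class_step: "\<pi> \<in> R \<Longrightarrow> rauzy_step m x \<pi> \<in> R"
  using R rauzy_orbit.step_a rauzy_orbit.step_b by (auto simp: rauzy_class_def rauzy_step_def)

lemma rauzy_class_path: "\<pi> \<in> R \<Longrightarrow> rauzy_path m \<pi> w \<in> R"
  by (induction w arbitrary: \<pi>) (auto simp: rauzy_class_step)

lemma finite_rauzy_class: "finite R"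
  by (rule finite_subset[OF _ finite_permutations[of "{1..m}"]])
     (use rauzy_class_irreducible irreducible_permD in auto)

text \<open>The operation \<open>a\<close> keeps the position of \<open>m\<close> and
  \<open>b\<close> keeps the value at \<open>m\<close>. So the parameter of the shift can be read
  off from the result, and the shift can be undone.\<close>

lemma rauzy_step_inj: "inj_on (rauzy_step m x) R"
proof (rule inj_onI)
  fix \<pi> \<pi>' assume p: "\<pi> \<in> R" "\<pi>' \<in> R" and eq: "rauzy_step m x \<pi> = rauzy_step m x \<pi>'"
  note ir = rauzy_class_irreducible[OF p(1)] rauzy_class_irreducible[OF p(2)]
  show "\<pi> = \<pi>'"
  proof (cases x)
    case True
    have last: "rauzy_a m \<rho> (inv \<rho> m) = m" if "irreducible_perm m \<rho>" for \<rho>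
      using irreducible_last[OF m that] permutes_inverses(1)[OF irreducible_permD[OF that], of m]
      by (auto simp: rauzy_a_def)
    have "rauzy_a m \<pi> = rauzy_a m \<pi>'" using eq True by (simp add: rauzy_step_def)
    then have "inv \<pi> m = inv \<pi>' m"
      using last[OF ir(1)] last[OF ir(2)] permutes_inj[OF rauzy_a_permutes[OF m ir(1)]] by (metis injD)
    then have "\<pi> j = \<pi>' j" if "j \<in> {1..m}" for j
      using rauzy_a_shift[OF m ir(1) that] rauzy_a_shift[OF m ir(2) that] eq True by (simp add: rauzy_step_def)
    moreover have "\<pi> j = \<pi>' j" if "j \<notin> {1..m}" for j
      using permutes_not_in[OF irreducible_permD[OF ir(1)] that] permutes_not_in[OF irreducible_permD[OF ir(2)] that] by simp
    ultimately show ?thesis by blast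
  next
    case False
    have last: "rauzy_b m \<rho> m = \<rho> m" for \<rho> using m by (simp add: rauzy_b_def)
    have bb: "rauzy_b m \<pi> = rauzy_b m \<pi>'" using eq False by (simp add: rauzy_step_def)
    then have q: "\<pi> m = \<pi>' m" using last by metis
    have s: "inj (rauzy_shift m (\<pi> m))"
      by (rule permutes_inj[OF rauzy_shift_permutes[OF irreducible_last(1)[OF m ir(1)]]])
    have "\<pi> = inv (rauzy_shift m (\<pi> m)) \<circ> rauzy_b m \<pi>"
      unfolding rauzy_b_eq[OF m ir(1)] using s by (simp add: fun_eq_iff inv_f_f)
    also have "\<dots> = \<pi>'"
      unfolding bb rauzy_b_eq[OF m ir(2)] q using s[unfolded q] by (simp add: fun_eq_iff inv_f_f)
    finally show ?thesis .
  qed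
qed

lemma path_replicate: "rauzy_path m \<pi> (replicate n x) = (rauzy_step m x ^^ n) \<pi>"
  by (induction n arbitrary: \<pi>) (simp_all add: funpow_swap1)

lemma rauzy_step_periodic:
  assumes "\<pi> \<in> R"
  obtains n where "n \<ge> 1" "rauzy_path m \<pi> (replicate n x) = \<pi>"
proof -
  let ?f = "\<lambda>n. rauzy_path m \<pi> (replicate n x)"
  have "\<not> inj_on ?f (UNIV :: nat set)"
  proof
    assume "inj_on ?f (UNIV :: nat set)"
    moreover have "finite (range ?f)"
      by (rule finite_subset[OF _ finite_rauzy_class]) (use rauzy_class_path[OF assms] in auto)
    ultimately show False using finite_imageD by blast
  qed
  then obtain i' j' where ij': "i' \<noteq> j'" "?f i' = ?f j'" unfolding inj_on_def by blast
  define i j where "i = min i' j'" and "j = max i' j'"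
  have ij: "i < j" "?f i = ?f j" using ij' by (auto simp: i_def j_def min_def max_def)
  have injp: "(rauzy_step m x ^^ i) \<rho> = (rauzy_step m x ^^ i) \<rho>' \<Longrightarrow> \<rho> = \<rho>'" if "\<rho> \<in> R" "\<rho>' \<in> R" for \<rho> \<rho>' i
    using that
  proof (induction i arbitrary: \<rho> \<rho>')
    case (Suc i)
    have "rauzy_step m x \<rho> = rauzy_step m x \<rho>'"
      using Suc.IH[of "rauzy_step m x \<rho>" "rauzy_step m x \<rho>'"] Suc.prems rauzy_class_step
      by (simp add: funpow_swap1)
    then show ?case using rauzy_step_inj Suc.prems by (auto dest: inj_onD)
  qed simp
  have "(rauzy_step m x ^^ i) \<pi> = (rauzy_step m x ^^ i) (?f (j - i))"
    using ij funpow_add[of i "j - i" "rauzy_step m x"] unfolding path_replicate by simp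
  then have "\<pi> = ?f (j - i)" by (rule injp[OF assms rauzy_class_path[OF assms]])
  then show ?thesis using that[of "j - i"] ij by simp
qed

text \<open>A single \<open>a\<close> followed by a full period of \<open>b\<close>, and a full
  period of \<open>a\<close> followed by a single \<open>b\<close>, are blocks with the effect of
  one operation. Periodicity also inverts each operation, so paths from the initial permutation can
  be reversed.\<close>

lemma rauzy_block_path:
  assumes "\<pi> \<in> R" "\<pi>' \<in> R"
  shows "(\<pi>, \<pi>') \<in> {(\<rho>, \<rho>'). \<rho> \<in> R \<and> (\<exists>w. block w \<and> rauzy_path m \<rho> w = \<rho>')}\<^sup>*"
proof -
  let ?E = "{(\<rho>, \<rho>'). \<rho> \<in> R \<and> (\<exists>w. block w \<and> rauzy_path m \<rho> w = \<rho>')}"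
  have gen: "(\<rho>, rauzy_step m x \<rho>) \<in> ?E" if rR: "\<rho> \<in> R" for \<rho> x
  proof (cases x)
    case True
    obtain l where l: "l \<ge> 1" "rauzy_path m (rauzy_step m True \<rho>) (replicate l False) = rauzy_step m True \<rho>"
      using rauzy_step_periodic[OF rauzy_class_step[OF rR]] by blast
    have "block (replicate 1 True @ replicate l False)" unfolding block_def using l(1) by blast
    then show ?thesis using True rR l(2) by (auto intro!: exI[of _ "replicate 1 True @ replicate l False"])
  next
    case False
    obtain l where l: "l \<ge> 1" "rauzy_path m \<rho> (replicate l True) = \<rho>" using rauzy_step_periodic[OF rR] by blast
    have "block (replicate l True @ replicate 1 False)" unfolding block_def using l(1) by blast
    then show ?thesis using False rR l(2) by (auto intro!: exI[of _ "replicate l True @ replicate 1 False"])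
  qed
  have iter: "(\<rho>, (rauzy_step m x ^^ n) \<rho>) \<in> ?E\<^sup>*" if "\<rho> \<in> R" for \<rho> x n
  proof (induction n)
    case (Suc n)
    have "(rauzy_step m x ^^ n) \<rho> \<in> R" using rauzy_class_path[OF that, of "replicate n x"] by (simp add: path_replicate)
    from gen[OF this, of x] Suc show ?case by (auto intro: rtrancl_into_rtrancl)
  qed simp
  have bck: "(rauzy_step m x \<rho>, \<rho>) \<in> ?E\<^sup>*" if rR: "\<rho> \<in> R" for \<rho> x
  proof -
    obtain n where n: "n \<ge> 1" "rauzy_path m \<rho> (replicate n x) = \<rho>" using rauzy_step_periodic[OF rR] by blast
    then obtain k where "n = Suc k" by (cases n) auto
    then have "(rauzy_step m x ^^ k) (rauzy_step m x \<rho>) = \<rho>" using n by (simp add: path_replicate funpow_swap1)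
    then show ?thesis using iter[OF rauzy_class_step[OF rR, of x], where x = x and n = k] by simp
  qed
  obtain \<pi>\<^sub>0 where \<pi>\<^sub>0: "R = rauzy_orbit m \<pi>\<^sub>0" using R by (auto simp: rauzy_class_def)
  have "\<rho> \<in> rauzy_orbit m \<pi>\<^sub>0 \<Longrightarrow> (\<pi>\<^sub>0, \<rho>) \<in> ?E\<^sup>* \<and> (\<rho>, \<pi>\<^sub>0) \<in> ?E\<^sup>*" for \<rho>
  proof (induction rule: rauzy_orbit.induct)
    case (step_a \<rho>)
    then have "\<rho> \<in> R" by (simp add: \<pi>\<^sub>0)
    from gen[OF this, of True] bck[OF this, of True] step_a.IH show ?case
      by (auto simp: rauzy_step_def intro: rtrancl_into_rtrancl rtrancl_trans)
  next
    case (step_b \<rho>)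
    then have "\<rho> \<in> R" by (simp add: \<pi>\<^sub>0)
    from gen[OF this, of False] bck[OF this, of False] step_b.IH show ?case
      by (auto simp: rauzy_step_def intro: rtrancl_into_rtrancl rtrancl_trans)
  qed simp
  then have conn: "(\<pi>\<^sub>0, \<rho>) \<in> ?E\<^sup>* \<and> (\<rho>, \<pi>\<^sub>0) \<in> ?E\<^sup>*" if "\<rho> \<in> R" for \<rho> using that \<pi>\<^sub>0 by blast
  show ?thesis using conn[OF assms(1)] conn[OF assms(2)] by (blast intro: rtrancl_trans)
qed

text \<open>
  As \<open>a\<close> and \<open>b\<close> have finite orders, every permutation can follow itself under \<open>\<G>\<^sup>2\<close>, so paths of
  different lengths can be padded to the same number of changes.
\<close>

lemma rauzy_words_same_changes:
  assumes "\<pi> \<in> R" and q: "q \<noteq> []" "hd q"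
  shows "\<exists>J. \<forall>\<pi>'\<in>R. \<exists>r. rauzy_path m \<pi> (q @ r) = \<pi>' \<and> r \<noteq> [] \<and> \<not> last r \<and> changes (q @ r @ [True]) = 2 * J"
proof -
  let ?E = "{(\<rho>, \<rho>'). \<rho> \<in> R \<and> (\<exists>w. block w \<and> rauzy_path m \<rho> w = \<rho>')}"
  define \<pi>1 where "\<pi>1 = rauzy_path m \<pi> q"
  have \<pi>1: "\<pi>1 \<in> R" unfolding \<pi>1_def by (rule rauzy_class_path[OF assms(1)])
  \<comment> \<open>A full period of \<open>b\<close> appended to \<open>q\<close> leaves the
    permutation unchanged and makes the word end with \<open>False\<close>, so that blocks can
    follow.\<close>
  obtain p where p: "p \<ge> 1" "rauzy_path m \<pi>1 (replicate p False) = \<pi>1" using rauzy_step_periodic[OF \<pi>1] by blast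
  have loop: "(\<rho>, \<rho>) \<in> ?E" if \<rho>: "\<rho> \<in> R" for \<rho>
  proof -
    obtain i where i: "i \<ge> 1" "rauzy_path m \<rho> (replicate i True) = \<rho>" using rauzy_step_periodic[OF \<rho>] by blast
    obtain l where l: "l \<ge> 1" "rauzy_path m \<rho> (replicate l False) = \<rho>" using rauzy_step_periodic[OF \<rho>] by blast
    have "block (replicate i True @ replicate l False)" unfolding block_def using i l by blast
    moreover have "rauzy_path m \<rho> (replicate i True @ replicate l False) = \<rho>" using i l by simp
    ultimately show ?thesis using \<rho> by blast
  qed
  have pad: "(\<rho>, \<rho>') \<in> ?E ^^ (n + k)" if "(\<rho>, \<rho>') \<in> ?E ^^ n" "\<rho>' \<in> R" for \<rho> \<rho>' n k
  proof (induction k)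
    case (Suc k)
    then show ?case using loop[OF that(2)] by (auto intro: relcompI)
  qed (use that in simp)
  have "\<forall>\<pi>'\<in>R. \<exists>n. (\<pi>1, \<pi>') \<in> ?E ^^ n" using rauzy_block_path[OF \<pi>1] by (auto dest: rtrancl_imp_relpow)
  from bchoice[OF this] obtain n where n': "\<forall>\<pi>'\<in>R. (\<pi>1, \<pi>') \<in> ?E ^^ n \<pi>'" by (rule exE)
  note n = bspec[OF n']
  define N where "N = Max (n ` R)"
  have nN: "(\<pi>1, \<pi>') \<in> ?E ^^ N" if "\<pi>' \<in> R" for \<pi>'
  proof -
    have "n \<pi>' \<le> N" unfolding N_def using finite_rauzy_class that by simp
    then show ?thesis using pad[OF n[OF that] that, of "N - n \<pi>'"] by simp
  qed
  \<comment> \<open>The count is stated for every nonempty prefix \<open>u\<close> ending in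
    \<open>False\<close>. Then each appended block adds exactly two changes, whatever precedes
    it.\<close>
  have word: "\<exists>r. rauzy_path m \<pi>1 r = \<rho> \<and> (\<forall>u. u \<noteq> [] \<longrightarrow> \<not> last u \<longrightarrow>
      \<not> last (u @ r) \<and> changes (u @ r @ [True]) = changes (u @ [True]) + 2 * n)" if "(\<pi>1, \<rho>) \<in> ?E ^^ n" for \<rho> n
    using that
  proof (induction n arbitrary: \<rho>)
    case 0 then show ?case by (intro exI[of _ "[]"]) auto
  next
    case (Suc n)
    then obtain \<rho>1 w where w: "(\<pi>1, \<rho>1) \<in> ?E ^^ n" "block w" "rauzy_path m \<rho>1 w = \<rho>" by auto
    from Suc.IH[OF w(1)] obtain r where r: "rauzy_path m \<pi>1 r = \<rho>1"
      "\<And>u. u \<noteq> [] \<Longrightarrow> \<not> last u \<Longrightarrow> \<not> last (u @ r) \<and> changes (u @ r @ [True]) = changes (u @ [True]) + 2 * n" by blast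
    have "\<not> last (u @ r @ w) \<and> changes (u @ (r @ w) @ [True]) = changes (u @ [True]) + 2 * Suc n"
      if u: "u \<noteq> []" "\<not> last u" for u
    proof -
      have "w \<noteq> [] \<and> \<not> last w" using changes_block[OF w(2)] by blast
      then have "\<not> last (u @ r @ w)" by simp
      moreover have "changes ((u @ r) @ w @ [True]) = changes ((u @ r) @ [True]) + 2"
        using changes_append_True[of w "u @ r"] changes_block[OF w(2)] by simp
      ultimately show ?thesis using r(2)[OF u] by simp
    qed
    then show ?case using r(1) w(3) by (intro exI[of _ "r @ w"]) simp
  qed
  let ?u = "q @ replicate p False"
  have u: "?u \<noteq> []" "\<not> last ?u" using q p(1) by auto
  \<comment> \<open>The word begins and ends with \<open>True\<close>, so its number of changes is
    even and corresponds to whole pairs of \<G>-steps.\<close>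
  have "even (changes (?u @ [True]))" using q by (subst even_changes) auto
  then obtain J0 where J0: "changes (?u @ [True]) = 2 * J0" by blast
  show ?thesis
  proof (intro exI[of _ "J0 + N"] ballI)
    fix \<pi>' assume "\<pi>' \<in> R"
    from word[OF nN[OF this]] obtain r where r: "rauzy_path m \<pi>1 r = \<pi>'" "\<not> last (?u @ r)"
      "changes (?u @ r @ [True]) = changes (?u @ [True]) + 2 * N" using u by blast
    show "\<exists>r. rauzy_path m \<pi> (q @ r) = \<pi>' \<and> r \<noteq> [] \<and> \<not> last r \<and> changes (q @ r @ [True]) = 2 * (J0 + N)"
      using r p J0 by (intro exI[of _ "replicate p False @ r"]) (auto simp: \<pi>1_def[symmetric])
  qed
qed

end

subsection \<open>Iterates of the Zorich map\<close>

text \<open>The points whose orbits stay for ever where \<open>rauzy_T\<close> is genuinely defined;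
  their itineraries are infinite.\<close>

definition nondeg :: "nat \<Rightarrow> (nat \<Rightarrow> nat) set \<Rightarrow> ((nat \<Rightarrow> real) \<times> (nat \<Rightarrow> nat)) set" where
  "nondeg m R = {y \<in> open_simplex m \<times> R. \<forall>n. \<exists>x. typed m x ((rauzy_T m ^^ n) y)}"

text \<open>The itinerary. A value \<open>False\<close> means type \<open>b\<close> only on
  \<open>nondeg\<close> (see \<open>nondeg_typed\<close>); elsewhere it may also mean that the type
  is undefined.\<close>

abbreviation types :: "nat \<Rightarrow> (nat \<Rightarrow> real) \<times> (nat \<Rightarrow> nat) \<Rightarrow> nat \<Rightarrow> bool" where
  "types m y n \<equiv> typed m True ((rauzy_T m ^^ n) y)"

context
  fixes m :: nat and R :: "(nat \<Rightarrow> nat) set"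
  assumes m: "m \<ge> 2" and R: "rauzy_class m R"
begin

lemma typed_Delta:
  assumes "snd y \<in> R"
  shows "y \<in> Delta_plus m R \<longleftrightarrow> typed m True y" "y \<in> Delta_minus m R \<longleftrightarrow> typed m False y"
  using assms by (auto simp: Delta_plus_def Delta_minus_def typed_def simplex_plus_def simplex_minus_def
      winner_def loser_def split: prod.splits)

lemma rauzy_T_untyped:
  assumes "\<And>x. \<not> typed m x y" shows "rauzy_T m y = y"
proof -
  obtain v \<pi> where y: "y = (v, \<pi>)" by (cases y)
  have "v \<notin> simplex_plus m \<pi>" "v \<notin> simplex_minus m \<pi>"
    using assms[of True] assms[of False] unfolding y
    by (simp_all add: typed_def winner_def loser_def simplex_plus_def simplex_minus_def)
  then show ?thesis by (simp add: y rauzy_T_def)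
qed

lemma rauzy_T_base:
  assumes "y \<in> open_simplex m \<times> R" shows "rauzy_T m y \<in> open_simplex m \<times> R"
proof (cases "\<exists>x. typed m x y")
  case True
  then obtain x where x: "typed m x y" by blast
  obtain v \<pi> where y: "y = (v, \<pi>)" by (cases y)
  have v: "v \<in> open_simplex m" and \<pi>: "\<pi> \<in> R" using assms y by auto
  have "vec_normalize m (unstep m x \<pi> v) \<in> open_simplex m"
    using vec_normalize_pos_cone[OF unstep_pos_cone[OF m rauzy_class_irreducible[OF m R \<pi>] open_simplexD(1)[OF v]]]
      x m unfolding y typed_def by auto
  then show ?thesis using rauzy_T_typed[OF m x[unfolded y]] rauzy_class_step[OF m R \<pi>] y by simp
next
  case False
  then show ?thesis using rauzy_T_untyped[of y] assms by simp
qed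

lemma rauzy_T_iter_base: "y \<in> open_simplex m \<times> R \<Longrightarrow> (rauzy_T m ^^ n) y \<in> open_simplex m \<times> R"
  by (induction n) (simp_all add: rauzy_T_base del: mem_Times_iff)

lemma return_times_eq:
  assumes "y \<in> open_simplex m \<times> R" "typed m x y"
  shows "return_times m R y = {k. 0 < k \<and> typed m (\<not> x) ((rauzy_T m ^^ k) y)}"
proof -
  have s: "snd ((rauzy_T m ^^ k) y) \<in> R" for k using rauzy_T_iter_base[OF assms(1), of k] by auto
  have y: "typed m x' y \<longleftrightarrow> x' = x" for x' using assms(2) typed_exclusive[OF m, of x' y x] by auto
  have p: "y \<in> Delta_plus m R \<longleftrightarrow> x" "y \<in> Delta_minus m R \<longleftrightarrow> \<not> x"
    using typed_Delta[of y] s[of 0] y[of True] y[of False] by simp_all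
  show ?thesis unfolding return_times_def p typed_Delta[OF s] by (cases x) simp_all
qed

lemma zorich_G_step:
  assumes y: "y \<in> open_simplex m \<times> R" and r: "r > 0"
    and same: "\<And>i. i < r \<Longrightarrow> typed m x ((rauzy_T m ^^ i) y)"
    and other: "typed m (\<not> x) ((rauzy_T m ^^ r) y)"
  shows "zorich_G m R y = (rauzy_T m ^^ r) y"
proof -
  have rt: "return_times m R y = {k. 0 < k \<and> typed m (\<not> x) ((rauzy_T m ^^ k) y)}"
    using return_times_eq[OF y] same[OF r] same[of 0] r by simp
  have "r \<in> return_times m R y" using r other by (simp add: rt)
  moreover have "r \<le> k" if "k \<in> return_times m R y" for k
  proof (rule ccontr)
    assume "\<not> r \<le> k"
    then have "typed m x ((rauzy_T m ^^ k) y)" using same by simp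
    moreover have "typed m (\<not> x) ((rauzy_T m ^^ k) y)" using that by (simp add: rt)
    ultimately show False using typed_exclusive[OF m] by blast
  qed
  ultimately have "Inf (return_times m R y) = r" "return_times m R y \<noteq> {}"
    by (auto intro!: cInf_eq_minimum)
  then show ?thesis by (simp add: zorich_G_def)
qed

text \<open>Iterating \<G> as often as the letter has changed leads to the time \<open>N'\<close> at
  which the current run of equal letters began, which may be earlier than \<open>N\<close>.\<close>

lemma zorich_G_iter:
  assumes y: "y \<in> open_simplex m \<times> R"
  shows "(\<And>i. i \<le> N \<Longrightarrow> typed m (s i) ((rauzy_T m ^^ i) y)) \<Longrightarrow>
    \<exists>N'\<le>N. (\<forall>i. N' \<le> i \<and> i \<le> N \<longrightarrow> s i = s N) \<and> changes_upto s N' = changes_upto s N \<and>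
      (N' = 0 \<or> s (N' - 1) \<noteq> s N') \<and> (zorich_G m R ^^ changes_upto s N) y = (rauzy_T m ^^ N') y"
proof (induction N)
  case 0 then show ?case by (intro exI[of _ 0]) simp
next
  case (Suc N)
  have "typed m (s i) ((rauzy_T m ^^ i) y)" if "i \<le> N" for i using Suc.prems that by simp
  from Suc.IH[OF this] obtain N' where N': "N' \<le> N" "\<forall>i. N' \<le> i \<and> i \<le> N \<longrightarrow> s i = s N"
    "changes_upto s N' = changes_upto s N" "N' = 0 \<or> s (N' - 1) \<noteq> s N'"
    "(zorich_G m R ^^ changes_upto s N) y = (rauzy_T m ^^ N') y" by blast
  show ?case
  proof (cases "s (Suc N) = s N")
    case True
    then have c: "changes_upto s (Suc N) = changes_upto s N" by (simp add: changes_upto_Suc)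
    have u: "\<forall>i. N' \<le> i \<and> i \<le> Suc N \<longrightarrow> s i = s (Suc N)" using N'(2) True by (metis le_Suc_eq)
    show ?thesis
      unfolding c by (intro exI[of _ N'] conjI u N'(3-5)) (use N'(1) in simp)
  next
    case False
    have add: "(rauzy_T m ^^ i) ((rauzy_T m ^^ N') y) = (rauzy_T m ^^ (i + N')) y" for i by (simp add: funpow_add)
    have "(zorich_G m R ^^ changes_upto s (Suc N)) y = zorich_G m R ((rauzy_T m ^^ N') y)"
      using False N'(5) by (simp add: changes_upto_Suc)
    also have "\<dots> = (rauzy_T m ^^ (Suc N - N')) ((rauzy_T m ^^ N') y)"
    proof (rule zorich_G_step[OF rauzy_T_iter_base[OF y], where x = "s N"])
      show "typed m (s N) ((rauzy_T m ^^ i) ((rauzy_T m ^^ N') y))" if "i < Suc N - N'" for i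
        using Suc.prems[of "i + N'"] N'(2)[THEN spec, of "i + N'"] that unfolding add by auto
      show "typed m (\<not> s N) ((rauzy_T m ^^ (Suc N - N')) ((rauzy_T m ^^ N') y))"
        using Suc.prems[of "Suc N"] False N'(1) unfolding add by (cases "s N") auto
    qed (use N'(1) in simp)
    also have "\<dots> = (rauzy_T m ^^ Suc N) y" using N'(1) unfolding add by simp
    finally have e: "(zorich_G m R ^^ changes_upto s (Suc N)) y = (rauzy_T m ^^ Suc N) y" .
    show ?thesis
    proof (intro exI[of _ "Suc N"] conjI)
      show "Suc N = 0 \<or> s (Suc N - 1) \<noteq> s (Suc N)" using False by simp
      show "\<forall>i. Suc N \<le> i \<and> i \<le> Suc N \<longrightarrow> s i = s (Suc N)" by (metis le_antisym)
    qed (rule le_refl refl e)+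
  qed
qed

lemma zorich_G_iter_change:
  assumes y: "y \<in> open_simplex m \<times> R" and s: "\<And>i. i \<le> N \<Longrightarrow> typed m (s i) ((rauzy_T m ^^ i) y)"
    and N: "N > 0" "s (N - 1) \<noteq> s N"
  shows "(zorich_G m R ^^ changes_upto s N) y = (rauzy_T m ^^ N) y"
proof -
  obtain N' where N': "N' \<le> N" "\<forall>i. N' \<le> i \<and> i \<le> N \<longrightarrow> s i = s N"
    "(zorich_G m R ^^ changes_upto s N) y = (rauzy_T m ^^ N') y"
    using zorich_G_iter[OF y, of N s] s by blast
  have "\<not> N' \<le> N - 1" using N' N by (metis diff_le_self)
  then have "N' = N" using N'(1) by simp
  then show ?thesis using N' by simp
qed

text \<open>The last letter of \<open>w\<close> is \<open>False\<close> and the next type is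
  \<open>True\<close>. So the end of \<open>w\<close> is a time of change, and the iterate of \<G>
  arrives exactly there.\<close>

lemma zorich_G_word:
  assumes v: "v \<in> cyl m \<pi> w" and \<pi>: "\<pi> \<in> R" and w: "w \<noteq> []" "\<not> last w"
    and t: "typed m True ((rauzy_T m ^^ length w) (v, \<pi>))"
  shows "(zorich_G m R ^^ changes (w @ [True])) (v, \<pi>) = (rauzy_T m ^^ length w) (v, \<pi>)"
proof -
  have vo: "v \<in> open_simplex m" using v cyl_subset[OF m] by blast
  let ?s = "\<lambda>i. (w @ [True]) ! i"
  have "typed m (?s i) ((rauzy_T m ^^ i) (v, \<pi>))" if "i \<le> length w" for i
    using cyl_iff_typed[OF m rauzy_class_irreducible[OF m R \<pi>] vo] v t that by (cases "i = length w") (auto simp: nth_append)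
  moreover have "?s (length w - 1) \<noteq> ?s (length w)" using w by (simp add: nth_append last_conv_nth)
  ultimately have "(zorich_G m R ^^ changes_upto ?s (length w)) (v, \<pi>) = (rauzy_T m ^^ length w) (v, \<pi>)"
    using w vo \<pi> by (intro zorich_G_iter_change) auto
  moreover have "changes_upto ?s (length w) = changes (w @ [True])"
    using map_nth[of "w @ [True]"] by (simp only: changes_upto_def length_append length_Cons list.size(3) add_Suc_right add_0_right)
  ultimately show ?thesis by simp
qed

lemma nondeg_typed: "y \<in> nondeg m R \<Longrightarrow> typed m (types m y n) ((rauzy_T m ^^ n) y)"
proof -
  assume "y \<in> nondeg m R"
  then obtain x where "typed m x ((rauzy_T m ^^ n) y)" by (auto simp: nondeg_def)
  then show ?thesis by (cases x; cases "types m y n") auto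
qed

lemma nondeg_types_infinite:
  assumes "y \<in> nondeg m R" shows "\<exists>\<^sub>\<infinity>n. types m y n = x"
proof -
  obtain v \<pi> where y: "y = (v, \<pi>)" by (cases y)
  have v: "v \<in> open_simplex m" "\<pi> \<in> R" using assms by (auto simp: y nondeg_def)
  show ?thesis
    unfolding y
    by (rule rauzy_orbit_words(2)[OF m rauzy_class_irreducible[OF m R v(2)] v(1) nondeg_typed[OF assms[unfolded y]]])
qed

lemma nondeg_zorich_G:
  assumes y: "y \<in> nondeg m R"
  obtains N where "N \<ge> n" "(zorich_G m R ^^ n) y = (rauzy_T m ^^ N) y"
    "changes_upto (types m y) N = n" "N = 0 \<or> types m y (N - 1) \<noteq> types m y N"
proof -
  obtain N0 where N0: "changes_upto (types m y) N0 = n"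
    using changes_upto_surj[OF nondeg_types_infinite[OF y]] by blast
  have yb: "y \<in> open_simplex m \<times> R" using y by (simp add: nondeg_def)
  obtain N where N: "changes_upto (types m y) N = changes_upto (types m y) N0"
      "N = 0 \<or> types m y (N - 1) \<noteq> types m y N"
      "(zorich_G m R ^^ changes_upto (types m y) N0) y = (rauzy_T m ^^ N) y"
    using zorich_G_iter[OF yb nondeg_typed[OF y]] by blast
  have "N \<ge> n" using changes_upto_le[of "types m y" N] N(1) N0 by simp
  then show ?thesis by (rule that[OF _ N(3)[unfolded N0] N(1)[unfolded N0] N(2)])
qed

lemma nondeg_regular:
  assumes "y \<in> nondeg m R" "y \<in> Delta_plus m R"
  shows "y \<in> Delta_plus_regular m R"
proof -
  have "return_times m R ((zorich_G m R ^^ n) y) \<noteq> {}" for n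
  proof -
    obtain N where N: "(zorich_G m R ^^ n) y = (rauzy_T m ^^ N) y" using nondeg_zorich_G[OF assms(1)] by blast
    let ?x = "types m y N"
    obtain k where k: "k \<ge> Suc N" "types m y k = (\<not> ?x)"
      using nondeg_types_infinite[OF assms(1)] unfolding INFM_nat_le by blast
    have yb: "y \<in> open_simplex m \<times> R" using assms(1) by (simp add: nondeg_def)
    have "typed m (\<not> ?x) ((rauzy_T m ^^ (k - N)) ((rauzy_T m ^^ N) y))"
    proof -
      have "(rauzy_T m ^^ (k - N)) ((rauzy_T m ^^ N) y) = (rauzy_T m ^^ k) y"
        using funpow_add[of "k - N" N "rauzy_T m"] k(1) by simp
      then show ?thesis using nondeg_typed[OF assms(1), of k] unfolding k(2) by simp
    qed
    then have "k - N \<in> return_times m R ((rauzy_T m ^^ N) y)"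
      using return_times_eq[OF rauzy_T_iter_base[OF yb] nondeg_typed[OF assms(1)]] k(1) by auto
    then show ?thesis unfolding N by blast
  qed
  then show ?thesis using assms(2) by (simp add: Delta_plus_regular_def)
qed

lemma zorich_G_swap:
  assumes "return_times m R y \<noteq> {}"
  shows "y \<in> Delta_plus m R \<Longrightarrow> zorich_G m R y \<in> Delta_minus m R"
    "y \<in> Delta_minus m R \<Longrightarrow> zorich_G m R y \<in> Delta_plus m R"
proof -
  have disj: "\<not> (y \<in> Delta_plus m R \<and> y \<in> Delta_minus m R)"
    by (auto simp: Delta_plus_def Delta_minus_def simplex_plus_def simplex_minus_def)
  have "Inf (return_times m R y) \<in> return_times m R y" using Inf_nat_def1[OF assms] .
  then show "y \<in> Delta_plus m R \<Longrightarrow> zorich_G m R y \<in> Delta_minus m R"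
    "y \<in> Delta_minus m R \<Longrightarrow> zorich_G m R y \<in> Delta_plus m R"
    using assms disj by (auto simp: return_times_def zorich_G_def)
qed

lemma regular_zorich_G_even:
  assumes "y \<in> Delta_plus_regular m R"
  shows "(zorich_G m R ^^ (2 * n)) y \<in> Delta_plus m R"
proof (induction n)
  case 0 then show ?case using assms by (simp add: Delta_plus_regular_def)
next
  case (Suc n)
  have rt: "return_times m R ((zorich_G m R ^^ k) y) \<noteq> {}" for k using assms by (simp add: Delta_plus_regular_def)
  have "zorich_G m R ((zorich_G m R ^^ (2 * n)) y) \<in> Delta_minus m R" using zorich_G_swap(1)[OF rt Suc] .
  then show ?case using zorich_G_swap(2)[OF rt[of "Suc (2 * n)"]] by simp
qed

text \<open>Let \<open>n\<close> be the first time without a type and \<open>w\<close> the itinerary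
  up to it. The vector is then the image under \<open>word_map\<close> of one on the hyperplane
  \<open>D w\<close>, where the two compared lengths coincide. There are countably many words, and
  each of them carries null sets to null sets.\<close>

lemma null_sets_not_nondeg:
  assumes \<pi>: "\<pi> \<in> R"
  defines "Z \<equiv> {v \<in> open_simplex m. (v, \<pi>) \<notin> nondeg m R}"
  assumes Z: "Z \<in> sets (simplex_borel m)"
  shows "Z \<in> null_sets (cone_measure m)"
proof -
  let ?L = "lebesgue_PiM {1..m}"
  have ir: "irreducible_perm m \<pi>" by (rule rauzy_class_irreducible[OF m R \<pi>])
  define D :: "bool list \<Rightarrow> (nat \<Rightarrow> real) set" where "D w = {u \<in> extensional {1..m}. u (inv (rauzy_path m \<pi> w) m) = u m}" for w
  have D: "D w \<in> null_sets ?L" for w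
    unfolding D_def using irreducible_last(2)[OF m irreducible_rauzy_path[OF m ir, of w]] m
    by (intro null_sets_lebesgue_PiM_diagonal) auto
  have WD: "word_map m \<pi> w ` D w \<in> null_sets ?L" for w
    using emeasure_word_image[OF m ir, of "D w" w] D[of w] by (auto simp: null_sets_def)
  have sub: "cone_over m Z \<subseteq> (\<Union>w. word_map m \<pi> w ` D w)"
  proof
    fix v assume "v \<in> cone_over m Z"
    then have v: "v \<in> pos_cone m" and vZ: "vec_normalize m v \<in> Z" by (auto simp: cone_over_def)
    let ?v = "vec_normalize m v"
    have vo: "?v \<in> open_simplex m" using vec_normalize_pos_cone[OF v] m by simp
    have "\<exists>n. \<forall>x. \<not> typed m x ((rauzy_T m ^^ n) (?v, \<pi>))" using vZ vo \<pi> by (auto simp: Z_def nondeg_def)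
    define n where "n = (LEAST n. \<forall>x. \<not> typed m x ((rauzy_T m ^^ n) (?v, \<pi>)))"
    have n: "\<not> typed m x ((rauzy_T m ^^ n) (?v, \<pi>))" for x
      using LeastI_ex[OF \<open>\<exists>n. \<forall>x. \<not> typed m x ((rauzy_T m ^^ n) (?v, \<pi>))\<close>] unfolding n_def by blast
    have before: "\<exists>x. typed m x ((rauzy_T m ^^ i) (?v, \<pi>))" if "i < n" for i
      using not_less_Least[OF that[unfolded n_def]] by blast
    define w where "w = map (types m (?v, \<pi>)) [0..<n]"
    have "typed m (w ! i) ((rauzy_T m ^^ i) (?v, \<pi>))" if "i < length w" for i
    proof -
      have i: "i < n" "w ! i = types m (?v, \<pi>) i" using that by (auto simp: w_def)
      obtain x where "typed m x ((rauzy_T m ^^ i) (?v, \<pi>))" using before[OF i(1)] by blast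
      then show ?thesis unfolding i(2) by (cases x; cases "types m (?v, \<pi>) i") auto
    qed
    then have "?v \<in> cyl m \<pi> w" using cyl_iff_typed[OF m ir vo] by blast
    then have "?v \<in> word_map m \<pi> w ` pos_cone m" by (simp add: cyl_def)
    then have "v \<in> word_map m \<pi> w ` pos_cone m" using normalize_mem_image_iff[OF m v] by blast
    then obtain u where u: "v = word_map m \<pi> w u" "u \<in> pos_cone m" by (rule imageE)
    have T: "(rauzy_T m ^^ n) (?v, \<pi>) = (vec_normalize m u, rauzy_path m \<pi> w)"
      using rauzy_T_word_map[OF m ir u(2), of w] unfolding u(1)[symmetric] by (simp add: w_def)
    have c: "coord_sum m u > 0" using coord_sum_pos[OF u(2)] m by simp
    have "vec_normalize m u \<in> open_simplex m" using vec_normalize_pos_cone[OF u(2)] m by simp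
    with n[of True] n[of False]
    have "vec_normalize m u (inv (rauzy_path m \<pi> w) m) = vec_normalize m u m"
      unfolding T by (simp add: typed_def winner_def loser_def)
    then have "u (inv (rauzy_path m \<pi> w) m) = u m"
      using c irreducible_last(2)[OF m irreducible_rauzy_path[OF m ir, of w]] m by (auto simp: vec_normalize_def)
    then have "u \<in> D w" using pos_cone_ext[OF u(2)] by (simp add: D_def)
    then show "v \<in> (\<Union>w. word_map m \<pi> w ` D w)" using u(1) by blast
  qed
  have U: "(\<Union>w. word_map m \<pi> w ` D w) \<in> null_sets ?L"
    using WD by (intro null_sets_UN') auto
  have "emeasure (cone_measure m) Z \<le> emeasure ?L (\<Union>w. word_map m \<pi> w ` D w)"
    unfolding emeasure_cone_measure[OF m_ge_1[OF m] Z] using sub U by (intro emeasure_mono) auto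
  then show ?thesis using U Z by (auto simp: null_sets_def)
qed

end

subsection \<open>Measurability and recurrence\<close>

lemma emeasure_vimage_funpow:
  assumes f: "f \<in> measurable M M"
    and inv: "\<And>A. A \<in> sets M \<Longrightarrow> emeasure M (f -` A \<inter> space M) = emeasure M A"
    and A: "A \<in> sets M"
  shows "emeasure M ((f ^^ n) -` A \<inter> space M) = emeasure M A"
proof (induction n)
  case 0 then show ?case using sets.sets_into_space[OF A] by (auto intro!: arg_cong[where f="emeasure M"])
next
  case (Suc n)
  have fn: "f ^^ n \<in> measurable M M" using f by (induction n) auto
  have "(f ^^ Suc n) -` A \<inter> space M = f -` ((f ^^ n) -` A \<inter> space M) \<inter> space M"
    using measurable_space[OF f] by (auto simp: funpow_swap1)
  then show ?case by (simp only: inv[OF measurable_sets[OF fn A]] Suc)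
qed

text \<open>The points of \<open>E\<close> that never return form a set \<open>Q\<close> whose
  preimages are disjoint and of equal measure, so \<open>Q\<close> is null. A point with finitely
  many visits lies in the preimage \<open>P k\<close> for its last visit \<open>k\<close>.\<close>

lemma (in finite_measure) poincare_recurrence:
  assumes f: "f \<in> measurable M M"
    and inv: "\<And>A. A \<in> sets M \<Longrightarrow> emeasure M (f -` A \<inter> space M) = emeasure M A"
    and E: "E \<in> sets M"
  shows "AE x in M. x \<in> E \<longrightarrow> (\<exists>\<^sub>\<infinity>n. (f ^^ n) x \<in> E)"
proof -
  have fn [measurable]: "f ^^ n \<in> measurable M M" for n using f by (induction n) auto
  have invn: "emeasure M ((f ^^ n) -` A \<inter> space M) = emeasure M A" if "A \<in> sets M" for n A
    using f inv that by (rule emeasure_vimage_funpow)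
  define Q where "Q = {x \<in> space M. x \<in> E \<and> (\<forall>n>0. (f ^^ n) x \<notin> E)}"
  have Q: "Q \<in> sets M" unfolding Q_def using E by measurable
  define P where "P n = (f ^^ n) -` Q \<inter> space M" for n
  have P: "P n \<in> sets M" "emeasure M (P n) = emeasure M Q" for n
    unfolding P_def using measurable_sets[OF fn Q] invn[OF Q] by auto
  have disj: "disjoint_family P"
  proof -
    have "P i \<inter> P j = {}" if "i < j" for i j
    proof -
      have "(f ^^ (j - i)) ((f ^^ i) x) = (f ^^ j) x" for x
        using funpow_add[of "j - i" i f] that by simp
      then have "(f ^^ j) x \<notin> E" if "x \<in> P i" for x
        using that \<open>i < j\<close> unfolding P_def Q_def by (metis (mono_tags, lifting) IntD1 mem_Collect_eq vimage_eq zero_less_diff)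
      then show ?thesis by (auto simp: P_def Q_def)
    qed
    then show ?thesis unfolding disjoint_family_on_def by (metis inf_commute linorder_neqE_nat)
  qed
  have "of_nat n * emeasure M Q \<le> emeasure M (space M)" for n
  proof -
    have "of_nat n * emeasure M Q = (\<Sum>i<n. emeasure M (P i))" using P by simp
    also have "\<dots> = emeasure M (\<Union>i<n. P i)"
      using P disj by (intro sum_emeasure) (auto simp: disjoint_family_on_def)
    also have "\<dots> \<le> emeasure M (space M)" by (rule emeasure_space)
    finally show ?thesis .
  qed
  then have "of_nat n * measure M Q \<le> measure M (space M)" for n
    using emeasure_eq_measure by (simp add: ennreal_of_nat_eq_real_of_nat ennreal_mult[symmetric])
  then have "measure M Q = 0"
    by (metis measure_nonneg less_eq_real_def reals_Archimedean3 not_le)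
  then have "Q \<in> null_sets M" using Q by (simp add: null_sets_def emeasure_eq_measure)
  then have "P n \<in> null_sets M" for n using P by (simp add: null_sets_def)
  then have "(\<Union>n. P n) \<in> null_sets M" by (intro null_sets_UN) auto
  then show ?thesis
  proof (rule AE_I')
    show "{x \<in> space M. \<not> (x \<in> E \<longrightarrow> (\<exists>\<^sub>\<infinity>n. (f ^^ n) x \<in> E))} \<subseteq> (\<Union>n. P n)"
    proof
      fix x assume x: "x \<in> {x \<in> space M. \<not> (x \<in> E \<longrightarrow> (\<exists>\<^sub>\<infinity>n. (f ^^ n) x \<in> E))}"
      then have fin: "finite {n. (f ^^ n) x \<in> E}" and "x \<in> E" "x \<in> space M" by (auto simp: INFM_iff_infinite)
      then have ne: "{n. (f ^^ n) x \<in> E} \<noteq> {}" by (auto intro!: exI[of _ 0])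
      define k where "k = Max {n. (f ^^ n) x \<in> E}"
      have k: "(f ^^ k) x \<in> E" "\<And>n. (f ^^ n) x \<in> E \<Longrightarrow> n \<le> k"
        using Max_in[OF fin ne] Max_ge[OF fin] by (auto simp: k_def)
      have "(f ^^ n) ((f ^^ k) x) \<notin> E" if "n > 0" for n
        using k(2)[of "n + k"] that by (auto simp: funpow_add)
      then have "x \<in> P k" using k(1) \<open>x \<in> space M\<close> measurable_space[OF fn] by (auto simp: P_def Q_def)
      then show "x \<in> (\<Union>n. P n)" by blast
    qed
  qed
qed

section \<open>Borel structure and measurability of the induction maps\<close>

abbreviation Delta_borel :: "nat \<Rightarrow> (nat \<Rightarrow> nat) set \<Rightarrow> ((nat \<Rightarrow> real) \<times> (nat \<Rightarrow> nat)) measure" where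
  "Delta_borel m R \<equiv> simplex_borel m \<Otimes>\<^sub>M count_space R"

lemma sets_simplex_lebesgue: "sets (simplex_lebesgue m) = sets (simplex_borel m)"
  by (simp add: simplex_lebesgue_def)

lemma sets_Delta_lebesgue: "sets (Delta_lebesgue m R) = sets (Delta_borel m R)"
  unfolding Delta_lebesgue_def by (intro sets_pair_measure_cong sets_simplex_lebesgue refl)

lemma space_Delta_borel: "space (Delta_borel m R) = open_simplex m \<times> R"
  by (simp only: space_pair_measure space_simplex_borel space_count_space)

lemma measurable_Delta_borel:
  assumes "countable R" "\<And>\<pi>. \<pi> \<in> R \<Longrightarrow> (\<lambda>v. f (v, \<pi>)) \<in> measurable (simplex_borel m) N"
  shows "f \<in> measurable (Delta_borel m R) N"
proof -
  have "(\<lambda>y. (\<lambda>\<pi> y. f (fst y, \<pi>)) (snd y) y) \<in> measurable (Delta_borel m R) N"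
  proof (rule measurable_compose_countable'[OF _ measurable_snd assms(1)])
    fix \<pi> assume "\<pi> \<in> R"
    show "(\<lambda>y. f (fst y, \<pi>)) \<in> measurable (Delta_borel m R) N"
      by (rule measurable_compose[OF measurable_fst assms(2)]) fact
  qed
  then show ?thesis by simp
qed

lemma component_measurable_simplex: "i \<in> {1..m} \<Longrightarrow> (\<lambda>v. v i) \<in> borel_measurable (simplex_borel m)"
  by (intro measurable_restrict_space1 measurable_component_singleton)

lemma mat_vec_measurable: "mat_vec m B \<in> measurable (PiM {1..m} (\<lambda>_. borel)) (lebesgue_PiM {1..m})"
  unfolding mat_vec_def
proof (rule measurable_restrict)
  fix i assume "i \<in> {1..m}"
  have "(\<lambda>v. \<Sum>j = 1..m. B i j * v j) \<in> borel_measurable (PiM {1..m} (\<lambda>_. borel))" by measurable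
  then show "(\<lambda>v. \<Sum>j = 1..m. B i j * v j) \<in> measurable (PiM {1..m} (\<lambda>_. borel)) lborel" by simp
qed

context
  fixes m :: nat and R :: "(nat \<Rightarrow> nat) set"
  assumes m: "m \<ge> 2" and R: "rauzy_class m R"
begin

lemma typed_measurable_slice:
  assumes "\<pi> \<in> R" shows "{v \<in> space (simplex_borel m). typed m x (v, \<pi>)} \<in> sets (simplex_borel m)"
proof -
  have "{v \<in> space (simplex_borel m). v (loser m x \<pi>) < v (winner m x \<pi>)} \<in> sets (simplex_borel m)"
    using winner_loser[OF m rauzy_class_irreducible[OF m R assms], of x]
    by (intro borel_measurable_less component_measurable_simplex)
  then show ?thesis unfolding space_simplex_borel typed_def by (simp cong: conj_cong)
qed

lemma typed_measurable: "{y \<in> space (Delta_borel m R). typed m x y} \<in> sets (Delta_borel m R)"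
proof -
  have "(\<lambda>y. typed m x y) \<in> measurable (Delta_borel m R) (count_space UNIV)"
  proof (rule measurable_Delta_borel)
    fix \<pi> assume "\<pi> \<in> R"
    from typed_measurable_slice[OF this]
    show "(\<lambda>v. typed m x (v, \<pi>)) \<in> measurable (simplex_borel m) (count_space UNIV)"
      by (simp add: pred_def)
  qed (rule countable_finite[OF finite_rauzy_class[OF m R]])
  then show ?thesis by (simp only: pred_def)
qed

lemma rauzy_T_measurable: "rauzy_T m \<in> measurable (Delta_borel m R) (Delta_borel m R)"
proof (rule measurable_Delta_borel)
  fix \<pi> assume \<pi>: "\<pi> \<in> R"
  define h where "h x v = (if typed m x (v, \<pi>) then vec_normalize m (unstep m x \<pi> v) else v)" for x v
  have h: "h x \<in> measurable (simplex_borel m) (simplex_borel m)" for x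
  proof (rule measurable_restrict_space2)
    show "h x \<in> space (simplex_borel m) \<rightarrow> open_simplex m"
    proof
      fix v assume v: "v \<in> space (simplex_borel m)"
      then have vo: "v \<in> open_simplex m" by (simp only: space_simplex_borel)
      have "vec_normalize m (unstep m x \<pi> v) \<in> open_simplex m" if "typed m x (v, \<pi>)"
        using vec_normalize_pos_cone[OF unstep_pos_cone[OF m rauzy_class_irreducible[OF m R \<pi>] open_simplexD(1)[OF vo]]]
          that m by (simp add: typed_def)
      then show "h x v \<in> open_simplex m" using vo by (simp add: h_def)
    qed
    have "(\<lambda>v. vec_normalize m (unstep m x \<pi> v)) \<in> measurable (PiM {1..m} (\<lambda>_. borel)) (PiM {1..m} (\<lambda>_. borel))"
      unfolding unstep_def by (rule measurable_compose[OF mat_vec_measurable vec_normalize_measurable])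
    then show "h x \<in> measurable (simplex_borel m) (PiM {1..m} (\<lambda>_. borel))"
      unfolding h_def
      by (intro measurable_If measurable_restrict_space1 typed_measurable_slice[OF \<pi>] measurable_ident_sets refl)
  qed
  have eq: "rauzy_T m (v, \<pi>) = (if typed m True (v, \<pi>) then (h True v, rauzy_step m True \<pi>)
      else if typed m False (v, \<pi>) then (h False v, rauzy_step m False \<pi>) else (v, \<pi>))" for v
  proof -
    consider "typed m True (v, \<pi>)" | "\<not> typed m True (v, \<pi>)" "typed m False (v, \<pi>)" | "\<And>x. \<not> typed m x (v, \<pi>)"
      by (metis (full_types))
    then show ?thesis
    proof cases
      case 3 then show ?thesis using rauzy_T_untyped[OF m R, of "(v, \<pi>)"] by simp
    qed (simp_all add: rauzy_T_typed[OF m] h_def)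
  qed
  show "(\<lambda>v. rauzy_T m (v, \<pi>)) \<in> measurable (simplex_borel m) (Delta_borel m R)"
    unfolding eq using \<pi> rauzy_class_step[OF m R \<pi>]
    by (intro measurable_If measurable_Pair h measurable_ident_sets refl typed_measurable_slice measurable_const) auto
qed (rule countable_finite[OF finite_rauzy_class[OF m R]])

lemma rauzy_T_iter_measurable: "rauzy_T m ^^ n \<in> measurable (Delta_borel m R) (Delta_borel m R)"
  using rauzy_T_measurable by (induction n) auto

lemma typed_iter_measurable:
  "{y \<in> space (Delta_borel m R). typed m x ((rauzy_T m ^^ n) y)} \<in> sets (Delta_borel m R)"
proof -
  have "{y \<in> space (Delta_borel m R). typed m x ((rauzy_T m ^^ n) y)}
     = (rauzy_T m ^^ n) -` {y \<in> space (Delta_borel m R). typed m x y} \<inter> space (Delta_borel m R)"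
    using measurable_space[OF rauzy_T_iter_measurable[of n]] by blast
  then show ?thesis using measurable_sets[OF rauzy_T_iter_measurable typed_measurable] by simp
qed

lemma Delta_plus_eq: "Delta_plus m R = {y \<in> space (Delta_borel m R). typed m True y}"
  "Delta_minus m R = {y \<in> space (Delta_borel m R). typed m False y}"
  unfolding space_Delta_borel using typed_Delta[OF m R]
  by (auto simp: Delta_plus_def Delta_minus_def simplex_plus_def simplex_minus_def typed_def winner_def loser_def)

lemma Delta_plus_sets: "Delta_plus m R \<in> sets (Delta_borel m R)"
  unfolding Delta_plus_eq by (rule typed_measurable)

lemma return_times_measurable:
  "{y \<in> space (Delta_borel m R). k \<in> return_times m R y} \<in> sets (Delta_borel m R)"
proof -
  have "{y \<in> space (Delta_borel m R). k \<in> return_times m R y} =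
    (if k = 0 then {} else
     {y \<in> space (Delta_borel m R). typed m True y} \<inter> {y \<in> space (Delta_borel m R). typed m False ((rauzy_T m ^^ k) y)} \<union>
     {y \<in> space (Delta_borel m R). typed m False y} \<inter> {y \<in> space (Delta_borel m R). typed m True ((rauzy_T m ^^ k) y)})"
    using measurable_space[OF rauzy_T_iter_measurable[of k]] unfolding return_times_def Delta_plus_eq by auto
  then show ?thesis using typed_measurable typed_iter_measurable by auto
qed

lemma zorich_G_measurable: "zorich_G m R \<in> measurable (Delta_borel m R) (Delta_borel m R)"
proof -
  \<comment> \<open>The second disjunct makes the least number 0 when there is no return. The
    iterate is then the identity, in agreement with the extension of \<open>zorich_G\<close>, and
    the exponent is a measurable function everywhere.\<close>
  let ?P = "\<lambda>k y. k \<in> return_times m R y \<or> (\<forall>j. j \<notin> return_times m R y)"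
  let ?n = "\<lambda>y. LEAST k. ?P k y"
  have G: "zorich_G m R y = (rauzy_T m ^^ ?n y) y" for y
  proof (cases "return_times m R y = {}")
    case True
    then have "?n y = 0" by (intro Least_equality) auto
    then show ?thesis using True by (simp add: zorich_G_def)
  next
    case False
    then have "?n y = Inf (return_times m R y)" unfolding Inf_nat_def by (intro arg_cong[where f=Least]) auto
    then show ?thesis using False by (simp add: zorich_G_def)
  qed
  have [measurable]: "Measurable.pred (Delta_borel m R) (\<lambda>y. k \<in> return_times m R y)" for k
    unfolding pred_def by (rule return_times_measurable)
  have "?n \<in> measurable (Delta_borel m R) (count_space UNIV)"
    by measurable
  from measurable_compose_countable[OF rauzy_T_iter_measurable this] show ?thesis unfolding G[abs_def] .
qed

lemma zorich_G_iter_measurable: "zorich_G m R ^^ n \<in> measurable (Delta_borel m R) (Delta_borel m R)"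
  using zorich_G_measurable by (induction n) auto

lemma nondeg_sets: "nondeg m R \<in> sets (Delta_borel m R)"
proof -
  have "nondeg m R = (\<Inter>n. \<Union>x. {y \<in> space (Delta_borel m R). typed m x ((rauzy_T m ^^ n) y)})"
    unfolding nondeg_def space_Delta_borel by auto
  moreover have "(\<Union>x. {y \<in> space (Delta_borel m R). typed m x ((rauzy_T m ^^ n) y)}) \<in> sets (Delta_borel m R)" for n
    using typed_iter_measurable by (intro sets.countable_UN) auto
  ultimately show ?thesis
    using sets.countable_INT[of "\<lambda>n. \<Union>x. {y \<in> space (Delta_borel m R). typed m x ((rauzy_T m ^^ n) y)}" UNIV "Delta_borel m R"]
    by auto
qed

lemma Delta_plus_regular_sets: "Delta_plus_regular m R \<in> sets (Delta_borel m R)"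
proof -
  let ?S = "\<lambda>n. (zorich_G m R ^^ n) -` (\<Union>k. {y \<in> space (Delta_borel m R). k \<in> return_times m R y}) \<inter> space (Delta_borel m R)"
  have "?S n \<in> sets (Delta_borel m R)" for n
    using return_times_measurable by (intro measurable_sets[OF zorich_G_iter_measurable]) auto
  then have "(\<Inter>n. ?S n) \<in> sets (Delta_borel m R)"
    using sets.countable_INT[of ?S UNIV "Delta_borel m R"] by blast
  with Delta_plus_sets have "Delta_plus m R \<inter> (\<Inter>n. ?S n) \<in> sets (Delta_borel m R)" by (rule sets.Int)
  also have "Delta_plus m R \<inter> (\<Inter>n. ?S n) = Delta_plus_regular m R"
    using measurable_space[OF zorich_G_iter_measurable] sets.sets_into_space[OF Delta_plus_sets]
    unfolding Delta_plus_regular_def by blast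
  finally show ?thesis .
qed

end

text \<open>A basic open set of the product topology restricts only finitely many coordinates, so
  one radius serves all of them. The 1 inserted in the minimum covers the case that none is
  restricted.\<close>

lemma open_fun_coordinate_ball:
  fixes x :: "nat \<Rightarrow> real"
  assumes "open U" "x \<in> U"
  obtains e where "e > 0" "\<And>z. (\<And>i. i \<in> I \<Longrightarrow> \<bar>z i - x i\<bar> \<le> e) \<Longrightarrow> (\<And>i. i \<notin> I \<Longrightarrow> z i = x i) \<Longrightarrow> z \<in> U"
proof -
  have "openin (product_topology (\<lambda>i. euclidean) UNIV) U" using assms(1) by (simp add: open_fun_def)
  from product_topology_open_contains_basis[OF this assms(2)]
  obtain X where X: "x \<in> (\<Pi>\<^sub>E i\<in>UNIV. X i)" "\<And>i. open (X i)" "finite {i. X i \<noteq> UNIV}" "(\<Pi>\<^sub>E i\<in>UNIV. X i) \<subseteq> U"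
    by auto
  have xX: "x i \<in> X i" for i using X(1) by auto
  have "\<exists>e>0. \<forall>y. \<bar>y - x i\<bar> \<le> e \<longrightarrow> y \<in> X i" for i
    using X(2)[of i] xX[of i] unfolding open_contains_cball by (fastforce simp: cball_def dist_real_def abs_minus_commute)
  then obtain e where e: "\<And>i. e i > 0" "\<And>i y. \<bar>y - x i\<bar> \<le> e i \<Longrightarrow> y \<in> X i" by metis
  define d where "d = Min (insert 1 (e ` {i. X i \<noteq> UNIV}))"
  have d: "d > 0" "\<And>i. X i \<noteq> UNIV \<Longrightarrow> d \<le> e i" unfolding d_def using X(3) e(1) by auto
  have "z \<in> U" if z: "\<And>i. i \<in> I \<Longrightarrow> \<bar>z i - x i\<bar> \<le> d" "\<And>i. i \<notin> I \<Longrightarrow> z i = x i" for z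
  proof -
    have "z i \<in> X i" for i
    proof (cases "X i = UNIV")
      case False
      then have "\<bar>z i - x i\<bar> \<le> e i" using z(1)[of i] z(2)[of i] d(1) d(2)[OF False] by (cases "i \<in> I") auto
      then show ?thesis by (rule e(2))
    qed simp
    then show ?thesis using X(4) by auto
  qed
  then show ?thesis using that d(1) by blast
qed

text \<open>Being extensional is a condition on countably many coordinates, hence Borel in the space
  of all functions; within it, membership in \<open>B\<close> depends on the restriction to
  \<open>{1..m}\<close>.\<close>

lemma simplex_borel_sets_borel:
  assumes "B \<in> sets (simplex_borel m)" shows "B \<in> sets borel"
proof -
  have B: "B \<in> sets (PiM {1..m} (\<lambda>_. borel))" using assms open_simplex_sets by (auto simp: sets_restrict_space)
  have r: "(\<lambda>x. restrict x {1..m}) \<in> measurable (PiM UNIV (\<lambda>_. borel :: real measure)) (PiM {1..m} (\<lambda>_. borel))"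
    by (rule measurable_restrict_subset) simp
  have "{x \<in> space (PiM UNIV (\<lambda>_. borel :: real measure)). \<forall>i\<in>- {1..m}. x i = undefined} \<in> sets (PiM UNIV (\<lambda>_. borel))"
    by measurable
  also have "{x \<in> space (PiM UNIV (\<lambda>_. borel :: real measure)). \<forall>i\<in>- {1..m}. x i = undefined} = extensional {1..m}"
    by (auto simp: space_PiM extensional_def)
  finally have "extensional {1..m} \<inter> ((\<lambda>x. restrict x {1..m}) -` B \<inter> space (PiM UNIV (\<lambda>_. borel :: real measure)))
      \<in> sets (PiM UNIV (\<lambda>_. borel))"
    by (rule sets.Int[OF _ measurable_sets[OF r B]])
  also have "extensional {1..m} \<inter> ((\<lambda>x. restrict x {1..m}) -` B \<inter> space (PiM UNIV (\<lambda>_. borel :: real measure))) = B"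
    using sets.sets_into_space[OF B] by (auto simp: space_PiM PiE_def extensional_restrict)
  finally show ?thesis by (simp only: sets_PiM_equal_borel)
qed

definition slice :: "('a \<times> 'b) set \<Rightarrow> 'b \<Rightarrow> 'a set" where
  "slice X \<pi> = (\<lambda>v. (v, \<pi>)) -` X"

lemma slice_sets: "X \<in> sets (Delta_borel m R) \<Longrightarrow> slice X \<pi> \<in> sets (simplex_borel m)"
  unfolding slice_def by (rule sets_Pair2)

section \<open>Null sets, small sets and recurrence for the invariant measure\<close>

context
  fixes m :: nat and R :: "(nat \<Rightarrow> nat) set" and \<nu> :: "((nat \<Rightarrow> real) \<times> (nat \<Rightarrow> nat)) measure"
  assumes m: "m \<ge> 2" and R: "rauzy_class m R" and \<nu>: "zorich_measure m R \<nu>"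
begin

lemma sets_zorich: "sets \<nu> = sets (Delta_borel m R)"
  using \<nu> by (simp only: zorich_measure_def sets_Delta_lebesgue)

lemma space_zorich: "space \<nu> = open_simplex m \<times> R"
  using sets_eq_imp_space_eq[OF sets_zorich] by (simp only: space_Delta_borel)

lemma zorich_prob: "prob_space \<nu>"
  using \<nu> by (simp add: zorich_measure_def)

lemma zorich_G_measurable_\<nu>: "zorich_G m R \<in> measurable \<nu> \<nu>"
  using zorich_G_measurable[OF m R] measurable_cong_sets[OF sets_zorich sets_zorich] by simp

text \<open>Nullity passes from cone measure to Lebesgue measure on the simplex, through the product
  with the finite set \<open>R\<close>, and finally to \<nu>.\<close>

lemma zorich_null:
  assumes X: "X \<in> sets (Delta_borel m R)" and s: "\<And>\<pi>. \<pi> \<in> R \<Longrightarrow> slice X \<pi> \<in> null_sets (cone_measure m)"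
  shows "X \<in> null_sets \<nu>"
proof -
  interpret C: sigma_finite_measure "count_space R"
    by (rule sigma_finite_measure_count_space_finite[OF finite_rauzy_class[OF m R]])
  have XL: "X \<in> sets (simplex_lebesgue m \<Otimes>\<^sub>M count_space R)"
    using X sets_Delta_lebesgue by (simp only: Delta_lebesgue_def[symmetric])
  have "AE v in simplex_lebesgue m. \<forall>\<pi>\<in>R. v \<notin> slice X \<pi>"
  proof (rule AE_finite_allI[OF finite_rauzy_class[OF m R]])
    fix \<pi> assume "\<pi> \<in> R"
    then have "slice X \<pi> \<in> null_sets (simplex_lebesgue m)"
      using s absolutely_continuous_cone_measure[OF m] by (auto simp: absolutely_continuous_def)
    then show "AE v in simplex_lebesgue m. v \<notin> slice X \<pi>" by (rule AE_not_in)
  qed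
  moreover have XR: "X \<subseteq> open_simplex m \<times> R" using sets.sets_into_space[OF X] by (simp only: space_Delta_borel)
  ultimately have "AE v in simplex_lebesgue m. Pair v -` X = {}"
    by (elim AE_mp) (auto intro!: AE_I2 simp: slice_def)
  then have "AE v in simplex_lebesgue m. emeasure (count_space R) (Pair v -` X) = 0"
    by (elim AE_mp) (auto intro!: AE_I2)
  then have "(\<integral>\<^sup>+v. emeasure (count_space R) (Pair v -` X) \<partial>simplex_lebesgue m) = 0"
    by (subst nn_integral_cong_AE[where v = "\<lambda>_. 0"]) auto
  then have "X \<in> null_sets (Delta_lebesgue m R)"
    using C.emeasure_pair_measure_alt[OF XL] XL by (simp add: Delta_lebesgue_def null_sets_def)
  then show ?thesis using \<nu> by (auto simp: zorich_measure_def absolutely_continuous_def)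
qed

text \<open>The epsilon-delta form of absolute continuity. Counterexamples with slices of measure at
  most \<open>(1/2)^n\<close> would have a limit superior that is null by Borel-Cantelli and
  \<open>zorich_null\<close>, but of \<nu>-measure at least \<epsilon> by continuity from
  above.\<close>

lemma zorich_small:
  assumes "\<epsilon> > 0"
  shows "\<exists>\<delta>>0. \<forall>X\<in>sets (Delta_borel m R).
    (\<forall>\<pi>\<in>R. emeasure (cone_measure m) (slice X \<pi>) \<le> ennreal \<delta>) \<longrightarrow> emeasure \<nu> X \<le> ennreal \<epsilon>"
proof (rule ccontr)
  interpret prob_space \<nu> by (rule zorich_prob)
  interpret K: finite_measure "cone_measure m" by (rule finite_measure_cone_measure) (use m in simp)
  assume "\<not> ?thesis"
  then have "\<exists>X. X \<in> sets (Delta_borel m R) \<and> (\<forall>\<pi>\<in>R. emeasure (cone_measure m) (slice X \<pi>) \<le> ennreal \<delta>) \<and> ennreal \<epsilon> < emeasure \<nu> X"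
    if "\<delta> > 0" for \<delta> using that by (meson not_le)
  then have "\<forall>n. \<exists>X. X \<in> sets (Delta_borel m R) \<and> (\<forall>\<pi>\<in>R. emeasure (cone_measure m) (slice X \<pi>) \<le> ennreal ((1/2)^n)) \<and> ennreal \<epsilon> < emeasure \<nu> X"
    by simp
  from choice[OF this] obtain X where X: "\<And>n. X n \<in> sets (Delta_borel m R)"
    "\<And>n \<pi>. \<pi> \<in> R \<Longrightarrow> emeasure (cone_measure m) (slice (X n) \<pi>) \<le> ennreal ((1/2)^n)"
    "\<And>n. ennreal \<epsilon> < emeasure \<nu> (X n)" by blast
  define Y where "Y n = (\<Union>k\<in>{n..}. X k)" for n
  have Y: "Y n \<in> sets (Delta_borel m R)" for n unfolding Y_def using X(1) by (intro sets.countable_UN) auto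
  have Z: "(\<Inter>n. Y n) \<in> sets (Delta_borel m R)" using sets.countable_INT[of Y UNIV "Delta_borel m R"] Y by blast
  have "slice (\<Inter>n. Y n) \<pi> \<in> null_sets (cone_measure m)" if \<pi>: "\<pi> \<in> R" for \<pi>
  proof -
    have "limsup (\<lambda>n. slice (X n) \<pi>) \<in> null_sets (cone_measure m)"
    proof (rule borel_cantelli_limsup1)
      show "slice (X n) \<pi> \<in> sets (cone_measure m)" for n using slice_sets[OF X(1)] by simp
      show "emeasure (cone_measure m) (slice (X n) \<pi>) < \<infinity>" for n
        by (simp add: K.emeasure_eq_measure)
      show "summable (\<lambda>n. measure (cone_measure m) (slice (X n) \<pi>))"
      proof (rule summable_comparison_test[OF exI[of _ 0]])
        show "\<forall>n\<ge>0. norm (measure (cone_measure m) (slice (X n) \<pi>)) \<le> (1/2)^n"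
          using X(2)[OF \<pi>] by (auto simp: K.emeasure_eq_measure)
      qed (simp add: summable_geometric)
    qed
    also have "limsup (\<lambda>n. slice (X n) \<pi>) = slice (\<Inter>n. Y n) \<pi>"
      by (auto simp: limsup_INF_SUP slice_def Y_def)
    finally show ?thesis .
  qed
  from zorich_null[OF Z this] have "emeasure \<nu> (\<Inter>n. Y n) = 0" by auto
  moreover have "(INF n. emeasure \<nu> (Y n)) = emeasure \<nu> (\<Inter>n. Y n)"
  proof (rule INF_emeasure_decseq)
    show "decseq Y" unfolding Y_def by (rule decseq_SucI, rule UN_mono) auto
  qed (use Y in \<open>auto simp: sets_zorich\<close>)
  moreover have "ennreal \<epsilon> \<le> (INF n. emeasure \<nu> (Y n))"
  proof (rule INF_greatest)
    fix n
    have "emeasure \<nu> (X n) \<le> emeasure \<nu> (Y n)" using Y by (intro emeasure_mono) (auto simp: sets_zorich Y_def)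
    then show "ennreal \<epsilon> \<le> emeasure \<nu> (Y n)" using X(3)[of n] by simp
  qed
  ultimately show False using assms by simp
qed

lemma zorich_nondeg: "(open_simplex m \<times> R) - nondeg m R \<in> null_sets \<nu>"
proof (rule zorich_null)
  show X: "(open_simplex m \<times> R) - nondeg m R \<in> sets (Delta_borel m R)"
    using nondeg_sets[OF m R] sets.top[of "Delta_borel m R"] unfolding space_Delta_borel by (intro sets.Diff)
  fix \<pi> assume \<pi>: "\<pi> \<in> R"
  have "slice ((open_simplex m \<times> R) - nondeg m R) \<pi> = {v \<in> open_simplex m. (v, \<pi>) \<notin> nondeg m R}"
    using \<pi> by (auto simp: slice_def)
  then show "slice ((open_simplex m \<times> R) - nondeg m R) \<pi> \<in> null_sets (cone_measure m)"
    using null_sets_not_nondeg[OF m R \<pi>] slice_sets[OF X, of \<pi>] by simp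
qed

lemma zorich_recurrent_words:
  "AE y in \<nu>. \<forall>\<pi>\<in>R. \<forall>q. y \<in> cyl m \<pi> q \<times> {\<pi>} \<longrightarrow> (\<exists>\<^sub>\<infinity>n. (zorich_G m R ^^ n) y \<in> cyl m \<pi> q \<times> {\<pi>})"
proof -
  interpret prob_space \<nu> by (rule zorich_prob)
  have "AE y in \<nu>. y \<in> cyl m \<pi> q \<times> {\<pi>} \<longrightarrow> (\<exists>\<^sub>\<infinity>n. (zorich_G m R ^^ n) y \<in> cyl m \<pi> q \<times> {\<pi>})" if \<pi>: "\<pi> \<in> R" for \<pi> q
  proof (rule poincare_recurrence[OF zorich_G_measurable_\<nu>])
    show "emeasure \<nu> (zorich_G m R -` A \<inter> space \<nu>) = emeasure \<nu> A" if "A \<in> sets \<nu>" for A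
      using \<nu> that by (simp add: zorich_measure_def)
    show "cyl m \<pi> q \<times> {\<pi>} \<in> sets \<nu>"
      unfolding sets_zorich using cyl_sets[OF m rauzy_class_irreducible[OF m R \<pi>]] \<pi> by (intro pair_measureI) auto
  qed
  then have "AE y in \<nu>. \<forall>q. y \<in> cyl m \<pi> q \<times> {\<pi>} \<longrightarrow> (\<exists>\<^sub>\<infinity>n. (zorich_G m R ^^ n) y \<in> cyl m \<pi> q \<times> {\<pi>})"
    if "\<pi> \<in> R" for \<pi> using that by (subst AE_all_countable) blast
  then show ?thesis by (rule AE_finite_allI[OF finite_rauzy_class[OF m R]])
qed

end

subsection \<open>Exactness\<close>

context
  fixes m :: nat and R :: "(nat \<Rightarrow> nat) set"
  assumes m: "m \<ge> 2" and R: "rauzy_class m R"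
begin

lemma cyl_disjoint:
  assumes ir: "irreducible_perm m \<pi>" and "\<not> prefix u v" "\<not> prefix v u"
  shows "cyl m \<pi> u \<inter> cyl m \<pi> v = {}"
proof -
  have "prefix u v" if z: "z \<in> cyl m \<pi> u" "z \<in> cyl m \<pi> v" and le: "length u \<le> length v" for z u v
  proof -
    have zo: "z \<in> open_simplex m" using z cyl_subset[OF m] by blast
    have "u ! i = v ! i" if "i < length u" for i
    proof -
      have "typed m (u ! i) ((rauzy_T m ^^ i) (z, \<pi>))"
        using iffD1[OF cyl_iff_typed[OF m ir zo] z(1)] that by blast
      moreover have "typed m (v ! i) ((rauzy_T m ^^ i) (z, \<pi>))"
        using iffD1[OF cyl_iff_typed[OF m ir zo] z(2)] less_le_trans[OF that le] by blast
      ultimately show ?thesis by (rule typed_exclusive[OF m])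
    qed
    then have "u = take (length u) v" using le by (intro nth_equalityI) auto
    then show ?thesis using take_is_prefix by metis
  qed
  then show ?thesis using assms(2,3) nat_le_linear by blast
qed

text \<open>\<open>cylinder_density\<close> concerns a measure on the Borel sets of a complete
  second countable type. The cone measure is carried to the space of all functions along the
  inclusion, which is measurable because coordinates outside \<open>{1..m}\<close> are constant on
  the simplex.\<close>

lemma simplex_density:
  assumes ir: "irreducible_perm m \<pi>" and A: "A \<in> sets (simplex_borel m)" and \<delta>: "\<delta> > 0"
  shows "\<exists>N\<in>null_sets (cone_measure m). \<forall>x\<in>A - N. \<exists>U. open U \<and> x \<in> U \<and>
     (\<forall>w. x \<in> cyl m \<pi> w \<longrightarrow> cyl m \<pi> w \<subseteq> U \<longrightarrow>
       emeasure (cone_measure m) (cyl m \<pi> w - A) < ennreal \<delta> * emeasure (cone_measure m) (cyl m \<pi> w))"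
proof -
  interpret K: finite_measure "cone_measure m" by (rule finite_measure_cone_measure) (use m in simp)
  have sp: "space (cone_measure m) = open_simplex m"
    by (simp only: cone_measure_def space_distr space_simplex_borel)
  have idm: "(\<lambda>x. x) \<in> measurable (cone_measure m) borel"
  proof (rule measurable_coordinatewise_then_product)
    fix i
    show "(\<lambda>x. x i) \<in> borel_measurable (cone_measure m)"
    proof (cases "i \<in> {1..m}")
      case True
      from component_measurable_simplex[OF this] show ?thesis
        using measurable_cong_sets[OF sets_cone_measure refl] by blast
    next
      case False
      have "x i = undefined" if "x \<in> space (cone_measure m)" for x
        using that False unfolding sp by (auto simp: open_simplex_def extensional_def)
      then show ?thesis by (subst measurable_cong[where g = "\<lambda>_. undefined"]) auto
    qed
  qed
  define M where "M = distr (cone_measure m) borel (\<lambda>x. x)"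
  have eM: "emeasure M X = emeasure (cone_measure m) X" if X: "X \<in> sets (simplex_borel m)" for X
    unfolding M_def using emeasure_distr[OF idm simplex_borel_sets_borel[OF X]] sets.sets_into_space[of X "cone_measure m"] X
    by (simp add: Int_absorb2)
  have C: "cyl m \<pi> w \<in> sets (simplex_borel m)" for w by (rule cyl_sets[OF m ir])
  have "\<exists>N\<in>null_sets M. \<forall>x\<in>A - N. \<exists>U. open U \<and> x \<in> U \<and>
     (\<forall>w. x \<in> cyl m \<pi> w \<longrightarrow> cyl m \<pi> w \<subseteq> U \<longrightarrow> emeasure M (cyl m \<pi> w - A) < ennreal \<delta> * emeasure M (cyl m \<pi> w))"
  proof (rule cylinder_density)
    show "finite_measure M" unfolding M_def by (rule K.finite_measure_distr[OF idm])
    show "cyl m \<pi> (u @ v) \<subseteq> cyl m \<pi> u" for u v by (rule cyl_prefix[OF m ir])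
  qed (use cyl_disjoint[OF ir] simplex_borel_sets_borel[OF C] simplex_borel_sets_borel[OF A] \<delta> in \<open>auto simp: M_def\<close>)
  then obtain N where N: "N \<in> null_sets M" "\<And>x. x \<in> A - N \<Longrightarrow> \<exists>U. open U \<and> x \<in> U \<and>
     (\<forall>w. x \<in> cyl m \<pi> w \<longrightarrow> cyl m \<pi> w \<subseteq> U \<longrightarrow> emeasure M (cyl m \<pi> w - A) < ennreal \<delta> * emeasure M (cyl m \<pi> w))"
    by blast
  have "N \<inter> space (cone_measure m) \<in> null_sets (cone_measure m)"
    using N(1) measurable_sets[OF idm, of N] emeasure_distr[OF idm, of N] by (auto simp: null_sets_def M_def)
  moreover have "A - N \<inter> space (cone_measure m) = A - N"
    using sets.sets_into_space[of A "cone_measure m"] A by auto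
  ultimately show ?thesis using N(2) eM[OF C] eM[OF sets.Diff[OF C A]] by (intro bexI[of _ "N \<inter> space (cone_measure m)"]) auto
qed

lemma nondeg_cyl:
  assumes y: "(v, \<pi>) \<in> nondeg m R"
  shows "v \<in> cyl m \<pi> (map (types m (v, \<pi>)) [0..<N])"
    "snd ((rauzy_T m ^^ N) (v, \<pi>)) = rauzy_path m \<pi> (map (types m (v, \<pi>)) [0..<N])"
proof -
  have v: "v \<in> open_simplex m" "\<pi> \<in> R" using y by (auto simp: nondeg_def)
  note ir = rauzy_class_irreducible[OF m R v(2)]
  let ?w = "map (types m (v, \<pi>)) [0..<N]"
  show c: "v \<in> cyl m \<pi> ?w"
    unfolding cyl_iff_typed[OF m ir v(1)] using nondeg_typed[OF m R y] by simp
  then have "v \<in> word_map m \<pi> ?w ` pos_cone m" by (simp only: cyl_def Int_iff)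
  then obtain u where u: "v = word_map m \<pi> ?w u" "u \<in> pos_cone m" by (rule imageE)
  from rauzy_T_word_map[OF m ir u(2), of ?w]
  show "snd ((rauzy_T m ^^ N) (v, \<pi>)) = rauzy_path m \<pi> ?w"
    unfolding u(1)[symmetric] vec_normalize_id[OF v(1)] by simp
qed

lemma tail_sets_vimage:
  assumes A: "A \<in> tail_sets m R" and n: "n \<ge> 1"
  obtains B where "B \<in> sets (Delta_borel m R)" "A = (zorich_G m R ^^ (2 * n)) -` B \<inter> Delta_plus_regular m R"
proof -
  let ?D = "restrict_space (Delta_lebesgue m R) (Delta_plus m R)"
  have S: "Delta_plus m R \<subseteq> space (Delta_lebesgue m R)"
    using sets.sets_into_space[OF Delta_plus_sets[OF m R]] sets_eq_imp_space_eq[OF sets_Delta_lebesgue] by blast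
  have "zorich_G m R ^^ (2 * n) \<in> Delta_plus_regular m R \<rightarrow> space ?D"
    using regular_zorich_G_even[OF m R] S by (auto simp: space_restrict_space)
  moreover have "A \<in> sets (vimage_algebra (Delta_plus_regular m R) (zorich_G m R ^^ (2 * n)) ?D)"
    using A n by (auto simp: tail_sets_def)
  ultimately obtain B where B: "B \<in> sets ?D" "A = (zorich_G m R ^^ (2 * n)) -` B \<inter> Delta_plus_regular m R"
    by (auto simp: sets_vimage_algebra2)
  have "B \<in> sets (Delta_lebesgue m R)"
    using B(1) Delta_plus_sets[OF m R] sets_Delta_lebesgue by (auto simp: sets_restrict_space)
  then show ?thesis using that B(2) sets_Delta_lebesgue by blast
qed

lemma tail_sets_measurable:
  assumes "A \<in> tail_sets m R" shows "A \<in> sets (Delta_borel m R)" "A \<subseteq> Delta_plus_regular m R"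
proof -
  obtain B where B: "B \<in> sets (Delta_borel m R)" "A = (zorich_G m R ^^ (2 * 1)) -` B \<inter> Delta_plus_regular m R"
    using tail_sets_vimage[OF assms, of 1] by auto
  have "A = ((zorich_G m R ^^ (2 * 1)) -` B \<inter> space (Delta_borel m R)) \<inter> Delta_plus_regular m R"
    unfolding B(2) using sets.sets_into_space[OF Delta_plus_regular_sets[OF m R]] by blast
  then show "A \<in> sets (Delta_borel m R)"
    using sets.Int[OF measurable_sets[OF zorich_G_iter_measurable[OF m R] B(1)] Delta_plus_regular_sets[OF m R]] by (simp only:)
  show "A \<subseteq> Delta_plus_regular m R" unfolding B(2) by (rule Int_lower2)
qed

text \<open>Recurrence is available for the orbit of \<G>. Each of its instants is a time
  \<open>N\<close> of \<open>rauzy_T\<close> at which the letter changes, so the word before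
  \<open>N\<close> consists of whole \<G>-steps.\<close>

lemma recurrent_times:
  assumes y: "(v, \<pi>) \<in> nondeg m R" and q: "q \<noteq> []" "hd q"
    and rec: "\<exists>\<^sub>\<infinity>n. (zorich_G m R ^^ n) (v, \<pi>) \<in> cyl m \<pi> q \<times> {\<pi>}"
  defines "s \<equiv> types m (v, \<pi>)"
  shows "\<exists>N\<ge>N0. N \<ge> 1 \<and> s (N - 1) \<noteq> s N \<and> s N \<and> rauzy_path m \<pi> (map s [0..<N]) = \<pi> \<and> map s [N..<N + length q] = q
    \<and> changes_upto s N \<ge> 1"
proof -
  \<comment> \<open>The 1 excludes the trivial visit at time 0, so at least one \<G>-step precedes
    \<open>N\<close>.\<close>
  from rec[unfolded INFM_nat_le, THEN spec, of "max N0 1"]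
  obtain n where n: "n \<ge> max N0 1" "(zorich_G m R ^^ n) (v, \<pi>) \<in> cyl m \<pi> q \<times> {\<pi>}"
    by (elim exE conjE) simp
  obtain N where N: "N \<ge> n" "(zorich_G m R ^^ n) (v, \<pi>) = (rauzy_T m ^^ N) (v, \<pi>)"
    "changes_upto s N = n" "N = 0 \<or> s (N - 1) \<noteq> s N"
    unfolding s_def by (rule nondeg_zorich_G[OF m R y])
  define v' where "v' = fst ((rauzy_T m ^^ N) (v, \<pi>))"
  have v': "(rauzy_T m ^^ N) (v, \<pi>) = (v', \<pi>)" "v' \<in> cyl m \<pi> q"
    using n(2) unfolding N(2) v'_def mem_Times_iff by (simp_all add: prod_eq_iff)
  have \<pi>: "\<pi> \<in> R" using y by (simp add: nondeg_def)
  have v'o: "v' \<in> open_simplex m" using v'(2) cyl_subset[OF m] by blast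
  have sq: "s (N + i) = q ! i" if i: "i < length q" for i
  proof -
    have "typed m (q ! i) ((rauzy_T m ^^ i) (v', \<pi>))"
      using v'(2) i unfolding cyl_iff_typed[OF m rauzy_class_irreducible[OF m R \<pi>] v'o] by blast
    moreover have "(rauzy_T m ^^ i) (v', \<pi>) = (rauzy_T m ^^ (N + i)) (v, \<pi>)"
      using funpow_add[of i N "rauzy_T m"] v'(1) by (simp add: add.commute)
    ultimately have "typed m (q ! i) ((rauzy_T m ^^ (N + i)) (v, \<pi>))" by simp
    moreover have "typed m (s (N + i)) ((rauzy_T m ^^ (N + i)) (v, \<pi>))"
      unfolding s_def by (rule nondeg_typed[OF m R y])
    ultimately show ?thesis using typed_exclusive[OF m] by blast
  qed
  have "map s [N..<N + length q] = q" by (rule nth_equalityI) (use sq in auto)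
  moreover have "s N" using sq[of 0] q by (simp add: hd_conv_nth)
  moreover have "rauzy_path m \<pi> (map s [0..<N]) = \<pi>" using nondeg_cyl(2)[OF y, of N] v'(1) by (simp add: s_def)
  ultimately show ?thesis using N n by (intro exI[of _ N]) auto
qed

end

context
  fixes m :: nat and R :: "(nat \<Rightarrow> nat) set"
  assumes m: "m \<ge> 2" and R: "rauzy_class m R"
begin

text \<open>The iterate that defines \<open>A\<close> from \<open>B\<close> follows exactly the word
  \<open>w @ q @ r\<close>. Pulling a point outside \<open>B\<close> back along this word therefore
  gives a point outside \<open>A\<close>.\<close>

lemma tail_slice_image:
  assumes \<pi>: "\<pi> \<in> R" and A: "A = (zorich_G m R ^^ changes (w @ q @ r @ [True])) -` B \<inter> D"
    and w: "rauzy_path m \<pi> w = \<pi>" and r: "rauzy_path m \<pi> (q @ r) = \<pi>'" "r \<noteq> []" "\<not> last r" "\<pi>' \<in> R"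
  shows "word_img m \<pi> (w @ q @ r) (slice (Delta_plus m R - B) \<pi>') \<subseteq> cyl m \<pi> (w @ q) - slice A \<pi>"
proof
  let ?W = "w @ q @ r"
  fix z assume "z \<in> word_img m \<pi> ?W (slice (Delta_plus m R - B) \<pi>')"
  then obtain y where y: "(y, \<pi>') \<in> Delta_plus m R" "(y, \<pi>') \<notin> B" and z: "z = vec_normalize m (word_map m \<pi> ?W y)"
    unfolding word_img_def slice_def by blast
  note ir = rauzy_class_irreducible[OF m R \<pi>]
  have ty: "typed m True (y, \<pi>')" using y(1) typed_Delta(1)[OF m R, of "(y, \<pi>')"] r(4) by simp
  then have yo: "y \<in> open_simplex m" by (simp add: typed_def)
  note yp = open_simplexD(1)[OF yo]
  have W: "rauzy_path m \<pi> ?W = \<pi>'" using w r(1) by simp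
  have wp: "word_map m \<pi> ?W y \<in> pos_cone m" by (rule word_map_pos_cone[OF m ir yp])
  have zo: "z \<in> open_simplex m" unfolding z using vec_normalize_pos_cone[OF wp] m by simp
  have zc: "z \<in> cyl m \<pi> ?W"
    unfolding cyl_def using zo normalize_mem_image_iff[OF m wp, of \<pi> ?W] yp unfolding z by blast
  have T: "(rauzy_T m ^^ length ?W) (z, \<pi>) = (y, \<pi>')"
    using rauzy_T_word_map[OF m ir yp, of ?W] unfolding z[symmetric] W vec_normalize_id[OF yo] .
  have "(zorich_G m R ^^ changes (?W @ [True])) (z, \<pi>) = (y, \<pi>')"
    using zorich_G_word[OF m R zc \<pi> _ _ ty[folded T]] T r(2,3) by simp
  then have "(z, \<pi>) \<notin> A" using y(2) by (simp add: A)
  moreover have "z \<in> cyl m \<pi> (w @ q)" using zc cyl_prefix[OF m ir, of "w @ q" r] by auto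
  ultimately show "z \<in> cyl m \<pi> (w @ q) - slice A \<pi>" by (simp add: slice_def)
qed

text \<open>The order of choices matters. The word \<open>q\<close>, the continuations
  \<open>r\<close>, the count \<open>J\<close> and the constants \<open>c\<close> and \<tau> depend
  only on the given point; they determine the density precision \<open>1 / Suc k\<close>, this
  yields the neighbourhood \<open>U\<close>, and the return time \<open>N\<close> is taken
  last.\<close>

lemma tail_set_exhausts:
  assumes A: "A \<in> tail_sets m R" and y: "(v, \<pi>) \<in> A" and nd: "(v, \<pi>) \<in> nondeg m R"
    and rec: "\<And>q. v \<in> cyl m \<pi> q \<Longrightarrow> \<exists>\<^sub>\<infinity>n. (zorich_G m R ^^ n) (v, \<pi>) \<in> cyl m \<pi> q \<times> {\<pi>}"
    and dens: "\<And>k. \<exists>U. open U \<and> v \<in> U \<and> (\<forall>w. v \<in> cyl m \<pi> w \<longrightarrow> cyl m \<pi> w \<subseteq> U \<longrightarrow>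
       emeasure (cone_measure m) (cyl m \<pi> w - slice A \<pi>)
         < ennreal (1 / Suc k) * emeasure (cone_measure m) (cyl m \<pi> w))"
    and \<epsilon>: "\<epsilon> > 0"
  shows "\<exists>K B. B \<in> sets (Delta_borel m R) \<and> A = (zorich_G m R ^^ (2 * K)) -` B \<inter> Delta_plus_regular m R \<and>
    (\<forall>\<pi>'\<in>R. emeasure (cone_measure m) (slice (Delta_plus m R - B) \<pi>') \<le> ennreal \<epsilon>)"
proof -
  interpret C: finite_measure "cone_measure m" by (rule finite_measure_cone_measure) (use m in simp)
  have v: "v \<in> open_simplex m" "\<pi> \<in> R" using nd by (auto simp: nondeg_def)
  note ir = rauzy_class_irreducible[OF m R v(2)]
  have "(v, \<pi>) \<in> Delta_plus m R" using y tail_sets_measurable(2)[OF m R A] by (auto simp: Delta_plus_regular_def)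
  then have ty: "typed m True (v, \<pi>)" using typed_Delta(1)[OF m R, of "(v, \<pi>)"] v(2) by simp
  define s where "s = types m (v, \<pi>)"
  have s0: "s 0" using ty by (simp add: s_def)
  obtain n0 where n0: "\<forall>i\<in>{1..m}. \<forall>j\<in>{1..m}. word_mat m \<pi> (map s [0..<n0]) i j > 0"
    using rauzy_orbit_words(1)[OF m ir v(1) nondeg_typed[OF m R nd]] unfolding s_def by blast
  define q where "q = map s [0..<n0]"
  have pos: "word_mat m \<pi> q i j > 0" if "i \<in> {1..m}" "j \<in> {1..m}" for i j using n0 that by (simp add: q_def)
  have "n0 \<noteq> 0"
  proof
    assume "n0 = 0"
    then show False using pos[of 1 2] m by (simp add: q_def word_mat.simps mat_id_def)
  qed
  then have q: "q \<noteq> []" "hd q" using s0 by (auto simp: q_def hd_map)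
  have vq: "v \<in> cyl m \<pi> q" unfolding q_def s_def by (rule nondeg_cyl(1)[OF m R nd])
  have times: "\<exists>N\<ge>N0. N \<ge> 1 \<and> s (N - 1) \<noteq> s N \<and> s N \<and> rauzy_path m \<pi> (map s [0..<N]) = \<pi>
      \<and> map s [N..<N + length q] = q \<and> changes_upto s N \<ge> 1" for N0
    unfolding s_def by (rule recurrent_times[OF m R nd q rec[OF vq]])
  obtain J where J: "\<forall>\<pi>'\<in>R. \<exists>r. rauzy_path m \<pi> (q @ r) = \<pi>' \<and> r \<noteq> [] \<and> \<not> last r \<and> changes (q @ r @ [True]) = 2 * J"
    using rauzy_words_same_changes[OF m R v(2) q] by blast
  from bchoice[OF this] obtain r where r: "\<forall>\<pi>'\<in>R. rauzy_path m \<pi> (q @ r \<pi>') = \<pi>' \<and> r \<pi>' \<noteq> [] \<and> \<not> last (r \<pi>') \<and> changes (q @ r \<pi>' @ [True]) = 2 * J"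
    by (rule exE)
  obtain c where c: "0 < c" "c \<le> 1" "\<And>k j. k \<in> {1..m} \<Longrightarrow> j \<in> {1..m} \<Longrightarrow> c * col_sum m (word_mat m \<pi> q) j \<le> word_mat m \<pi> q k j"
    by (rule positive_mat_col_ratio[of m "word_mat m \<pi> q"]) (use pos m in auto)
  \<comment> \<open>The constant of \<open>bounded_distortion\<close> for the continuation to
    \<pi>', without the factor for the precision. As all these constants are nonnegative, their sum
    \<tau> bounds each of them.\<close>
  define t where "t \<pi>' = (mat_total m (word_mat m \<pi> (q @ r \<pi>')) / c) ^ m * measure (cone_measure m) (open_simplex m)" for \<pi>'
  have t: "t \<pi>' \<ge> 0" for \<pi>'
    unfolding t_def using mat_total_pos[OF m ir, of "q @ r \<pi>'"] c(1) by simp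
  define \<tau> where "\<tau> = sum t R"
  have t\<tau>: "t \<pi>' \<le> \<tau>" if "\<pi>' \<in> R" for \<pi>'
    unfolding \<tau>_def using t finite_rauzy_class[OF m R] that by (intro member_le_sum) auto
  obtain k :: nat where k: "\<tau> / \<epsilon> < real (Suc k)" using reals_Archimedean2 less_trans lessI of_nat_less_iff by metis
  have k\<epsilon>: "1 / Suc k * \<tau> \<le> \<epsilon>" using k \<epsilon> by (simp add: field_simps)
  obtain U where U: "open U" "v \<in> U" "\<And>w. v \<in> cyl m \<pi> w \<Longrightarrow> cyl m \<pi> w \<subseteq> U \<Longrightarrow>
       emeasure (cone_measure m) (cyl m \<pi> w - slice A \<pi>)
         < ennreal (1 / Suc k) * emeasure (cone_measure m) (cyl m \<pi> w)"
    using dens[of k] by blast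
  obtain e where e: "e > 0" "\<And>z. (\<And>i. i \<in> {1..m} \<Longrightarrow> \<bar>z i - v i\<bar> \<le> e) \<Longrightarrow> (\<And>i. i \<notin> {1..m} \<Longrightarrow> z i = v i) \<Longrightarrow> z \<in> U"
    using open_fun_coordinate_ball[OF U(1,2), of "{1..m}"] by blast
  have "\<exists>\<^sub>\<infinity>N. rauzy_path m \<pi> (map s [0..<N]) = \<pi> \<and> map s [N..<N + length q] = q"
    unfolding INFM_nat_le using times by blast
  from row_osc_recurrent[OF m ir pos this e(1)]
  obtain N1 where N1: "\<And>n. n \<ge> N1 \<Longrightarrow> row_osc m (word_mat m \<pi> (map s [0..<n])) e" by blast
  from times[of N1]
  obtain N where N: "N \<ge> N1" "N \<ge> 1" "s (N - 1) \<noteq> s N" "s N" "rauzy_path m \<pi> (map s [0..<N]) = \<pi>"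
    "map s [N..<N + length q] = q" "changes_upto s N \<ge> 1" by (elim exE conjE)
  define w where "w = map s [0..<N]"
  have wq: "w @ q = map s [0..<N + length q]"
    unfolding w_def upt_add_eq_append[of 0 N "length q", OF le0] map_append N(6) ..
  have vwq: "v \<in> cyl m \<pi> (w @ q)" unfolding wq s_def by (rule nondeg_cyl(1)[OF m R nd])
  have "cyl m \<pi> (w @ q) \<subseteq> U"
  proof
    fix z assume z: "z \<in> cyl m \<pi> (w @ q)"
    have "row_osc m (word_mat m \<pi> (w @ q)) e" unfolding wq using N1 N(1) by simp
    then have "\<bar>z i - v i\<bar> \<le> e" if "i \<in> {1..m}" for i using cyl_small[OF m ir _ vwq z that] by blast
    moreover have "z i = v i" if "i \<notin> {1..m}" for i
      using subsetD[OF cyl_subset[OF m] z] v(1) that by (auto simp: open_simplex_def extensional_def)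
    ultimately show "z \<in> U" by (rule e(2))
  qed
  from U(3)[OF vwq this]
  have small: "emeasure (cone_measure m) (cyl m \<pi> (w @ q) - slice A \<pi>)
     \<le> ennreal (1 / Suc k) * emeasure (cone_measure m) (cyl m \<pi> (w @ q))" by (rule less_imp_le)
  have cw: "changes (w @ [True]) = changes_upto s N" using N(4) by (simp add: w_def changes_upto_def)
  \<comment> \<open>The point starts in \<open>Delta_plus\<close> and is there again at time
    \<open>N\<close>, so the number of \<G>-steps up to \<open>N\<close> is even.\<close>
  have "even (changes_upto s N)" using even_changes_upto[of s N] N(4) s0 by simp
  then obtain h where h: "changes_upto s N = 2 * h" by blast
  \<comment> \<open>The count is independent of \<pi>', so a single \<open>B\<close> belongs to all
    continuations.\<close>
  have ch: "changes (w @ q @ r \<pi>' @ [True]) = 2 * (h + J)" if "\<pi>' \<in> R" for \<pi>'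
  proof -
    have "changes (w @ (q @ r \<pi>') @ [True]) = changes (w @ [True]) + changes ((q @ r \<pi>') @ [True])"
      using q by (intro changes_append_True) auto
    then show ?thesis using r that cw h by simp
  qed
  have "h + J \<ge> 1" using N(7) h by simp
  then obtain B where B: "B \<in> sets (Delta_borel m R)" "A = (zorich_G m R ^^ (2 * (h + J))) -` B \<inter> Delta_plus_regular m R"
    by (rule tail_sets_vimage[OF m R A])
  have AS: "slice A \<pi> \<in> sets (simplex_borel m)" using slice_sets[OF tail_sets_measurable(1)[OF m R A]] .
  have "emeasure (cone_measure m) (slice (Delta_plus m R - B) \<pi>') \<le> ennreal \<epsilon>" if \<pi>': "\<pi>' \<in> R" for \<pi>'
  proof -
    have pw: "rauzy_path m \<pi> w = \<pi>" using N(5) by (simp add: w_def)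
    have FS: "slice (Delta_plus m R - B) \<pi>' \<in> sets (simplex_borel m)"
      by (rule slice_sets[OF sets.Diff[OF Delta_plus_sets[OF m R] B(1)]])
    have "word_img m \<pi> (w @ q @ r \<pi>') (slice (Delta_plus m R - B) \<pi>') \<subseteq> cyl m \<pi> (w @ q) - slice A \<pi>"
      by (rule tail_slice_image[OF v(2) _ pw]) (use B(2) ch[OF \<pi>'] r \<pi>' in auto)
    from bounded_distortion[OF m ir c(1) _ FS AS this _ small] pw c(3)
    have "emeasure (cone_measure m) (slice (Delta_plus m R - B) \<pi>')
      \<le> ennreal (1 / Suc k * (mat_total m (word_mat m \<pi> (q @ r \<pi>')) / c) ^ m) * emeasure (cone_measure m) (open_simplex m)"
      by simp
    also have "\<dots> = ennreal (1 / Suc k * t \<pi>')"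
    proof -
      have "0 \<le> 1 / Suc k * (mat_total m (word_mat m \<pi> (q @ r \<pi>')) / c) ^ m"
        using mat_total_pos[OF m ir, of "q @ r \<pi>'"] c(1) by simp
      then show ?thesis by (simp add: t_def C.emeasure_eq_measure ennreal_mult[symmetric] mult.assoc)
    qed
    also have "\<dots> \<le> ennreal \<epsilon>"
    proof (rule ennreal_leI)
      have "1 / Suc k * t \<pi>' \<le> 1 / Suc k * \<tau>" using t\<tau>[OF \<pi>'] by (intro mult_left_mono) auto
      then show "1 / Suc k * t \<pi>' \<le> \<epsilon>" using k\<epsilon> by simp
    qed
    finally show ?thesis .
  qed
  then show ?thesis using B by blast
qed

end

theorem proposition1:
  fixes m :: nat
    and R :: "(nat \<Rightarrow> nat) set"
    and \<nu> :: "((nat \<Rightarrow> real) \<times> (nat \<Rightarrow> nat)) measure"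
  assumes "m \<ge> 2"
    and "rauzy_class m R"
    and "zorich_measure m R \<nu>"
  shows "\<forall>A \<in> tail_sets m R.
           A \<in> null_sets (restrict_space \<nu> (Delta_plus m R)) \<or>
           Delta_plus m R - A \<in> null_sets (restrict_space \<nu> (Delta_plus m R))"
proof
  note m = assms(1) and R = assms(2) and \<nu> = assms(3)
  interpret prob_space \<nu> by (rule zorich_prob[OF m R \<nu>])
  note sets_\<nu> = sets_zorich[OF m R \<nu>]
  fix A assume A: "A \<in> tail_sets m R"
  have AS: "A \<in> sets \<nu>" using tail_sets_measurable(1)[OF m R A] sets_\<nu> by simp
  have Ap: "A \<subseteq> Delta_plus m R" using tail_sets_measurable(2)[OF m R A] by (auto simp: Delta_plus_regular_def)
  have PS: "Delta_plus m R \<in> sets \<nu>" using Delta_plus_sets[OF m R] sets_\<nu> by simp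
  have Gm: "zorich_G m R ^^ n \<in> measurable \<nu> \<nu>" for n
    using zorich_G_iter_measurable[OF m R, of n] measurable_cong_sets[OF sets_\<nu> sets_\<nu>] by simp
  have "\<forall>\<pi>\<in>R. \<forall>k. \<exists>N. N \<in> null_sets (cone_measure m) \<and> (\<forall>x\<in>slice A \<pi> - N. \<exists>U. open U \<and> x \<in> U \<and>
     (\<forall>w. x \<in> cyl m \<pi> w \<longrightarrow> cyl m \<pi> w \<subseteq> U \<longrightarrow> emeasure (cone_measure m) (cyl m \<pi> w - slice A \<pi>)
        < ennreal (1 / Suc k) * emeasure (cone_measure m) (cyl m \<pi> w)))"
    using simplex_density[OF m R rauzy_class_irreducible[OF m R] slice_sets[OF tail_sets_measurable(1)[OF m R A]]]
    by (simp add: Bex_def)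
  then obtain N where N: "\<And>\<pi> k. \<pi> \<in> R \<Longrightarrow> N \<pi> k \<in> null_sets (cone_measure m)"
    "\<And>\<pi> k x. \<pi> \<in> R \<Longrightarrow> x \<in> slice A \<pi> - N \<pi> k \<Longrightarrow> \<exists>U. open U \<and> x \<in> U \<and>
     (\<forall>w. x \<in> cyl m \<pi> w \<longrightarrow> cyl m \<pi> w \<subseteq> U \<longrightarrow> emeasure (cone_measure m) (cyl m \<pi> w - slice A \<pi>)
        < ennreal (1 / Suc k) * emeasure (cone_measure m) (cyl m \<pi> w))" by metis
  \<comment> \<open>The points of \<open>A\<close> that fail to be density points at one of the
    countably many precisions are contained here.\<close>
  define Bad where "Bad = (\<Union>\<pi>\<in>R. (\<Union>k. N \<pi> k) \<times> {\<pi>})"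
  have Nn: "(\<Union>k. N \<pi> k) \<in> null_sets (cone_measure m)" if "\<pi> \<in> R" for \<pi>
    using N(1)[OF that] by (intro null_sets_UN) auto
  have Bad: "Bad \<in> null_sets \<nu>"
  proof (rule zorich_null[OF m R \<nu>])
    have "(\<Union>k. N \<pi> k) \<times> {\<pi>} \<in> sets (Delta_borel m R)" if "\<pi> \<in> R" for \<pi>
      using Nn[OF that] that by (intro pair_measureI) (auto simp: null_sets_def)
    then show "Bad \<in> sets (Delta_borel m R)"
      unfolding Bad_def using finite_rauzy_class[OF m R] by (intro sets.finite_UN) auto
    show "slice Bad \<pi> \<in> null_sets (cone_measure m)" if "\<pi> \<in> R" for \<pi>
    proof -
      have "slice Bad \<pi> = (\<Union>k. N \<pi> k)" using that by (auto simp: Bad_def slice_def)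
      then show ?thesis using Nn[OF that] by simp
    qed
  qed
  have good: "AE y in \<nu>. y \<notin> Bad \<and> y \<in> nondeg m R \<and>
     (\<forall>\<pi>\<in>R. \<forall>q. y \<in> cyl m \<pi> q \<times> {\<pi>} \<longrightarrow> (\<exists>\<^sub>\<infinity>n. (zorich_G m R ^^ n) y \<in> cyl m \<pi> q \<times> {\<pi>}))"
    using AE_not_in[OF Bad] AE_not_in[OF zorich_nondeg[OF m R \<nu>]] zorich_recurrent_words[OF m R \<nu>] AE_space
    by eventually_elim (auto simp: space_zorich[OF m R \<nu>])
  show "A \<in> null_sets (restrict_space \<nu> (Delta_plus m R)) \<or>
           Delta_plus m R - A \<in> null_sets (restrict_space \<nu> (Delta_plus m R))"
  \<comment> \<open>A single good point in \<open>A\<close> already forces full measure. If there is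
    none, \<open>A\<close> lies in the null set of points that are not good.\<close>
  proof (cases "\<exists>y\<in>A. y \<notin> Bad \<and> y \<in> nondeg m R \<and>
     (\<forall>\<pi>\<in>R. \<forall>q. y \<in> cyl m \<pi> q \<times> {\<pi>} \<longrightarrow> (\<exists>\<^sub>\<infinity>n. (zorich_G m R ^^ n) y \<in> cyl m \<pi> q \<times> {\<pi>}))")
    case False
    have "AE y in \<nu>. y \<notin> A" using good by eventually_elim (use False in blast)
    then have "A \<in> null_sets \<nu>" using AE_iff_null_sets[OF AS] by simp
    then show ?thesis using PS Ap by (simp add: null_sets_restrict_space)
  next
    case True
    then obtain v \<pi> where y: "(v, \<pi>) \<in> A" "(v, \<pi>) \<notin> Bad" "(v, \<pi>) \<in> nondeg m R"
      "\<And>\<pi>' q. \<pi>' \<in> R \<Longrightarrow> (v, \<pi>) \<in> cyl m \<pi>' q \<times> {\<pi>'} \<Longrightarrow> \<exists>\<^sub>\<infinity>n. (zorich_G m R ^^ n) (v, \<pi>) \<in> cyl m \<pi>' q \<times> {\<pi>'}"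
      by (metis surj_pair)
    have \<pi>: "\<pi> \<in> R" using y(3) by (simp add: nondeg_def)
    have "emeasure \<nu> (Delta_plus m R - A) \<le> ennreal \<epsilon>" if \<epsilon>: "\<epsilon> > 0" for \<epsilon>
    proof -
      obtain \<delta> where \<delta>: "\<delta> > 0" "\<And>X. X \<in> sets (Delta_borel m R) \<Longrightarrow>
        (\<forall>\<pi>\<in>R. emeasure (cone_measure m) (slice X \<pi>) \<le> ennreal \<delta>) \<Longrightarrow> emeasure \<nu> X \<le> ennreal \<epsilon>"
        using zorich_small[OF m R \<nu> \<epsilon>] by blast
      have "v \<in> slice A \<pi> - N \<pi> k" for k using y(1,2) \<pi> by (auto simp: slice_def Bad_def)
      note dens = N(2)[OF \<pi> this]
      have rec: "\<exists>\<^sub>\<infinity>n. (zorich_G m R ^^ n) (v, \<pi>) \<in> cyl m \<pi> q \<times> {\<pi>}" if "v \<in> cyl m \<pi> q" for q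
        using y(4)[OF \<pi>, of q] that by blast
      obtain K B where B: "B \<in> sets (Delta_borel m R)" "A = (zorich_G m R ^^ (2 * K)) -` B \<inter> Delta_plus_regular m R"
        "\<forall>\<pi>'\<in>R. emeasure (cone_measure m) (slice (Delta_plus m R - B) \<pi>') \<le> ennreal \<delta>"
        using tail_set_exhausts[OF m R A y(1,3) rec dens \<delta>(1)] by blast
      let ?X = "Delta_plus m R - B"
      have X: "?X \<in> sets \<nu>" using PS B(1) sets_\<nu> by auto
      have X\<epsilon>: "emeasure \<nu> ?X \<le> ennreal \<epsilon>" using \<delta>(2)[OF _ B(3)] X sets_\<nu> by simp
      let ?V = "(zorich_G m R ^^ (2 * K)) -` ?X \<inter> space \<nu>"
      \<comment> \<open>Almost every point of \<open>Delta_plus\<close> is regular, so its image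
        under the iterate is in \<open>Delta_plus\<close>; if the point is outside \<open>A\<close>,
        that image is outside \<open>B\<close>. Invariance then gives the preimage \<open>?V\<close>
        the measure of \<open>?X\<close>, however large \<open>K\<close> is.\<close>
      have "AE x in \<nu>. x \<in> Delta_plus m R - A \<longrightarrow> x \<in> ?V"
        using good AE_space
      proof eventually_elim
        case (elim x)
        show ?case
        proof
          assume x: "x \<in> Delta_plus m R - A"
          then have reg: "x \<in> Delta_plus_regular m R" using nondeg_regular[OF m R] elim(1) by blast
          then have "(zorich_G m R ^^ (2 * K)) x \<in> Delta_plus m R" by (rule regular_zorich_G_even[OF m R])
          then show "x \<in> ?V" using x reg elim(2) B(2) by blast
        qed
      qed
      then have "emeasure \<nu> (Delta_plus m R - A) \<le> emeasure \<nu> ?V"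
        using measurable_sets[OF Gm X] by (rule emeasure_mono_AE)
      also have "\<dots> = emeasure \<nu> ?X"
      proof (rule emeasure_vimage_funpow[OF zorich_G_measurable_\<nu>[OF m R \<nu>] _ X])
        show "emeasure \<nu> (zorich_G m R -` Y \<inter> space \<nu>) = emeasure \<nu> Y" if "Y \<in> sets \<nu>" for Y
          using \<nu> that by (simp add: zorich_measure_def)
      qed
      also note X\<epsilon>
      finally show ?thesis .
    qed
    then have "emeasure \<nu> (Delta_plus m R - A) \<le> 0 + ennreal \<epsilon>" if "\<epsilon> > 0" for \<epsilon>
      using that by (simp only: add_0)
    then have "emeasure \<nu> (Delta_plus m R - A) \<le> 0" by (rule ennreal_le_epsilon)
    then have "Delta_plus m R - A \<in> null_sets \<nu>" using PS AS by (intro null_setsI) auto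
    then show ?thesis using PS by (subst null_sets_restrict_space) auto
  qed
qed

end
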